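(* Let $d\geq 2$, let $A$ and $B$ be convex bodies in $\mathbb{R}^d$, let $\alpha,\beta>0$, and let $L$ be a linear $(d-1)$-dimensional subspace of $\mathbb{R}^d$. Let $M$ and $N$ be the maximal $(d-1)$-volumes of the sections of $A$ and $B$, respectively, by hyperplanes parallel to $L$. Then the equality $$ \mu_d(\alpha A+\beta B)= \left(\alpha M^{\frac1{d-1}}+\beta N^{\frac1{d-1}}\right)^{d-1} \left(\alpha\,\frac{\mu_d(A)}{M}+\beta\,\frac{\mu_d(B)}{N}\right) $$ holds if and only if either $A$ and $B$ are homothetic, or there exist $v\in S^{d-1}$, homothetic convex bodies $A'$ and $B'$ in $\mathbb{R}^d$, and a hyperplane $H$ parallel to $L$, such that $\pi_v(A')=\pi_v(A'\cap H)$, and $A$ and $B$ are obtained from $A'$ and $B'$, respectively, by stretching along $v$.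
   Context: A convex body in $\mathbb{R}^d$ is a compact convex set with non-empty interior. $\mu_k$ denotes $k$-dimensional Lebesgue measure; the $(d-1)$-volume of a section of a body by a hyperplane is its $(d-1)$-dimensional Lebesgue measure within that hyperplane. $S^{d-1}$ is the unit sphere in $\mathbb{R}^d$. The set $\alpha A+\beta B=\{\alpha a+\beta b:\ a\in A,\ b\in B\}$ is the Minkowski linear combination. Hyperplanes are affine; a hyperplane is parallel to $L$ if it is a translate of $L$. Two convex bodies are homothetic if one is of the form $x+rK$ with $x\in\mathbb{R}^d$, $r>0$, where $K$ is the other. For $v\in S^{d-1}$, $\pi_v$ denotes the orthogonal projection of $\mathbb{R}^d$ onto the hyperplane $v^\perp$. $[x,y]$ denotes the segment (convex hull) of the points $x,y$. For $v\in S^{d-1}$, a convex body $K$ is said to be obtained from a convex body $C$ by stretching along $v$ if there exist $\lambda\geq 0$ and $w\in\mathbb{R}^d$ such that $K=C+[w,w+\lambda v]$ (Minkowski sum); in particular $K=C+w$ if $\lambda=0$. *)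

theory Defs
  imports "HOL-Analysis.Analysis" "HOL-Library.Set_Algebras"
begin

definition convex_body :: "'a::euclidean_space set \<Rightarrow> bool" where
  "convex_body K \<longleftrightarrow> compact K \<and> convex K \<and> interior K \<noteq> {}"

definition homothetic :: "'a::real_vector set \<Rightarrow> 'a set \<Rightarrow> bool" where
  "homothetic A B \<longleftrightarrow>
     (\<exists>x r. r > 0 \<and> (A = (\<lambda>y. x + r *\<^sub>R y) ` B \<or> B = (\<lambda>y. x + r *\<^sub>R y) ` A))"

text \<open>
  Lebesgue measure within a nonempty affine subspace \<open>H\<close> (of dimension \<open>aff_dim H\<close>), as a
  measure on the Borel sets of the ambient space that is concentrated on \<open>H\<close>. It is the image of
  the product Lebesgue measure under Cartesian coordinates on \<open>H\<close>: an origin \<open>p\<close> in \<open>H\<close> and an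
  orthonormal basis \<open>E\<close> of the direction space of \<open>H\<close>, just as \<open>lborel\<close> itself is built from
  \<open>Basis\<close>. By translation and rotation invariance the result does not depend on the choices.
\<close>
definition flat_lborel :: "'a::euclidean_space set \<Rightarrow> 'a measure" where
  "flat_lborel H =
     (let p = (SOME p. p \<in> H);
          E = (SOME E. pairwise orthogonal E \<and> (\<forall>e\<in>E. norm e = 1) \<and>
                       span E = (\<lambda>x. x - p) ` H)
      in distr (Pi\<^sub>M E (\<lambda>_. lborel)) borel (\<lambda>f. p + (\<Sum>e\<in>E. f e *\<^sub>R e)))"

text \<open>
  The greatest volume of a section of \<open>A\<close> by a translate of \<open>L\<close>. For compact \<open>A\<close> the maximum
  is attained, so \<open>Greatest\<close> is well defined.
\<close>
definition max_section :: "'a::euclidean_space set \<Rightarrow> 'a set \<Rightarrow> real" where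
  "max_section L A =
     (GREATEST m. \<exists>H. affine_parallel L H \<and> m = measure (flat_lborel H) (A \<inter> H))"

text \<open>Orthogonal projection onto the hyperplane orthogonal to \<open>v\<close>; \<open>v\<close> must be a unit vector.\<close>
definition proj_perp :: "'a::real_inner \<Rightarrow> 'a \<Rightarrow> 'a" where
  "proj_perp v x = x - (x \<bullet> v) *\<^sub>R v"

text \<open>\<open>stretching v C K\<close>: the body \<open>K\<close> is obtained from \<open>C\<close> by stretching along \<open>v\<close>.\<close>
definition stretching :: "'a::euclidean_space \<Rightarrow> 'a set \<Rightarrow> 'a set \<Rightarrow> bool" where
  "stretching v C K \<longleftrightarrow> (\<exists>l\<ge>0. \<exists>w. K = C + closed_segment w (w + l *\<^sub>R v))"

end

theory Submission
  imports Defs "HOL-Probability.Probability"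
begin

text \<open>
  Let \<open>n = d - 1\<close>, and let \<open>u\<close> be a unit normal of \<open>L\<close>. Dividing each body by the \<open>n\<close>-th root of its largest section volume turns the
  equality into \<open>vol (p A + q B) = p vol A + q vol B\<close> with \<open>p + q = 1\<close>, for bodies whose largest sections
  have volume one. Put \<open>C = p A + q B\<close>, and consider the section volume of each body as a function of the level, its profile.
  By the Brunn-Minkowski inequality for sections (\<open>sec_brunn_minkowski\<close>), the superlevel set of the profile of \<open>C\<close> at any height up
  to one contains the combination of those of \<open>A\<close> and \<open>B\<close>. Integrating lengths over all heights gives Bonnesen's inequality
  \<open>vol C \<ge> p vol A + q vol B\<close>, and equality leaves no room: the ends of the superlevel intervals of \<open>C\<close> are the combinations of
  those of \<open>A\<close> and \<open>B\<close>, and \<open>C\<close> has no section of volume greater than one.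

  Let \<open>a r\<close> and \<open>b r\<close> be the left ends of the superlevel intervals of \<open>A\<close> and \<open>B\<close> at height \<open>r ^ n\<close>. Combining points at different heights gives
  \<open>p a r + q b r' \<ge> p a m + q b m\<close> for \<open>m = p r + q r'\<close>, and a pair of continuous functions with this property differs by a
  constant (\<open>diff_const_if_diagonal_maximal\<close>). So, up to shifts, the profiles of \<open>A\<close>, \<open>B\<close> and \<open>C\<close> agree to the left of their maxima
  (\<open>profiles_agree_left\<close>). The caps cut off there have equal volumes, and the cap of \<open>C\<close> contains the
  combination of the caps of \<open>A\<close> and \<open>B\<close>. By the equality case of the Brunn-Minkowski inequality the caps of \<open>A\<close> and \<open>B\<close> are
  translates (\<open>left_translate\<close>), and by symmetry so are the caps on the right.

  That equality case (\<open>brunn_minkowski_equality\<close>) follows from the inequality by the same principle: in each direction the levels that cut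
  off given volumes from the two bodies differ by a constant, and comparison of centroids shows that this constant is a
  linear function of the direction.

  Between their caps \<open>A\<close>, \<open>B\<close> and \<open>C\<close> are cylinders over translates of one section \<open>P\<close>, by the equality case for
  sections. If neither \<open>A\<close> nor \<open>B\<close> has a cylindrical part of positive height, the bodies are translates. Otherwise the axes of the cylinders are parallel, both bodies
  lie over translates of \<open>P\<close> in the direction of the axis, and the body with the shorter cylinder becomes a translate of the other one by
  stretching along the axis (\<open>equality_structure\<close>).

  Conversely, stretching a body that lies over one of its sections inserts a cylinder, which adds an explicit volume and does not change the
  largest section volume. Stretched copies of one body are closed under Minkowski combinations, and
  the equality becomes a polynomial identity (\<open>equality_for_stretched\<close>).
\<close>

section \<open>Minkowski combinations and cuts by hyperplanes\<close>

definition mcomb :: "real \<Rightarrow> 'a::real_vector set \<Rightarrow> real \<Rightarrow> 'a set \<Rightarrow> 'a set" where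
  "mcomb p A q B = {p *\<^sub>R a + q *\<^sub>R b |a b. a \<in> A \<and> b \<in> B}"

lemma mcombI: "a \<in> A \<Longrightarrow> b \<in> B \<Longrightarrow> p *\<^sub>R a + q *\<^sub>R b \<in> mcomb p A q B"
  by (auto simp: mcomb_def)

lemma mcomb_eq: "mcomb p A q B = (*\<^sub>R) p ` A + (*\<^sub>R) q ` B"
  by (auto simp: mcomb_def set_plus_def)

lemma compact_mcomb:
  fixes A B :: "'a::real_normed_vector set"
  shows "compact A \<Longrightarrow> compact B \<Longrightarrow> compact (mcomb p A q B)"
  unfolding mcomb_eq set_plus_image
  by (intro compact_continuous_image compact_Times compact_scaling continuous_intros)
     (auto intro!: continuous_intros simp: case_prod_beta)

lemma convex_mcomb: "convex A \<Longrightarrow> convex B \<Longrightarrow> convex (mcomb p A q B)"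
  unfolding mcomb_eq by (intro convex_set_plus convex_scaling)

abbreviation vol :: "'a::euclidean_space set \<Rightarrow> real" where
  "vol \<equiv> measure lebesgue"

lemma vol_scale: "vol ((*\<^sub>R) c ` S) = \<bar>c\<bar> ^ DIM('a) * vol (S :: 'a::euclidean_space set)"
  using measure_lebesgue_affine[of c 0 S] by simp

lemma vol_cut_add:
  fixes A :: "'a::euclidean_space set"
  assumes "A \<in> lmeasurable" "u \<noteq> 0"
  shows "vol A = vol (A \<inter> {x. x \<bullet> u < t}) + vol (A \<inter> {x. x \<bullet> u > t})"
proof -
  have s: "{x. x \<bullet> u < t} \<in> sets lebesgue" "{x. x \<bullet> u > t} \<in> sets lebesgue"
    using open_halfspace_lt[of u t] open_halfspace_gt[of t u]
    by (auto simp: inner_commute intro!: sets_completionI_sets borel_open)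
  have m: "A \<inter> {x. x \<bullet> u < t} \<in> lmeasurable" "A \<inter> {x. x \<bullet> u > t} \<in> lmeasurable"
    using s assms by (auto intro: fmeasurable_Int_fmeasurable)
  have n: "negligible {x. x \<bullet> u = t}"
    using negligible_hyperplane[of u t] assms by (simp add: inner_commute)
  have "vol A = vol ((A \<inter> {x. x \<bullet> u < t}) \<union> (A \<inter> {x. x \<bullet> u > t}))"
  proof (rule measure_negligible_symdiff)
    show "negligible (sym_diff ((A \<inter> {x. x \<bullet> u < t}) \<union> (A \<inter> {x. x \<bullet> u > t})) A)"
      by (rule negligible_subset[OF n]) auto
  qed (use m in auto)
  also have "\<dots> = vol (A \<inter> {x. x \<bullet> u < t}) + vol (A \<inter> {x. x \<bullet> u > t})"
    using m by (intro measure_Un2[THEN trans]) (auto intro!: arg_cong[of _ _ vol])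
  finally show ?thesis .
qed

lemma bounded_vol_outside:
  fixes A :: "'a::euclidean_space set"
  assumes "bounded A" "u \<noteq> 0"
  obtains lo hi where "\<And>x. x \<in> A \<Longrightarrow> lo < x \<bullet> u \<and> x \<bullet> u < hi"
proof -
  have "bounded ((\<lambda>x. x \<bullet> u) ` A)"
    using assms(1) bounded_linear_inner_left by (rule bounded_linear_image)
  then obtain B where "\<forall>y\<in>(\<lambda>x. x \<bullet> u) ` A. \<bar>y\<bar> \<le> B"
    by (auto simp: bounded_iff)
  then show ?thesis by (intro that[of "-B-1" "B+1"]) force
qed

text \<open>As a function of \<open>t\<close> this is the distribution function of the functional \<open>x \<bullet> u\<close> on \<open>A\<close>, which has
  no atoms because hyperplanes are null sets.\<close>
lemma continuous_vol_cut:
  fixes A :: "'a::euclidean_space set"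
  assumes A: "A \<in> lmeasurable" and u: "u \<noteq> 0"
  shows "continuous_on UNIV (\<lambda>t. vol (A \<inter> {x. x \<bullet> u < t}))"
proof -
  let ?M = "distr (restrict_space lebesgue A) borel (\<lambda>x. x \<bullet> u)"
  have A': "A \<in> sets lebesgue" using A by (rule fmeasurableD)
  have "finite_measure (lebesgue_on A)" by (rule finite_measure_lebesgue_on[OF A])
  moreover have meas: "(\<lambda>x. x \<bullet> u) \<in> borel_measurable (lebesgue_on A)"
    by (intro measurable_restrict_space1 measurable_completion) simp
  ultimately have fb: "finite_borel_measure ?M"
    by (auto simp: finite_borel_measure_def finite_borel_measure_axioms_def intro!: finite_measure.finite_measure_distr)
  then interpret finite_borel_measure ?M .
  have msr: "measure ?M S = vol (A \<inter> {x. x \<bullet> u \<in> S})" if "S \<in> sets borel" for S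
  proof -
    have "measure ?M S = measure (lebesgue_on A) ((\<lambda>x. x \<bullet> u) -` S \<inter> space (lebesgue_on A))"
      using meas that by (rule measure_distr)
    also have "\<dots> = vol ((\<lambda>x. x \<bullet> u) -` S \<inter> space (lebesgue_on A))"
      using A' by (intro measure_restrict_space) (auto)
    also have "(\<lambda>x. x \<bullet> u) -` S \<inter> space (lebesgue_on A) = A \<inter> {x. x \<bullet> u \<in> S}"
      by auto
    finally show ?thesis .
  qed
  have hyp: "vol (A \<inter> {x. x \<bullet> u = t}) = 0" for t
  proof -
    have "negligible {x. x \<bullet> u = t}"
      using negligible_hyperplane[of u t] u by (simp add: inner_commute)
    then have "negligible (A \<inter> {x. x \<bullet> u = t})" by (rule negligible_subset) auto
    then show ?thesis by (simp add: negligible_imp_measure0)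
  qed
  have z: "measure ?M {t} = 0" for t
    using msr[of "{t}"] hyp by simp
  have eq: "cdf ?M = (\<lambda>t. vol (A \<inter> {x. x \<bullet> u < t}))"
  proof
    fix t
    have "{..t} = {..<t} \<union> {t::real}" by auto
    then have "measure ?M {..t} = measure ?M {..<t} + measure ?M {t}"
      by (simp add: finite_measure_Union[symmetric] del: Un_insert_right)
    then show "cdf ?M t = vol (A \<inter> {x. x \<bullet> u < t})"
      using z[of t] msr[of "{..<t}"] by (simp add: cdf_def)
  qed
  show ?thesis
    unfolding eq[symmetric] continuous_on_eq_continuous_at[OF open_UNIV] using z isCont_cdf by auto
qed

lemma vol_cut_eq_fraction:
  fixes A :: "'a::euclidean_space set"
  assumes A: "A \<in> lmeasurable" "bounded A" and u: "u \<noteq> 0" and r: "0 < r" "r < vol A"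
  obtains t where "vol (A \<inter> {x. x \<bullet> u < t}) = r"
proof -
  obtain lo hi where lh: "\<And>x. x \<in> A \<Longrightarrow> lo < x \<bullet> u \<and> x \<bullet> u < hi"
    using bounded_vol_outside[OF A(2) u] by blast
  have e: "A \<inter> {x. x \<bullet> u < lo} = {}" "A \<inter> {x. x \<bullet> u < hi} = A" using lh by force+
  have "A \<noteq> {}" using r by auto
  then have "lo \<le> hi" using lh by fastforce
  then have "\<exists>t. lo \<le> t \<and> t \<le> hi \<and> vol (A \<inter> {x. x \<bullet> u < t}) = r"
    using e r by (intro IVT') (auto intro: continuous_on_subset[OF continuous_vol_cut[OF A(1) u]])
  then show ?thesis using that by blast
qed

section \<open>The Brunn-Minkowski inequality\<close>

definition obox :: "'a::euclidean_space set \<Rightarrow> bool" where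
  "obox X \<longleftrightarrow> X \<noteq> {} \<and> (\<exists>a b. X = box a b)"

lemma box_sum:
  fixes a b c e :: "'a::euclidean_space"
  assumes "box a b \<noteq> {}" "box c e \<noteq> {}"
  shows "box (a + c) (b + e) \<subseteq> box a b + box c e"
proof
  fix z assume z: "z \<in> box (a + c) (b + e)"
  have ab: "\<forall>i\<in>Basis. a \<bullet> i < b \<bullet> i" "\<forall>i\<in>Basis. c \<bullet> i < e \<bullet> i"
    using assms by (auto simp: box_ne_empty)
  \<comment> \<open>Divide the position of \<open>z\<close> between the two boxes proportionally to their widths.\<close>
  define l where "l i = (z \<bullet> i - (a + c) \<bullet> i) / ((b + e) \<bullet> i - (a + c) \<bullet> i)" for i
  define x where "x = (\<Sum>i\<in>Basis. (a \<bullet> i + l i * (b \<bullet> i - a \<bullet> i)) *\<^sub>R i)"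
  have zb: "(a + c) \<bullet> i < z \<bullet> i \<and> z \<bullet> i < (b + e) \<bullet> i" if "i \<in> Basis" for i
    using z that by (auto simp: box_def)
  have l: "0 < l i \<and> l i < 1" if "i \<in> Basis" for i
    using zb[OF that] unfolding l_def by (intro conjI divide_pos_pos) (auto simp: divide_less_eq_1)
  have lz: "z \<bullet> i = (a + c) \<bullet> i + l i * ((b + e) \<bullet> i - (a + c) \<bullet> i)" if "i \<in> Basis" for i
    using zb[OF that] unfolding l_def by auto
  have lab: "0 < l i * (b \<bullet> i - a \<bullet> i)" "l i * (b \<bullet> i - a \<bullet> i) < 1 * (b \<bullet> i - a \<bullet> i)" if "i \<in> Basis" for i
    using l[OF that] ab that by (auto intro!: mult_strict_right_mono)
  have "x \<in> box a b"
    using lab by (force simp: x_def box_def)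
  moreover have "z - x \<in> box c e"
  proof -
    have "(z - x) \<bullet> i = c \<bullet> i + l i * (e \<bullet> i - c \<bullet> i)" if "i \<in> Basis" for i
    proof -
      have "x \<bullet> i = a \<bullet> i + l i * (b \<bullet> i - a \<bullet> i)" using that by (simp add: x_def)
      then show ?thesis using lz[OF that] by (simp add: inner_diff_left inner_add_left algebra_simps)
    qed
    moreover have "0 < l i * (e \<bullet> i - c \<bullet> i)" "l i * (e \<bullet> i - c \<bullet> i) < 1 * (e \<bullet> i - c \<bullet> i)" if "i \<in> Basis" for i
      using l[OF that] ab that by (auto intro: mult_strict_right_mono)
    ultimately show ?thesis by (force simp: box_def)
  qed
  ultimately show "z \<in> box a b + box c e"
    by (metis add_diff_cancel_left' add_diff_eq set_plus_intro)
qed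

text \<open>Divide by the right-hand side and add the inequalities between the arithmetic and the geometric mean
  for the numbers \<open>x i / (x i + y i)\<close> and for the numbers \<open>y i / (x i + y i)\<close>.\<close>
lemma prod_add_ge_geom:
  fixes x y :: "'i \<Rightarrow> real"
  assumes I: "finite I" "I \<noteq> {}" and x: "\<And>i. i \<in> I \<Longrightarrow> x i > 0" and y: "\<And>i. i \<in> I \<Longrightarrow> y i > 0"
    and a: "a > 0" "prod x I = a ^ card I" and b: "b > 0" "prod y I = b ^ card I"
  shows "(a + b) ^ card I \<le> (\<Prod>i\<in>I. x i + y i)"
proof -
  let ?n = "card I"
  have n: "?n > 0" using I by (simp add: card_gt_0_iff)
  define z where "z = (\<Prod>i\<in>I. x i + y i)"
  have z0: "z > 0" unfolding z_def using x y by (intro prod_pos) (auto intro: add_pos_pos)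
  define c where "c = root ?n z"
  have c: "c > 0" "c ^ ?n = z" using n z0 by (auto simp: c_def real_root_pow_pos)
  have am: "w / c \<le> (\<Sum>i\<in>I. s i / (x i + y i) / ?n)"
    if s: "\<And>i. i \<in> I \<Longrightarrow> s i > 0" "w > 0" "prod s I = w ^ ?n" for s w
  proof -
    have "(\<Prod>i\<in>I. s i / (x i + y i)) = (w / c) ^ ?n"
      using s c by (simp add: prod_dividef power_divide z_def)
    moreover have "((w / c) ^ ?n) powr (1 / ?n) = w / c"
      using n s c by (simp add: powr_realpow[symmetric] powr_powr)
    moreover have "0 \<le> s i / (x i + y i)" if "i \<in> I" for i
      using s(1)[OF that] x[OF that] y[OF that] by simp
    ultimately show ?thesis
      using arith_geom_mean[OF I, of "\<lambda>i. s i / (x i + y i)"] by simp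
  qed
  have "a / c + b / c \<le> (\<Sum>i\<in>I. x i / (x i + y i) / ?n) + (\<Sum>i\<in>I. y i / (x i + y i) / ?n)"
    using am[of x a] am[of y b] x y a b by (intro add_mono) auto
  also have "\<dots> = (\<Sum>i\<in>I. 1 / real ?n)"
    unfolding sum.distrib[symmetric]
  proof (rule sum.cong)
    fix i assume "i \<in> I"
    then have "x i + y i \<noteq> 0" using x[of i] y[of i] by linarith
    then have "x i / (x i + y i) + y i / (x i + y i) = 1" by (simp add: add_divide_distrib[symmetric])
    then show "x i / (x i + y i) / real ?n + y i / (x i + y i) / real ?n = 1 / real ?n"
      by (metis add_divide_distrib)
  qed simp
  also have "\<dots> = 1" using n by simp
  finally have "a + b \<le> c" using c by (simp add: field_simps)
  then have "(a + b) ^ ?n \<le> c ^ ?n" using a b by (intro power_mono) auto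
  then show ?thesis using c by (simp add: z_def)
qed

lemma open_add_set: "open A \<Longrightarrow> open (A + B)" for A :: "'a::real_normed_vector set"
proof -
  assume "open A"
  moreover have "A + B = (\<Union>b\<in>B. (+) b ` A)"
    by (auto simp: set_plus_def) (metis add.commute image_iff)
  ultimately show ?thesis by (auto intro: open_translation)
qed

lemma bounded_add_set: "bounded A \<Longrightarrow> bounded B \<Longrightarrow> bounded (A + B)" for A :: "'a::real_normed_vector set"
proof -
  assume "bounded A" "bounded B"
  moreover have "A + B = (\<Union>x\<in>A. \<Union>y\<in>B. {x + y})" by (auto simp: set_plus_def)
  ultimately show ?thesis using bounded_sums[of A B] by simp
qed

lemma lmeasurable_add_set:
  "open A \<Longrightarrow> bounded A \<Longrightarrow> bounded B \<Longrightarrow> A + B \<in> lmeasurable" for A :: "'a::euclidean_space set"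
  by (intro lmeasurable_open bounded_add_set open_add_set)

lemma brunn_minkowski_box:
  fixes X Y :: "'a::euclidean_space set"
  assumes "obox X" "obox Y" "a > 0" "b > 0" "vol X = a ^ DIM('a)" "vol Y = b ^ DIM('a)"
  shows "(a + b) ^ DIM('a) \<le> vol (X + Y)"
proof -
  obtain l u where X: "X = box l u" "box l u \<noteq> {}" using assms by (auto simp: obox_def)
  obtain l' u' where Y: "Y = box l' u'" "box l' u' \<noteq> {}" using assms by (auto simp: obox_def)
  have lu: "\<forall>i\<in>Basis. l \<bullet> i < u \<bullet> i" "\<forall>i\<in>Basis. l' \<bullet> i < u' \<bullet> i"
    using X Y by (auto simp: box_ne_empty)
  have v: "vol (box l u) = (\<Prod>i\<in>Basis. (u - l) \<bullet> i)" "vol (box l' u') = (\<Prod>i\<in>Basis. (u' - l') \<bullet> i)"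
    using lu by (auto simp: measure_lborel_box_eq less_imp_le)
  have v2: "vol (box (l + l') (u + u')) = (\<Prod>i\<in>Basis. (u - l) \<bullet> i + (u' - l') \<bullet> i)"
    using lu by (auto simp: measure_lborel_box_eq less_imp_le inner_add_left inner_diff_left intro!: add_mono prod.cong)
  have "(a + b) ^ card (Basis::'a set) \<le> (\<Prod>i\<in>Basis. (u - l) \<bullet> i + (u' - l') \<bullet> i)"
    using assms lu X Y v by (intro prod_add_ge_geom) (auto simp: inner_diff_left)
  also have "\<dots> = vol (box (l + l') (u + u'))" using v2 by simp
  also have "\<dots> \<le> vol (X + Y)"
  proof (rule measure_mono_fmeasurable)
    show "X + Y \<in> lmeasurable" unfolding X Y by (intro lmeasurable_add_set) auto
  qed (use box_sum[OF X(2) Y(2)] X Y in auto)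
  finally show ?thesis by simp
qed

text \<open>Disjointness of boxes already shows in one coordinate, and there a face of one of them separates.\<close>
lemma obox_disjoint_separated:
  fixes X Y :: "'a::euclidean_space set"
  assumes "obox X" "obox Y" "X \<inter> Y = {}"
  obtains i t where "i \<in> Basis"
    "(X \<subseteq> {x. x \<bullet> i < t} \<and> Y \<subseteq> {x. x \<bullet> i > t}) \<or> (Y \<subseteq> {x. x \<bullet> i < t} \<and> X \<subseteq> {x. x \<bullet> i > t})"
proof -
  obtain l u where X: "X = box l u" "box l u \<noteq> {}" using assms by (auto simp: obox_def)
  obtain l' u' where Y: "Y = box l' u'" "box l' u' \<noteq> {}" using assms by (auto simp: obox_def)
  obtain i where i: "i \<in> Basis" and le: "u \<bullet> i \<le> l \<bullet> i \<or> u' \<bullet> i \<le> l' \<bullet> i \<or> u' \<bullet> i \<le> l \<bullet> i \<or> u \<bullet> i \<le> l' \<bullet> i"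
    using disjoint_interval(4)[of l u l' u'] assms(3) X Y by auto
  moreover have "l \<bullet> i < u \<bullet> i" "l' \<bullet> i < u' \<bullet> i" using X Y i by (auto simp: box_ne_empty)
  ultimately consider "u' \<bullet> i \<le> l \<bullet> i" | "u \<bullet> i \<le> l' \<bullet> i" by linarith
  then show ?thesis
  proof cases
    case 1
    then show ?thesis using i by (intro that[of i "u' \<bullet> i"]) (fastforce simp: X Y box_def)+
  next
    case 2
    then show ?thesis using i by (intro that[of i "u \<bullet> i"]) (fastforce simp: X Y box_def)+
  qed
qed

lemma obox_Int_halfspace:
  fixes X :: "'a::euclidean_space set"
  assumes "obox X" "i \<in> Basis"
  shows "X \<inter> {x. x \<bullet> i < t} = {} \<or> obox (X \<inter> {x. x \<bullet> i < t})"
    and "X \<inter> {x. x \<bullet> i > t} = {} \<or> obox (X \<inter> {x. x \<bullet> i > t})"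
proof -
  obtain l u where X: "X = box l u" using assms by (auto simp: obox_def)
  define u' where "u' = (\<Sum>j\<in>Basis. (if j = i then min (u \<bullet> j) t else u \<bullet> j) *\<^sub>R j)"
  define l' where "l' = (\<Sum>j\<in>Basis. (if j = i then max (l \<bullet> j) t else l \<bullet> j) *\<^sub>R j)"
  have u': "u' \<bullet> j = (if j = i then min (u \<bullet> j) t else u \<bullet> j)"
    and l': "l' \<bullet> j = (if j = i then max (l \<bullet> j) t else l \<bullet> j)" if "j \<in> Basis" for j
    using that by (simp_all add: u'_def l'_def)
  have "x \<in> X \<inter> {x. x \<bullet> i < t} \<longleftrightarrow> x \<in> box l u'" for x
    using u' assms(2) unfolding X box_def by auto
  then have "X \<inter> {x. x \<bullet> i < t} = box l u'" by blast
  moreover have "x \<in> X \<inter> {x. x \<bullet> i > t} \<longleftrightarrow> x \<in> box l' u" for x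
    using l' assms(2) unfolding X box_def by auto
  then have "X \<inter> {x. x \<bullet> i > t} = box l' u" by blast
  ultimately show "X \<inter> {x. x \<bullet> i < t} = {} \<or> obox (X \<inter> {x. x \<bullet> i < t})"
    "X \<inter> {x. x \<bullet> i > t} = {} \<or> obox (X \<inter> {x. x \<bullet> i > t})"
    unfolding obox_def by blast+
qed

definition boxy :: "'a::euclidean_space set set \<Rightarrow> bool" where
  "boxy F \<longleftrightarrow> finite F \<and> disjoint F \<and> (\<forall>X\<in>F. obox X)"

text \<open>Empty pieces are dropped, so that a half-space missing some box leaves strictly fewer boxes.\<close>
definition cutf :: "'a set \<Rightarrow> 'a set set \<Rightarrow> 'a set set" where
  "cutf H F = (\<lambda>X. X \<inter> H) ` F - {{}}"

lemma Union_cutf: "\<Union>(cutf H F) = \<Union>F \<inter> H"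
  by (auto simp: cutf_def)

lemma card_cutf: "finite F \<Longrightarrow> card (cutf H F) \<le> card F"
  unfolding cutf_def by (rule order_trans[OF card_mono[OF _ Diff_subset] card_image_le]) auto

lemma card_cutf_less:
  assumes "finite F" "X \<in> F" "X \<inter> H = {}"
  shows "card (cutf H F) < card F"
proof -
  have "cutf H F \<subseteq> (\<lambda>X. X \<inter> H) ` (F - {X})" using assms(3) unfolding cutf_def by blast
  then have "card (cutf H F) \<le> card (F - {X})"
    using assms(1) by (intro order_trans[OF card_mono card_image_le]) auto
  also have "\<dots> < card F" using assms by (intro card_Diff1_less)
  finally show ?thesis .
qed

lemma boxy_cutf_if:
  assumes "boxy F" and ob: "\<And>X. X \<in> F \<Longrightarrow> X \<inter> H = {} \<or> obox (X \<inter> H)"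
  shows "boxy (cutf H F)"
proof -
  have "obox Y" if "Y \<in> cutf H F" for Y
    using that ob unfolding cutf_def by blast
  moreover have "Y \<inter> Z = {}" if YZ: "Y \<in> cutf H F" "Z \<in> cutf H F" "Y \<noteq> Z" for Y Z
  proof -
    obtain X X' where "X \<in> F" "Y = X \<inter> H" "X' \<in> F" "Z = X' \<inter> H"
      using YZ(1,2) unfolding cutf_def by blast
    moreover from this have "X \<noteq> X'" using YZ(3) by blast
    moreover have "disjoint F" using assms(1) by (simp add: boxy_def)
    ultimately have "X \<inter> X' = {}" by (intro disjointD[of F])
    then show ?thesis using \<open>Y = X \<inter> H\<close> \<open>Z = X' \<inter> H\<close> by auto
  qed
  moreover have "finite (cutf H F)" using assms(1) by (simp add: boxy_def cutf_def)
  ultimately show ?thesis unfolding boxy_def by (simp add: disjointI)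
qed

lemma boxy_cutf:
  assumes "boxy F" "i \<in> Basis"
  shows "boxy (cutf {x. x \<bullet> i < t} F)" "boxy (cutf {x. x \<bullet> i > t} F)"
  by (rule boxy_cutf_if[OF assms(1)],
      use assms(1) obox_Int_halfspace[OF _ assms(2)] in \<open>simp add: boxy_def\<close>)+

lemma boxy_Union:
  assumes "boxy F"
  shows "open (\<Union>F)" "bounded (\<Union>F)" "\<Union>F \<in> lmeasurable"
proof -
  have "open X \<and> bounded X" if "X \<in> F" for X
    using assms that by (auto simp: boxy_def obox_def)
  then show "open (\<Union>F)" "bounded (\<Union>F)"
    using assms by (simp_all add: boxy_def bounded_Union open_Union)
  then show "\<Union>F \<in> lmeasurable" by (rule lmeasurable_open[rotated])
qed

lemma vol_boxy_pos:
  assumes "boxy F" "F \<noteq> {}"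
  shows "vol (\<Union>F) > 0"
proof -
  obtain X where X: "X \<in> F" "obox X" using assms by (auto simp: boxy_def)
  then have "open X" "X \<noteq> {}" by (auto simp: obox_def)
  then have "\<not> negligible (\<Union>F)"
    using X(1) open_not_negligible negligible_subset by (metis Sup_upper)
  then show ?thesis
    using boxy_Union(3)[OF assms(1)] negligible_iff_measure0 measure_nonneg
    by (metis less_eq_real_def)
qed

text \<open>The cutting argument of Hadwiger and Ohmann. A hyperplane separating two boxes of \<open>F\<close> leaves fewer boxes
  on either side; \<open>G\<close> is cut by a parallel hyperplane in the same volume ratio. The sums of the matching parts lie
  on different sides of a third parallel hyperplane, and because the ratios agree the two lower bounds
  add up to the bound for the whole.\<close>
lemma brunn_minkowski_boxy_step:
  fixes F G :: "'a::euclidean_space set set"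
  assumes F: "boxy F" "X \<in> F" "Y \<in> F" "X \<noteq> Y" and G: "boxy G"
    and ab: "a > 0" "b > 0" "vol (\<Union>F) = a ^ DIM('a)" "vol (\<Union>G) = b ^ DIM('a)"
    and IH: "\<And>(F'::'a set set) (G'::'a set set) a' b'. \<lbrakk>card F' < card F; card G' \<le> card G; boxy F'; boxy G'; a' > 0; b' > 0;
      vol (\<Union>F') = a' ^ DIM('a); vol (\<Union>G') = b' ^ DIM('a)\<rbrakk>
      \<Longrightarrow> (a' + b') ^ DIM('a) \<le> vol (\<Union>F' + \<Union>G')"
  shows "(a + b) ^ DIM('a) \<le> vol (\<Union>F + \<Union>G)"
proof -
  let ?d = "DIM('a)"
  have XY: "obox X" "obox Y" "X \<inter> Y = {}" "X \<noteq> {}" "Y \<noteq> {}"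
    using F by (auto simp: boxy_def disjoint_def obox_def)
  obtain i t where i: "i \<in> Basis" and
    sep: "(X \<subseteq> {x. x \<bullet> i < t} \<and> Y \<subseteq> {x. x \<bullet> i > t}) \<or> (Y \<subseteq> {x. x \<bullet> i < t} \<and> X \<subseteq> {x. x \<bullet> i > t})"
    using obox_disjoint_separated[OF XY(1-3)] by metis
  have i0: "i \<noteq> 0" using i by auto
  define F1 F2 where "F1 = cutf {x. x \<bullet> i < t} F" and "F2 = cutf {x. x \<bullet> i > t} F"
  have fin: "finite F" "finite G" using F G by (auto simp: boxy_def)
  have b12: "boxy F1" "boxy F2" unfolding F1_def F2_def using boxy_cutf[OF F(1) i] by auto
  have c12: "card F1 < card F" "card F2 < card F"
    unfolding F1_def F2_def using sep F(2,3) fin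
    by (auto intro: card_cutf_less[of F X] card_cutf_less[of F Y]; fastforce intro: card_cutf_less[of F X] card_cutf_less[of F Y])+
  have "F1 \<noteq> {}" "F2 \<noteq> {}"
    using sep F(2,3) XY(4,5) unfolding F1_def F2_def cutf_def by blast+
  then have v12: "vol (\<Union>F1) > 0" "vol (\<Union>F2) > 0" using b12 vol_boxy_pos by auto
  have vF: "vol (\<Union>F) = vol (\<Union>F1) + vol (\<Union>F2)"
    unfolding F1_def F2_def Union_cutf using boxy_Union[OF F(1)] i0 by (intro vol_cut_add) auto
  \<comment> \<open>Cut \<open>G\<close> by a parallel hyperplane in the same volume ratio.\<close>
  define \<theta> where "\<theta> = vol (\<Union>F1) / vol (\<Union>F)"
  have th: "0 < \<theta>" "\<theta> < 1" using v12 vF by (auto simp: \<theta>_def)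
  have vF1: "vol (\<Union>F1) = \<theta> * a ^ ?d" "vol (\<Union>F2) = (1 - \<theta>) * a ^ ?d"
    using v12 vF ab by (auto simp: \<theta>_def field_simps)
  obtain s where s: "vol (\<Union>G \<inter> {x. x \<bullet> i < s}) = \<theta> * b ^ ?d"
    using vol_cut_eq_fraction[of "\<Union>G" i "\<theta> * b ^ ?d"] boxy_Union[OF G] i0 th ab by auto
  define G1 G2 where "G1 = cutf {x. x \<bullet> i < s} G" and "G2 = cutf {x. x \<bullet> i > s} G"
  have g12: "boxy G1" "boxy G2" unfolding G1_def G2_def using boxy_cutf[OF G(1) i] by auto
  have cg: "card G1 \<le> card G" "card G2 \<le> card G"
    unfolding G1_def G2_def using fin card_cutf by auto
  have vG1: "vol (\<Union>G1) = \<theta> * b ^ ?d" unfolding G1_def Union_cutf by (rule s)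
  have vG: "vol (\<Union>G) = vol (\<Union>G1) + vol (\<Union>G2)"
    unfolding G1_def G2_def Union_cutf using boxy_Union[OF G(1)] i0 by (intro vol_cut_add) auto
  then have vG2: "vol (\<Union>G2) = (1 - \<theta>) * b ^ ?d" using vG1 ab by (simp add: algebra_simps)
  define r q where "r = root ?d \<theta>" and "q = root ?d (1 - \<theta>)"
  have r: "r > 0" "r ^ ?d = \<theta>" and q: "q > 0" "q ^ ?d = 1 - \<theta>"
    using th by (auto simp: r_def q_def real_root_pow_pos)
  have 1: "(r * a + r * b) ^ ?d \<le> vol (\<Union>F1 + \<Union>G1)"
    using IH[OF c12(1) cg(1) b12(1) g12(1), of "r * a" "r * b"] r ab vF1 vG1 by (simp add: power_mult_distrib)
  have 2: "(q * a + q * b) ^ ?d \<le> vol (\<Union>F2 + \<Union>G2)"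
    using IH[OF c12(2) cg(2) b12(2) g12(2), of "q * a" "q * b"] q ab vF1 vG2 by (simp add: power_mult_distrib)
  have lm: "\<Union>F + \<Union>G \<in> lmeasurable" "\<Union>F1 + \<Union>G1 \<in> lmeasurable" "\<Union>F2 + \<Union>G2 \<in> lmeasurable"
    using F G b12 g12 by (auto intro!: lmeasurable_add_set boxy_Union)
  have hs: "open {x. x \<bullet> i < t + s}" "open {x. x \<bullet> i > t + s}"
    using open_halfspace_lt[of i "t+s"] open_halfspace_gt[of "t+s" i] by (auto simp: inner_commute)
  have "(a + b) ^ ?d = (r * a + r * b) ^ ?d + (q * a + q * b) ^ ?d"
    using r q by (simp add: distrib_left[symmetric] power_mult_distrib) (simp add: algebra_simps)
  also have "\<dots> \<le> vol (\<Union>F1 + \<Union>G1) + vol (\<Union>F2 + \<Union>G2)" using 1 2 by (rule add_mono)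
  also have "\<dots> \<le> vol ((\<Union>F + \<Union>G) \<inter> {x. x \<bullet> i < t + s}) + vol ((\<Union>F + \<Union>G) \<inter> {x. x \<bullet> i > t + s})"
  proof (intro add_mono measure_mono_fmeasurable)
    show "\<Union>F1 + \<Union>G1 \<subseteq> (\<Union>F + \<Union>G) \<inter> {x. x \<bullet> i < t + s}"
      unfolding F1_def G1_def Union_cutf by (auto simp: set_plus_def inner_add_left)
    show "\<Union>F2 + \<Union>G2 \<subseteq> (\<Union>F + \<Union>G) \<inter> {x. x \<bullet> i > t + s}"
      unfolding F2_def G2_def Union_cutf by (auto simp: set_plus_def inner_add_left)
  qed (use lm hs in \<open>auto intro!: fmeasurable_Int_fmeasurable\<close>)
  also have "\<dots> = vol (\<Union>F + \<Union>G)" by (rule vol_cut_add[symmetric, OF lm(1) i0])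
  finally show ?thesis .
qed

lemma brunn_minkowski_boxy:
  fixes F G :: "'a::euclidean_space set set"
  assumes "boxy F" "boxy G" "a > 0" "b > 0" "vol (\<Union>F) = a ^ DIM('a)" "vol (\<Union>G) = b ^ DIM('a)"
  shows "(a + b) ^ DIM('a) \<le> vol (\<Union>F + \<Union>G)"
  using assms
proof (induction "card F + card G" arbitrary: F G a b rule: less_induct)
  case less
  have ne: "F \<noteq> {}" "G \<noteq> {}" using less.prems by auto
  consider (F) X Y where "X \<in> F" "Y \<in> F" "X \<noteq> Y" | (G) X Y where "X \<in> G" "Y \<in> G" "X \<noteq> Y"
    | (1) X Y where "F = {X}" "G = {Y}"
  proof (cases "(\<exists>X\<in>F. \<exists>Y\<in>F. X \<noteq> Y) \<or> (\<exists>X\<in>G. \<exists>Y\<in>G. X \<noteq> Y)")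
    case True
    then show ?thesis by (elim disjE bexE) (rule that, assumption+)+
  next
    case False
    obtain X Y where "X \<in> F" "Y \<in> G" using ne by auto
    moreover from this False have "F = {X}" "G = {Y}" by auto
    ultimately show ?thesis by (intro that(3))
  qed
  then show ?case
  proof cases
    case F
    show ?thesis
      by (rule brunn_minkowski_boxy_step[OF less.prems(1) F less.prems(2-6)])
         (rule less.hyps, auto)
  next
    case G
    have "(b + a) ^ DIM('a) \<le> vol (\<Union>G + \<Union>F)"
    proof (rule brunn_minkowski_boxy_step[OF less.prems(2) G less.prems(1,4,3,6,5)])
      fix F' G' :: "'a set set" and a' b' :: real
      assume "card F' < card G" "card G' \<le> card F" "boxy F'" "boxy G'" "a' > 0" "b' > 0"
        "vol (\<Union>F') = a' ^ DIM('a)" "vol (\<Union>G') = b' ^ DIM('a)"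
      then have "(b' + a') ^ DIM('a) \<le> vol (\<Union>G' + \<Union>F')" by (intro less.hyps) auto
      then show "(a' + b') ^ DIM('a) \<le> vol (\<Union>F' + \<Union>G')" by (simp add: add.commute)
    qed
    then show ?thesis by (simp add: add.commute)
  next
    case 1
    then show ?thesis using less.prems brunn_minkowski_box[of X Y a b] by (auto simp: boxy_def)
  qed
qed

text \<open>An open set is a countable union of closed boxes. Finitely many of them carry almost all of its volume,
  and dividing these into non-overlapping boxes and dropping the faces costs only a null set.\<close>
lemma open_approx_boxy:
  fixes A :: "'a::euclidean_space set"
  assumes A: "open A" "bounded A" and v: "v < vol A"
  obtains F where "boxy F" "\<Union>F \<subseteq> A" "v < vol (\<Union>F)"
proof -
  have Alm: "A \<in> lmeasurable" using A by (intro lmeasurable_open)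
  obtain D where D: "countable D" "D \<subseteq> Pow A" "\<And>X. X \<in> D \<Longrightarrow> \<exists>a b. X = cbox a b" "\<Union>D = A"
    using open_countable_Union_open_cbox[OF A(1)] by metis
  have lmD: "X \<in> lmeasurable" if "X \<in> D" for X using D(3)[OF that] by auto
  obtain E where E: "finite E" "E \<subseteq> D" "v < vol (\<Union>E)"
  proof (cases "D = {}")
    case True
    then show ?thesis using that[of "{}"] D(4) v by auto
  next
    case False
    let ?U = "\<lambda>n. \<Union>(from_nat_into D ` {..n})"
    have sub: "from_nat_into D n \<in> D" for n using False by (simp add: from_nat_into)
    have "(\<lambda>n. vol (?U n)) \<longlonglongrightarrow> vol (\<Union>n. ?U n)"
    proof (rule Lim_measure_incseq)
      show "range ?U \<subseteq> sets lebesgue"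
        using lmD sub by (auto intro!: sets.finite_UN)
      show "incseq ?U" by (force simp: incseq_def)
      have "(\<Union>n. ?U n) \<subseteq> A" using D sub by fastforce
      then have "emeasure lebesgue (\<Union>n. ?U n) \<le> emeasure lebesgue A"
        using Alm by (intro emeasure_mono) auto
      then show "emeasure lebesgue (\<Union>n. ?U n) \<noteq> \<infinity>"
        using Alm by (auto simp: fmeasurable_def top_unique)
    qed
    moreover have "(\<Union>n. ?U n) = A"
      using D(4) sub from_nat_into_surj[OF D(1)] by fastforce
    ultimately obtain n where "v < vol (?U n)"
      using v by (metis (no_types, lifting) eventually_sequentially order_tendstoD(1) order_refl)
    then show ?thesis using sub by (intro that[of "from_nat_into D ` {..n}"]) auto
  qed
  obtain P where P: "P division_of \<Union>E"
    using elementary_unions_intervals[OF E(1)] E(2) D(3) by blast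
  define F where "F = interior ` P - {{}}"
  have ob: "\<exists>a b. X = cbox a b" if "X \<in> P" for X using division_ofD(4)[OF P that] .
  have "boxy F"
    unfolding boxy_def
  proof (intro conjI ballI disjointI)
    show "finite F" using division_ofD(1)[OF P] by (auto simp: F_def)
    show "obox X" if "X \<in> F" for X
      using that ob unfolding F_def obox_def by (auto simp: interior_cbox) (metis interior_cbox)
    show "X \<inter> Y = {}" if "X \<in> F" "Y \<in> F" "X \<noteq> Y" for X Y
      using that division_ofD(5)[OF P] unfolding F_def by (metis (no_types, lifting) DiffD1 imageE)
  qed
  moreover have UF: "\<Union>F = \<Union>(interior ` P)" by (auto simp: F_def)
  have "\<Union>F \<subseteq> \<Union>E" unfolding UF using division_ofD(6)[OF P] interior_subset by fastforce
  moreover have "negligible (\<Union>E - \<Union>F)"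
  proof (rule negligible_subset)
    show "negligible (\<Union>(frontier ` P))"
    proof (rule negligible_Union)
      fix T assume "T \<in> frontier ` P"
      then obtain a b where "T = frontier (cbox a b)" using ob by blast
      then show "negligible T" by (simp add: negligible_convex_frontier)
    qed (use division_ofD(1)[OF P] in simp)
    show "\<Union>E - \<Union>F \<subseteq> \<Union>(frontier ` P)"
      unfolding UF division_ofD(6)[OF P, symmetric] frontier_def using closure_subset by fastforce
  qed
  then have "vol (\<Union>F) = vol (\<Union>E)"
    using \<open>\<Union>F \<subseteq> \<Union>E\<close> E lmD
    by (intro measure_negligible_symdiff) (auto simp: Un_commute Diff_eq_empty_iff[THEN iffD2] intro!: fmeasurable.finite_Union)
  ultimately show ?thesis using E D(2) by (intro that[of F]) auto
qed

text \<open>Approximate both sets from inside by disjoint boxes; the loss is a factor as close to one as desired.\<close>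
lemma brunn_minkowski_open:
  fixes A B :: "'a::euclidean_space set"
  assumes A: "open A" "bounded A" and B: "open B" "bounded B"
    and ab: "a > 0" "b > 0" "a ^ DIM('a) \<le> vol A" "b ^ DIM('a) \<le> vol B"
  shows "(a + b) ^ DIM('a) \<le> vol (A + B)"
proof (rule field_le_mult_one_interval)
  let ?d = "DIM('a)"
  fix z :: real assume z: "0 < z" "z < 1"
  have approx: "\<exists>F c. boxy F \<and> \<Union>F \<subseteq> S \<and> vol (\<Union>F) = c ^ ?d \<and> root ?d z * e \<le> c"
    if S: "open S" "bounded S" and e: "e > 0" "e ^ ?d \<le> vol S" for S :: "'a set" and e
  proof -
    have "(root ?d z * e) ^ ?d = z * e ^ ?d" using z by (simp add: power_mult_distrib)
    also have "\<dots> < 1 * e ^ ?d" using z e by (intro mult_strict_right_mono) auto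
    also have "\<dots> \<le> vol S" using e by simp
    finally obtain F where F: "boxy F" "\<Union>F \<subseteq> S" "(root ?d z * e) ^ ?d < vol (\<Union>F)"
      using open_approx_boxy[OF S] by metis
    have "vol (\<Union>F) = (root ?d (vol (\<Union>F))) ^ ?d" by simp
    moreover have "root ?d z * e \<le> root ?d (vol (\<Union>F))"
    proof -
      have "0 \<le> root ?d z * e" using z e by (simp add: real_root_ge_zero)
      then have "root ?d z * e = root ?d ((root ?d z * e) ^ ?d)" by (simp add: real_root_power_cancel)
      also have "\<dots> \<le> root ?d (vol (\<Union>F))" using F(3) by (intro real_root_le_mono) auto
      finally show ?thesis .
    qed
    ultimately show ?thesis using F(1,2) by (intro exI[of _ F] exI[of _ "root ?d (vol (\<Union>F))"]) simp
  qed
  obtain F c where F: "boxy F" "\<Union>F \<subseteq> A" "vol (\<Union>F) = c ^ ?d" "root ?d z * a \<le> c"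
    using approx[OF A ab(1,3)] by auto
  obtain G e where G: "boxy G" "\<Union>G \<subseteq> B" "vol (\<Union>G) = e ^ ?d" "root ?d z * b \<le> e"
    using approx[OF B ab(2,4)] by auto
  have rz: "root ?d z > 0" using z by simp
  have ce: "c > 0" "e > 0" using F(4) G(4) rz ab by (auto intro: less_le_trans[rotated] mult_pos_pos)
  have "z * (a + b) ^ ?d = (root ?d z * a + root ?d z * b) ^ ?d"
    using z by (simp add: distrib_left[symmetric] power_mult_distrib)
  also have "\<dots> \<le> (c + e) ^ ?d" using F(4) G(4) rz ab by (intro power_mono add_mono) auto
  also have "\<dots> \<le> vol (\<Union>F + \<Union>G)" using F G ce by (intro brunn_minkowski_boxy) auto
  also have "\<dots> \<le> vol (A + B)"
    using F G A B by (intro measure_mono_fmeasurable set_plus_mono2 lmeasurable_add_set fmeasurableD)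
      (auto intro: boxy_Union)
  finally show "z * (a + b) ^ ?d \<le> vol (A + B)" .
qed

text \<open>Stating the volumes through lower bounds \<open>a ^ DIM('a)\<close> and \<open>b ^ DIM('a)\<close> keeps roots out of the applications. The open
  case suffices because the boundary of a convex set is a null set.\<close>
theorem brunn_minkowski_convex:
  fixes A B :: "'a::euclidean_space set"
  assumes A: "compact A" "convex A" and B: "compact B" "convex B" and pq: "p > 0" "q > 0"
    and ab: "a > 0" "b > 0" "a ^ DIM('a) \<le> vol A" "b ^ DIM('a) \<le> vol B"
  shows "(p * a + q * b) ^ DIM('a) \<le> vol (mcomb p A q B)"
proof -
  have int: "vol (interior S) = vol S" if "compact S" "convex S" for S :: "'a set"
    using that by (intro measure_interior compact_imp_bounded negligible_convex_frontier)
  have op: "open ((*\<^sub>R) c ` interior S)" "bounded ((*\<^sub>R) c ` interior S)"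
    if "c > 0" "compact S" for S :: "'a set" and c :: real
    using that by (auto intro!: open_scaling bounded_scaling bounded_interior compact_imp_bounded[OF that(2)])
  have sc: "(c * e) ^ DIM('a) \<le> vol ((*\<^sub>R) c ` interior S)"
    if "c > 0" "compact S" "convex S" "e ^ DIM('a) \<le> vol S" for S :: "'a set" and c e :: real
    unfolding vol_scale int[OF that(2,3)] power_mult_distrib using that by (simp add: mult_left_mono)
  have "(p * a + q * b) ^ DIM('a) \<le> vol ((*\<^sub>R) p ` interior A + (*\<^sub>R) q ` interior B)"
    using A B pq ab by (intro brunn_minkowski_open op sc) simp_all
  also have "\<dots> \<le> vol (mcomb p A q B)"
  proof (rule measure_mono_fmeasurable)
    show "(*\<^sub>R) p ` interior A + (*\<^sub>R) q ` interior B \<subseteq> mcomb p A q B"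
      unfolding mcomb_eq using interior_subset by (intro set_plus_mono2 image_mono) auto
    show "(*\<^sub>R) p ` interior A + (*\<^sub>R) q ` interior B \<in> sets lebesgue"
      using op[OF pq(1) A(1)] op[OF pq(2) B(1)] by (intro fmeasurableD lmeasurable_add_set)
    show "mcomb p A q B \<in> lmeasurable" using A B by (intro lmeasurable_compact compact_mcomb)
  qed
  finally show ?thesis .
qed

text \<open>For \<open>x < y\<close> the hypothesis with \<open>t = m + q h\<close> and \<open>t' = m - p h\<close>, integrated over \<open>m\<close> from \<open>x\<close> to \<open>y\<close>, says that
  \<open>p (\<integral> f(m + q h) dm) + q (\<integral> g(m - p h) dm)\<close> is greatest at \<open>h = 0\<close>. Its derivative there,
  \<open>p q ((f y - f x) - (g y - g x))\<close>, therefore vanishes. The integrals are expressed by antiderivatives of \<open>f\<close> and \<open>g\<close>.\<close>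
section \<open>Equality in the Brunn-Minkowski inequality\<close>

lemma diff_const_if_diagonal_maximal:
  fixes f g :: "real \<Rightarrow> real"
  assumes cont: "continuous_on {l<..<r} f" "continuous_on {l<..<r} g"
    and pq: "p > 0" "q > 0" "p + q = 1"
    and ineq: "\<And>t t'. \<lbrakk>t \<in> {l<..<r}; t' \<in> {l<..<r}\<rbrakk> \<Longrightarrow>
      p * f t + q * g t' \<le> p * f (p * t + q * t') + q * g (p * t + q * t')"
  shows "\<exists>k. \<forall>t\<in>{l<..<r}. f t = g t + k"
proof -
  have diff: "f y - f x = g y - g x" if xy: "x \<in> {l<..<r}" "y \<in> {l<..<r}" "x < y" for x y
  proof -
    define \<delta> where "\<delta> = min (x - l) (r - y) / 2"
    have \<delta>: "\<delta> > 0" "l < x - \<delta>" "y + \<delta> < r"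
      using xy by (auto simp: \<delta>_def min_def field_simps)
    have sub: "{x - \<delta>..y + \<delta>} \<subseteq> {l<..<r}" using \<delta> by auto
    define F G where "F = (\<lambda>t. integral {x - \<delta>..t} f)" and "G = (\<lambda>t. integral {x - \<delta>..t} g)"
    have FG: "(F has_real_derivative f t) (at t)" "(G has_real_derivative g t) (at t)"
      if "t \<in> {x - \<delta><..<y + \<delta>}" for t
    proof -
      have t: "t \<in> {x - \<delta>..y + \<delta>}" and w: "at t within {x - \<delta>..y + \<delta>} = at t"
        using that by (auto intro!: at_within_interior)
      show "(F has_real_derivative f t) (at t)" "(G has_real_derivative g t) (at t)"
        using integral_has_real_derivative[OF continuous_on_subset[OF cont(1) sub] t]
          integral_has_real_derivative[OF continuous_on_subset[OF cont(2) sub] t]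
        unfolding F_def G_def w .
    qed
    define \<Phi> where "\<Phi> h = p * (F (y + q * h) - F (x + q * h)) + q * (G (y - p * h) - G (x - p * h))" for h
    have max: "\<Phi> h \<le> \<Phi> 0" if h: "\<bar>0 - h\<bar> < \<delta>" for h
    proof -
      define \<Psi> where "\<Psi> m = p * F m + q * G m - (p * F (m + q * h) + q * G (m - p * h))" for m
      have "\<bar>q * h\<bar> \<le> \<bar>h\<bar>" "\<bar>p * h\<bar> \<le> \<bar>h\<bar>"
        using pq by (simp_all add: abs_mult mult_left_le_one_le)
      then have small: "\<bar>q * h\<bar> < \<delta>" "\<bar>p * h\<bar> < \<delta>" using h by auto
      have "\<Psi> x \<le> \<Psi> y"
      proof (rule DERIV_nonneg_imp_nondecreasing[where f=\<Psi>])
        fix m assume m: "x \<le> m" "m \<le> y"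
        have dom: "m \<in> {x - \<delta><..<y + \<delta>}" "m + q * h \<in> {x - \<delta><..<y + \<delta>}" "m - p * h \<in> {x - \<delta><..<y + \<delta>}"
          using m small \<delta> by auto
        have "(\<Psi> has_real_derivative (p * f m + q * g m - (p * (f (m + q * h) * 1) + q * (g (m - p * h) * 1)))) (at m)"
          unfolding \<Psi>_def
          by (intro derivative_intros DERIV_chain2[where f=F] DERIV_chain2[where f=G] FG dom
              DERIV_cmult DERIV_add DERIV_diff) (auto intro!: derivative_eq_intros)
        moreover have "p * (m + q * h) + q * (m - p * h) = m"
          using pq by (simp add: algebra_simps flip: distrib_left distrib_right)
        then have "p * f (m + q * h) + q * g (m - p * h) \<le> p * f m + q * g m"
          using ineq[of "m + q * h" "m - p * h"] dom sub by (auto simp: subset_iff)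
        ultimately show "\<exists>D. (\<Psi> has_real_derivative D) (at m) \<and> 0 \<le> D"
          by (intro exI conjI) auto
      qed (use xy in simp)
      then show ?thesis by (simp add: \<Phi>_def \<Psi>_def algebra_simps)
    qed
    have xin: "x \<in> {x - \<delta><..<y + \<delta>}" "y \<in> {x - \<delta><..<y + \<delta>}" using \<delta> xy by auto
    have "(\<Phi> has_real_derivative (p * (f y * q - f x * q) + q * (g y * (- p) - g x * (- p)))) (at 0)"
      unfolding \<Phi>_def
      by (intro DERIV_cmult DERIV_add DERIV_diff DERIV_chain2[where f=F] DERIV_chain2[where f=G])
         (use FG xin in \<open>auto intro!: derivative_eq_intros\<close>)
    from DERIV_local_max[OF this \<delta>(1)] max
    have "p * (f y * q - f x * q) + q * (g y * (- p) - g x * (- p)) = 0" by blast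
    then have "(p * q) * ((f y - f x) - (g y - g x)) = 0" by (simp add: algebra_simps)
    then show ?thesis using pq by simp
  qed
  show ?thesis
  proof (cases "{l<..<r} = {}")
    case False
    then obtain x where x: "x \<in> {l<..<r}" by blast
    have "f t = g t + (f x - g x)" if "t \<in> {l<..<r}" for t
      using diff[OF x that] diff[OF that x] by (cases "x < t"; cases "t < x") auto
    then show ?thesis by blast
  qed auto
qed

lemma convex_body_lmeasurable: "convex_body K \<Longrightarrow> K \<in> lmeasurable"
  by (simp add: convex_body_def lmeasurable_compact)

text \<open>A convex body is the closure of its interior, so an open set that meets it meets its interior.\<close>
lemma vol_Int_open_pos:
  assumes K: "convex_body K" and W: "open W" "K \<inter> W \<noteq> {}"
  shows "vol (K \<inter> W) > 0"
proof -
  have "K \<subseteq> closure (interior K)"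
    using K convex_closure_interior[of K] closure_subset unfolding convex_body_def by blast
  then have "interior K \<inter> W \<noteq> {}" using W open_Int_closure_eq_empty by fast
  moreover have "open (interior K \<inter> W)" using W by auto
  ultimately have "\<not> negligible (interior K \<inter> W)" by (metis open_not_negligible)
  then have "\<not> negligible (K \<inter> W)"
    by (rule contrapos_nn) (rule negligible_subset, use interior_subset in auto)
  moreover have "K \<inter> W \<in> lmeasurable"
    using convex_body_lmeasurable[OF K] W by (auto intro!: fmeasurable_Int_fmeasurable)
  ultimately show ?thesis
    using negligible_iff_measure0 zero_less_measure_iff by (metis less_eq_real_def measure_nonneg)
qed

lemma vol_convex_body_pos: "convex_body K \<Longrightarrow> vol K > 0"
  using vol_Int_open_pos[of K UNIV] interior_subset[of K] by (auto simp: convex_body_def)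

lemma convex_body_if_vol_pos:
  assumes "compact K" "convex K" "vol K > 0"
  shows "convex_body K"
proof -
  have "\<not> negligible K" using assms(3) negligible_imp_measure0 by force
  then show ?thesis using assms negligible_convex_interior by (auto simp: convex_body_def)
qed

lemma convex_body_subset_eq:
  assumes X: "compact X" and Y: "convex_body Y" and "X \<subseteq> Y" "vol Y \<le> vol X"
  shows "X = Y"
proof (rule ccontr)
  assume "X \<noteq> Y"
  then have "Y \<inter> - X \<noteq> {}" using assms by auto
  moreover have "open (- X)" using X by (simp add: compact_imp_closed open_Compl)
  ultimately have "vol (Y \<inter> - X) > 0" by (intro vol_Int_open_pos[OF Y])
  moreover have "vol (Y - X) = vol Y - vol X"
    using X convex_body_lmeasurable[OF Y] assms by (intro measurable_measure_Diff) (auto simp: fmeasurableD lmeasurable_compact)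
  ultimately show False using assms by (simp add: Diff_eq)
qed

lemma vol_cut_closed:
  fixes A :: "'a::euclidean_space set"
  assumes A: "A \<in> lmeasurable" "u \<noteq> 0"
  shows "vol (A \<inter> {x. x \<bullet> u \<le> t}) = vol (A \<inter> {x. x \<bullet> u < t})"
    and "vol (A \<inter> {x. x \<bullet> u \<ge> t}) = vol A - vol (A \<inter> {x. x \<bullet> u < t})"
proof -
  have n: "negligible {x. x \<bullet> u = t}"
    using negligible_hyperplane[of u t] A by (simp add: inner_commute)
  have op: "open {x. x \<bullet> u < t}" "open {x. x \<bullet> u > t}"
    using open_halfspace_lt[of u t] open_halfspace_gt[of t u] by (auto simp: inner_commute)
  have m: "A \<inter> {x. x \<bullet> u < t} \<in> lmeasurable" "A \<inter> {x. x \<bullet> u > t} \<in> lmeasurable"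
    using op A by (auto intro!: fmeasurable_Int_fmeasurable)
  show "vol (A \<inter> {x. x \<bullet> u \<le> t}) = vol (A \<inter> {x. x \<bullet> u < t})"
    by (rule measure_negligible_symdiff[OF m(1)], rule negligible_subset[OF n]) auto
  have "vol (A \<inter> {x. x \<bullet> u \<ge> t}) = vol (A \<inter> {x. x \<bullet> u > t})"
    by (rule measure_negligible_symdiff[OF m(2)], rule negligible_subset[OF n]) auto
  then show "vol (A \<inter> {x. x \<bullet> u \<ge> t}) = vol A - vol (A \<inter> {x. x \<bullet> u < t})"
    using vol_cut_add[OF A, of t] by simp
qed

lemma convex_strip_nonempty:
  fixes K :: "'a::real_inner set"
  assumes "convex K" "x \<in> K" "y \<in> K" "x \<bullet> u < t" "s < y \<bullet> u" "s < t"
  obtains z where "z \<in> K" "s < z \<bullet> u" "z \<bullet> u < t"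
proof -
  consider "s < x \<bullet> u" | "y \<bullet> u < t" | "x \<bullet> u \<le> s" "t \<le> y \<bullet> u" by linarith
  then show ?thesis
  proof cases
    case 3
    define m where "m = (s + t) / 2"
    define w where "w = (m - x \<bullet> u) / (y \<bullet> u - x \<bullet> u)"
    have "x \<bullet> u < m" "m < y \<bullet> u" using 3 assms by (auto simp: m_def)
    then have l: "0 \<le> w" "w \<le> 1" "w * (y \<bullet> u - x \<bullet> u) = m - x \<bullet> u" by (auto simp: w_def)
    have "((1 - w) *\<^sub>R x + w *\<^sub>R y) \<bullet> u = m"
      using l(3) by (simp add: inner_add_left algebra_simps)
    moreover have "(1 - w) *\<^sub>R x + w *\<^sub>R y \<in> K"
      using assms l by (intro convexD_alt) auto
    ultimately show ?thesis using assms by (intro that[of "(1 - w) *\<^sub>R x + w *\<^sub>R y"]) (auto simp: m_def)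
  qed (use assms that in auto)
qed

text \<open>A body with points below \<open>t\<close> and points above \<open>s\<close> has, by convexity, points strictly between these levels.\<close>
lemma vol_cut_strict_mono:
  assumes K: "convex_body K" and u: "u \<noteq> 0" and st: "s < t"
    and s: "vol (K \<inter> {x. x \<bullet> u < s}) < vol K" and t: "0 < vol (K \<inter> {x. x \<bullet> u < t})"
  shows "vol (K \<inter> {x. x \<bullet> u < s}) < vol (K \<inter> {x. x \<bullet> u < t})"
proof -
  have lm: "K \<in> lmeasurable" using K by (rule convex_body_lmeasurable)
  have op: "open {x. x \<bullet> u < c}" "open {x. x \<bullet> u > c}" for c
    using open_halfspace_lt[of u c] open_halfspace_gt[of c u] by (auto simp: inner_commute)
  have "K \<inter> {x. x \<bullet> u < t} \<noteq> {}" using t by auto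
  then obtain x where x: "x \<in> K" "x \<bullet> u < t" by auto
  have "vol (K \<inter> {x. x \<bullet> u > s}) > 0" using vol_cut_add[OF lm u, of s] s by simp
  then have "K \<inter> {x. x \<bullet> u > s} \<noteq> {}" by auto
  then obtain y where y: "y \<in> K" "s < y \<bullet> u" by auto
  obtain z where z: "z \<in> K" "s < z \<bullet> u" "z \<bullet> u < t"
    using convex_strip_nonempty[of K x y u t s] K x y st by (auto simp: convex_body_def)
  let ?W = "{x. x \<bullet> u > s} \<inter> {x. x \<bullet> u < t}"
  have "vol (K \<inter> ?W) > 0" using z op by (intro vol_Int_open_pos[OF K] open_Int) auto
  moreover have "vol ((K \<inter> {x. x \<bullet> u < s}) \<union> (K \<inter> ?W)) = vol (K \<inter> {x. x \<bullet> u < s}) + vol (K \<inter> ?W)"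
    using lm op by (subst measure_Un2) (auto intro!: fmeasurable_Int_fmeasurable arg_cong[of _ _ vol])
  moreover have "vol ((K \<inter> {x. x \<bullet> u < s}) \<union> (K \<inter> ?W)) \<le> vol (K \<inter> {x. x \<bullet> u < t})"
    using lm op st by (intro measure_mono_fmeasurable) (auto intro!: fmeasurable_Int_fmeasurable sets.Un sets.Int fmeasurableD[OF lm])
  ultimately show ?thesis by linarith
qed

lemma compact_cut: "compact A \<Longrightarrow> compact (A \<inter> {x. x \<bullet> u \<le> t})" "compact A \<Longrightarrow> compact (A \<inter> {x. x \<bullet> u \<ge> t})"
  "compact A \<Longrightarrow> compact (A \<inter> {x. x \<bullet> u = t})"
  for u :: "'a::euclidean_space"
  using closed_halfspace_le[of u t] closed_halfspace_ge[of t u] closed_hyperplane[of u t]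
  by (auto simp: inner_commute intro!: compact_Int_closed)

lemma convex_cut: "convex A \<Longrightarrow> convex (A \<inter> {x. x \<bullet> u \<le> t})" "convex A \<Longrightarrow> convex (A \<inter> {x. x \<bullet> u \<ge> t})"
  "convex A \<Longrightarrow> convex (A \<inter> {x. x \<bullet> u = t})"
  for u :: "'a::euclidean_space"
  using convex_halfspace_le[of u t] convex_halfspace_ge[of t u] convex_hyperplane[of u t]
  by (auto simp: inner_commute intro!: convex_Int)

text \<open>The combination of the parts of \<open>A\<close> and \<open>B\<close> on one side of their cuts lies on the same side of the
  combined cut; apply the Brunn-Minkowski inequality to these parts.\<close>
lemma vol_cut_mcomb:
  fixes A B :: "'a::euclidean_space set"
  assumes A: "compact A" "convex A" and B: "compact B" "convex B" and pq: "p > 0" "q > 0" and u: "u \<noteq> 0"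
    and r: "r > 0" "r' > 0"
  shows "r ^ DIM('a) \<le> vol (A \<inter> {x. x \<bullet> u < s}) \<Longrightarrow> r' ^ DIM('a) \<le> vol (B \<inter> {x. x \<bullet> u < t}) \<Longrightarrow>
     (p * r + q * r') ^ DIM('a) \<le> vol (mcomb p A q B \<inter> {x. x \<bullet> u < p * s + q * t})"
    and "r ^ DIM('a) \<le> vol A - vol (A \<inter> {x. x \<bullet> u < s}) \<Longrightarrow> r' ^ DIM('a) \<le> vol B - vol (B \<inter> {x. x \<bullet> u < t}) \<Longrightarrow>
     (p * r + q * r') ^ DIM('a) \<le> vol (mcomb p A q B) - vol (mcomb p A q B \<inter> {x. x \<bullet> u < p * s + q * t})"
proof -
  let ?C = "mcomb p A q B"
  have lm: "A \<in> lmeasurable" "B \<in> lmeasurable" "?C \<in> lmeasurable"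
    using A B by (auto intro!: lmeasurable_compact compact_mcomb)
  have cC: "compact ?C" using A B by (intro compact_mcomb)
  { assume *: "r ^ DIM('a) \<le> vol (A \<inter> {x. x \<bullet> u < s})" "r' ^ DIM('a) \<le> vol (B \<inter> {x. x \<bullet> u < t})"
    have "(p * r + q * r') ^ DIM('a) \<le> vol (mcomb p (A \<inter> {x. x \<bullet> u \<le> s}) q (B \<inter> {x. x \<bullet> u \<le> t}))"
      using A B r pq * by (intro brunn_minkowski_convex compact_cut convex_cut) (simp_all only: vol_cut_closed[OF lm(1) u] vol_cut_closed[OF lm(2) u])
    also have "\<dots> \<le> vol (?C \<inter> {x. x \<bullet> u \<le> p * s + q * t})"
    proof (rule measure_mono_fmeasurable)
      show "mcomb p (A \<inter> {x. x \<bullet> u \<le> s}) q (B \<inter> {x. x \<bullet> u \<le> t}) \<subseteq> ?C \<inter> {x. x \<bullet> u \<le> p * s + q * t}"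
        using pq by (auto simp: mcomb_def inner_add_left intro!: add_mono mult_left_mono)
    qed (use A B cC in \<open>auto intro!: lmeasurable_compact fmeasurableD compact_mcomb compact_cut\<close>)
    also have "\<dots> = vol (?C \<inter> {x. x \<bullet> u < p * s + q * t})" by (rule vol_cut_closed[OF lm(3) u])
    finally show "(p * r + q * r') ^ DIM('a) \<le> vol (?C \<inter> {x. x \<bullet> u < p * s + q * t})" . }
  { assume *: "r ^ DIM('a) \<le> vol A - vol (A \<inter> {x. x \<bullet> u < s})" "r' ^ DIM('a) \<le> vol B - vol (B \<inter> {x. x \<bullet> u < t})"
    have "(p * r + q * r') ^ DIM('a) \<le> vol (mcomb p (A \<inter> {x. x \<bullet> u \<ge> s}) q (B \<inter> {x. x \<bullet> u \<ge> t}))"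
      using A B r pq * by (intro brunn_minkowski_convex compact_cut convex_cut) (simp_all only: vol_cut_closed[OF lm(1) u] vol_cut_closed[OF lm(2) u])
    also have "\<dots> \<le> vol (?C \<inter> {x. x \<bullet> u \<ge> p * s + q * t})"
    proof (rule measure_mono_fmeasurable)
      show "mcomb p (A \<inter> {x. x \<bullet> u \<ge> s}) q (B \<inter> {x. x \<bullet> u \<ge> t}) \<subseteq> ?C \<inter> {x. x \<bullet> u \<ge> p * s + q * t}"
        using pq by (auto simp: mcomb_def inner_add_left intro!: add_mono mult_left_mono)
    qed (use A B cC in \<open>auto intro!: lmeasurable_compact fmeasurableD compact_mcomb compact_cut\<close>)
    also have "\<dots> = vol ?C - vol (?C \<inter> {x. x \<bullet> u < p * s + q * t})" by (rule vol_cut_closed[OF lm(3) u])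
    finally show "(p * r + q * r') ^ DIM('a) \<le> vol ?C - vol (?C \<inter> {x. x \<bullet> u < p * s + q * t})" . }
qed

text \<open>Let \<open>f r\<close> and \<open>g r\<close> be the levels below which \<open>A\<close> and \<open>B\<close> have volume \<open>r ^ DIM('a)\<close>. Applied on both sides of the
  cuts, the Brunn-Minkowski inequality shows that in the case of equality \<open>p f r + q g r\<close> is the corresponding level of
  \<open>p A + q B\<close>. Applied to cuts with different parameters it gives \<open>p f r + q g r' \<ge> p f m + q g m\<close> for \<open>m = p r + q r'\<close>,
  so \<open>f - g\<close> is constant and the cut volumes agree up to this shift.\<close>
lemma brunn_minkowski_equality_cut:
  fixes A B :: "'a::euclidean_space set"
  assumes A: "convex_body A" and B: "convex_body B" and pq: "p > 0" "q > 0" "p + q = 1" and u: "u \<noteq> 0"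
    and V: "vol B = vol A" "vol (mcomb p A q B) = vol A"
  shows "\<exists>k. \<forall>t. vol (A \<inter> {x. x \<bullet> u < t}) = vol (B \<inter> {x. x \<bullet> u < t - k})"
proof -
  let ?d = "DIM('a)"
  let ?C = "mcomb p A q B"
  have cc: "compact A" "convex A" "compact B" "convex B" using A B by (auto simp: convex_body_def)
  define R where "R = root ?d (vol A)"
  have V0: "vol A > 0" using A by (rule vol_convex_body_pos)
  have R: "R > 0" "R ^ ?d = vol A" using V0 by (auto simp: R_def)
  have C: "convex_body ?C"
    using cc V V0 by (intro convex_body_if_vol_pos compact_mcomb convex_mcomb) auto
  have rR: "0 < r ^ ?d" "r ^ ?d < vol A" if "r \<in> {0<..<R}" for r
    using that R(2) power_strict_mono[of r R ?d] by auto
  have "\<exists>f. \<forall>r\<in>{0<..<R}. vol (K \<inter> {x. x \<bullet> u < f r}) = r ^ ?d"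
    if "convex_body K" "vol K = vol A" for K
  proof (rule bchoice, rule ballI)
    fix r assume "r \<in> {0<..<R}"
    from rR[OF this] show "\<exists>t. vol (K \<inter> {x. x \<bullet> u < t}) = r ^ ?d"
      using vol_cut_eq_fraction[OF convex_body_lmeasurable[OF that(1)] _ u, of "r ^ ?d"] that
      by (metis compact_imp_bounded convex_body_def)
  qed
  then obtain f g where f: "\<And>r. r \<in> {0<..<R} \<Longrightarrow> vol (A \<inter> {x. x \<bullet> u < f r}) = r ^ ?d"
    and g: "\<And>r. r \<in> {0<..<R} \<Longrightarrow> vol (B \<inter> {x. x \<bullet> u < g r}) = r ^ ?d"
    using A B V by metis
  have mono: "vol (K \<inter> {x. x \<bullet> u < s}) \<le> vol (K \<inter> {x. x \<bullet> u < t})" if "s \<le> t" "convex_body K" for K s t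
    using that open_halfspace_lt[of u t] open_halfspace_lt[of u s] convex_body_lmeasurable[OF that(2)]
    by (intro measure_mono_fmeasurable) (auto simp: inner_commute intro!: fmeasurable_Int_fmeasurable fmeasurableD[of "_ \<inter> _"])
  have le: "t \<le> s" if "convex_body K" "vol K = vol A" "r \<in> {0<..<R}"
    "vol (K \<inter> {x. x \<bullet> u < t}) = r ^ ?d" "r ^ ?d \<le> vol (K \<inter> {x. x \<bullet> u < s})" for K s t r
    using vol_cut_strict_mono[OF that(1) u, of s t] rR[OF that(3)] mono[of s t K] that by linarith
  have comb: "x * r + y * r' \<in> {0<..<R}" if "r \<in> {0<..<R}" "r' \<in> {0<..<R}" "x > 0" "y > 0" "x + y = 1" for x y r r'
    using that convexD[of "{0<..<R}" r r' x y] by auto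
  have conv: "convex_on {0<..<R} h"
    if K: "convex_body K" "vol K = vol A" and h: "\<And>r. r \<in> {0<..<R} \<Longrightarrow> vol (K \<inter> {x. x \<bullet> u < h r}) = r ^ ?d" for K h
  proof (rule convex_onI)
    fix t x y :: real assume t: "0 < t" "t < 1" and xy: "x \<in> {0<..<R}" "y \<in> {0<..<R}"
    have m: "(1 - t) * x + t * y \<in> {0<..<R}" using comb[OF xy, of "1 - t" t] t by auto
    have "mcomb (1 - t) K t K \<subseteq> K"
      using K t by (auto simp: mcomb_def convex_body_def intro: convexD)
    moreover have "K \<subseteq> mcomb (1 - t) K t K"
      using mcombI[of _ K _ K "1 - t" t] by (force simp: algebra_simps)
    ultimately have "mcomb (1 - t) K t K = K" by blast
    then have "((1 - t) * x + t * y) ^ ?d \<le> vol (K \<inter> {z. z \<bullet> u < (1 - t) * h x + t * h y})"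
      using vol_cut_mcomb(1)[of K K "1 - t" t u x y "h x" "h y"] K t u xy h by (auto simp: convex_body_def)
    then show "h ((1 - t) *\<^sub>R x + t *\<^sub>R y) \<le> (1 - t) * h x + t * h y"
      using le[OF K m h[OF m]] by simp
  qed simp
  have matched: "vol (?C \<inter> {x. x \<bullet> u < p * f r + q * g r}) = r ^ ?d" if r: "r \<in> {0<..<R}" for r
  proof (rule antisym)
    show "r ^ ?d \<le> vol (?C \<inter> {x. x \<bullet> u < p * f r + q * g r})"
      using vol_cut_mcomb(1)[OF cc pq(1,2) u, of r r "f r" "g r"] f[OF r] g[OF r] r pq
      by (simp flip: distrib_right)
    \<comment> \<open>The parts above the cuts bound the same volume from the other side.\<close>
  define r' where "r' = root ?d (vol A - r ^ ?d)"
    have r': "r' > 0" "r' ^ ?d = vol A - r ^ ?d" using rR[OF r] by (auto simp: r'_def)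
    then have "r' ^ ?d \<le> vol ?C - vol (?C \<inter> {x. x \<bullet> u < p * f r + q * g r})"
      using vol_cut_mcomb(2)[OF cc pq(1,2) u, of r' r' "f r" "g r"] f[OF r] g[OF r] r pq V
      by (simp flip: distrib_right)
    then show "vol (?C \<inter> {x. x \<bullet> u < p * f r + q * g r}) \<le> r ^ ?d" using r' V by simp
  qed
  have "\<exists>k. \<forall>t\<in>{0<..<R}. - f t = - g t + k"
  proof (rule diff_const_if_diagonal_maximal[OF _ _ pq])
    show "continuous_on {0<..<R} (\<lambda>t. - f t)" "continuous_on {0<..<R} (\<lambda>t. - g t)"
      using convex_on_continuous[OF _ conv[OF A _ f]] convex_on_continuous[OF _ conv[OF B V(1) g]]
      by (auto intro!: continuous_intros)
    fix t t' assume t: "t \<in> {0<..<R}" "t' \<in> {0<..<R}"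
    let ?m = "p * t + q * t'"
    have m: "?m \<in> {0<..<R}" using comb[OF t pq] .
    have "?m ^ ?d \<le> vol (?C \<inter> {x. x \<bullet> u < p * f t + q * g t'})"
      using vol_cut_mcomb(1)[OF cc pq(1,2) u, of t t' "f t" "g t'"] f[OF t(1)] g[OF t(2)] t by simp
    then have "p * f ?m + q * g ?m \<le> p * f t + q * g t'"
      using le[OF C V(2) m matched[OF m]] by simp
    then show "p * - f t + q * - g t' \<le> p * - f ?m + q * - g ?m" by simp
  qed
  then obtain k where k: "\<And>t. t \<in> {0<..<R} \<Longrightarrow> f t = g t + k"
    by (metis add.inverse_inverse diff_add_cancel minus_add_distrib uminus_add_conv_diff)
  have bd: "0 \<le> vol (K \<inter> {x. x \<bullet> u < t})" "vol (K \<inter> {x. x \<bullet> u < t}) \<le> vol K" if "convex_body K" for K t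
    using vol_cut_add[OF convex_body_lmeasurable[OF that] u, of t] measure_nonneg by auto
  have "vol (A \<inter> {x. x \<bullet> u < t}) = vol (B \<inter> {x. x \<bullet> u < t - k})" for t
  proof (rule ccontr)
    assume "vol (A \<inter> {x. x \<bullet> u < t}) \<noteq> vol (B \<inter> {x. x \<bullet> u < t - k})" (is "?a \<noteq> ?b")
    \<comment> \<open>A volume strictly between the two is cut off at one and the same level from \<open>A\<close> and from the shifted \<open>B\<close>, and this level lies on neither side of \<open>t\<close>.\<close>
    define \<rho> where "\<rho> = (?a + ?b) / 2"
    have bds: "0 \<le> ?a" "?a \<le> vol A" "0 \<le> ?b" "?b \<le> vol A"
      using bd[OF A, of t] bd[OF B, of "t - k"] V(1) by auto
    have "0 < (a + b) / 2 \<and> (a + b) / 2 < c" if "0 \<le> a" "a \<le> c" "0 \<le> b" "b \<le> c" "a \<noteq> b" for a b c :: real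
      using that by auto
    from this[OF bds \<open>?a \<noteq> ?b\<close>] have "0 < \<rho>" "\<rho> < vol A" unfolding \<rho>_def by blast+
    then have r: "root ?d \<rho> \<in> {0<..<R}" "root ?d \<rho> ^ ?d = \<rho>" by (auto simp: R_def)
    have fa: "vol (A \<inter> {x. x \<bullet> u < f (root ?d \<rho>)}) = \<rho>" "vol (B \<inter> {x. x \<bullet> u < f (root ?d \<rho>) - k}) = \<rho>"
      using f[OF r(1)] g[OF r(1)] k[OF r(1)] r(2) by auto
    consider "t \<le> f (root ?d \<rho>)" | "f (root ?d \<rho>) \<le> t" by linarith
    then show False
    proof cases
      case 1
      then show False using mono[OF 1 A] mono[of "t - k" "f (root ?d \<rho>) - k" B] B fa \<open>?a \<noteq> ?b\<close> by (simp add: \<rho>_def field_simps)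
    next
      case 2
      then show False using mono[OF 2 A] mono[of "f (root ?d \<rho>) - k" "t - k" B] B fa \<open>?a \<noteq> ?b\<close> by (simp add: \<rho>_def field_simps)
    qed
  qed
  then show ?thesis by blast
qed

text \<open>The cut volumes determine the distribution of \<open>x \<bullet> u\<close> on either body; compare its means.\<close>
lemma cut_shift_centroid:
  fixes A B :: "'a::euclidean_space set"
  assumes A: "convex_body A" and B: "convex_body B" and V: "vol B = vol A" and u: "u \<noteq> 0"
    and cut: "\<And>t. vol (A \<inter> {x. x \<bullet> u < t}) = vol (B \<inter> {x. x \<bullet> u < t - k})"
  shows "k * vol A = ((\<integral>x. indicator A x *\<^sub>R x \<partial>lborel) - (\<integral>x. indicator B x *\<^sub>R x \<partial>lborel)) \<bullet> u"
proof -
  have bA: "compact A" "A \<in> sets borel" and bB: "compact B" "B \<in> sets borel"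
    using A B by (auto simp: convex_body_def borel_compact)
  let ?M = "distr (restrict_space lborel A) borel (\<lambda>x. x \<bullet> u)"
  let ?N = "distr (restrict_space lborel B) borel (\<lambda>x. x \<bullet> u + k)"
  have em: "emeasure (distr (restrict_space lborel K) borel h) {t<..} = ennreal (vol (K \<inter> {x. h x > t}))"
    if K: "compact K" "K \<in> sets borel" and h: "h \<in> borel_measurable borel" for K and h :: "'a \<Rightarrow> real" and t
  proof -
    have hK: "h \<in> restrict_space lborel K \<rightarrow>\<^sub>M borel" using h by (intro measurable_restrict_space1) simp
    have s: "{x. h x > t} \<in> sets borel" using h by measurable
    have "emeasure (distr (restrict_space lborel K) borel h) {t<..}
        = emeasure (restrict_space lborel K) (h -` {t<..} \<inter> space (restrict_space lborel K))"
      by (rule emeasure_distr[OF hK]) simp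
    also have "h -` {t<..} \<inter> space (restrict_space lborel K) = K \<inter> {x. h x > t}"
      by (auto simp: space_restrict_space)
    also have "emeasure (restrict_space lborel K) (K \<inter> {x. h x > t}) = emeasure lborel (K \<inter> {x. h x > t})"
      using K by (intro emeasure_restrict_space) auto
    also have "\<dots> = ennreal (measure lborel (K \<inter> {x. h x > t}))"
      using K emeasure_mono[of "K \<inter> {x. h x > t}" K lborel] emeasure_compact_finite[OF K(1)]
      by (intro emeasure_eq_ennreal_measure) (auto simp: top_unique)
    also have "measure lborel (K \<inter> {x. h x > t}) = vol (K \<inter> {x. h x > t})"
      using K s by (simp add: measure_completion)
    finally show ?thesis .
  qed
  have eqMN: "?M = ?N"
  proof (rule measure_eqI_lessThan)
    fix t
    have "vol (A \<inter> {x. x \<bullet> u > t}) = vol (B \<inter> {x. x \<bullet> u > t - k})"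
      using vol_cut_add[OF convex_body_lmeasurable[OF A] u, of t] vol_cut_add[OF convex_body_lmeasurable[OF B] u, of "t - k"]
        cut[of t] V by simp
    moreover have "{x. x \<bullet> u > t - k} = {x. x \<bullet> u + k > t}" by auto
    ultimately show "emeasure ?M {t<..} = emeasure ?N {t<..}"
      using em[OF bA, of "\<lambda>x. x \<bullet> u" t] em[OF bB, of "\<lambda>x. x \<bullet> u + k" t] by simp
    show "emeasure ?M {t<..} < \<infinity>" using em[OF bA, of "\<lambda>x. x \<bullet> u" t] by simp
  qed simp_all
  have int: "(\<integral>t. t \<partial>distr (restrict_space lborel K) borel (\<lambda>x. x \<bullet> u + c))
      = (\<integral>x. indicator K x *\<^sub>R x \<partial>lborel) \<bullet> u + c * vol K"
    if K: "compact K" "K \<in> sets borel" for K c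
  proof -
    have "(\<integral>t. t \<partial>distr (restrict_space lborel K) borel (\<lambda>x. x \<bullet> u + c)) = (\<integral>x. x \<bullet> u + c \<partial>restrict_space lborel K)"
      by (intro integral_distr measurable_restrict_space1) simp_all
    also have "\<dots> = (\<integral>x. indicator K x *\<^sub>R (x \<bullet> u + c) \<partial>lborel)"
      using K by (subst integral_restrict_space) auto
    also have "\<dots> = (\<integral>x. (indicator K x *\<^sub>R x) \<bullet> u + indicator K x *\<^sub>R c \<partial>lborel)"
      by (intro Bochner_Integration.integral_cong) (auto simp: algebra_simps)
    also have "\<dots> = (\<integral>x. (indicator K x *\<^sub>R x) \<bullet> u \<partial>lborel) + (\<integral>x. indicator K x *\<^sub>R c \<partial>lborel)"
      using borel_integrable_compact[OF K(1), of "\<lambda>x. x"] borel_integrable_compact[OF K(1), of "\<lambda>x. c"]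
      by (intro Bochner_Integration.integral_add integrable_inner_left) auto
    also have "\<dots> = (\<integral>x. indicator K x *\<^sub>R x \<partial>lborel) \<bullet> u + c * vol K"
    proof -
      have "(\<integral>x. (indicator K x *\<^sub>R x) \<bullet> u \<partial>lborel) = (\<integral>x. indicator K x *\<^sub>R x \<partial>lborel) \<bullet> u"
        using borel_integrable_compact[OF K(1), of "\<lambda>x. x"] by (intro integral_inner_left) auto
      then show ?thesis using K by (simp add: measure_completion)
    qed
    finally show ?thesis .
  qed
  show ?thesis
    using int[OF bA, of 0] int[OF bB, of k] eqMN V by (simp add: inner_diff_left)
qed

text \<open>In every direction the two bodies have the same cut volumes up to a shift, and by comparing centroids the
  shift is linear in the direction. After the corresponding translation all half-spaces cut both
  bodies in equal volumes, and then separation by hyperplanes shows that the bodies coincide.\<close>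
theorem brunn_minkowski_equality:
  fixes A B :: "'a::euclidean_space set"
  assumes A: "convex_body A" and B: "convex_body B" and pq: "p > 0" "q > 0" "p + q = 1"
    and V: "vol B = vol A" "vol (mcomb p A q B) \<le> vol A"
  shows "\<exists>z. A = (+) z ` B"
proof -
  define z where "z = (1 / vol A) *\<^sub>R ((\<integral>x. indicator A x *\<^sub>R x \<partial>lborel) - (\<integral>x. indicator B x *\<^sub>R x \<partial>lborel))"
  have V0: "vol A > 0" using A by (rule vol_convex_body_pos)
  define R where "R = root DIM('a) (vol A)"
  have R: "R > 0" "R ^ DIM('a) = vol A" using V0 by (auto simp: R_def)
  have "vol A \<le> vol (mcomb p A q B)"
    using brunn_minkowski_convex[of A B p q R R] A B pq R V by (simp add: convex_body_def flip: distrib_right)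
  then have V': "vol (mcomb p A q B) = vol A" using V by simp
  have cut: "vol (A \<inter> {x. x \<bullet> u < t}) = vol (B \<inter> {x. x \<bullet> u < t - z \<bullet> u})" if u: "u \<noteq> 0" for u t
  proof -
    obtain k where k: "\<And>t. vol (A \<inter> {x. x \<bullet> u < t}) = vol (B \<inter> {x. x \<bullet> u < t - k})"
      using brunn_minkowski_equality_cut[OF A B pq u V(1) V'] by blast
    have "k = z \<bullet> u"
      unfolding z_def inner_scaleR_left cut_shift_centroid[OF A B V(1) u k, symmetric] using V0 by simp
    then show ?thesis using k by simp
  qed
  have op: "open {x. x \<bullet> a < b}" for a :: 'a and b
    using open_halfspace_lt[of a b] by (simp add: inner_commute)
  have "x - z \<in> B" if x: "x \<in> A" for x
  proof (rule ccontr)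
    assume "x - z \<notin> B"
    then obtain a b where ab: "a \<bullet> (x - z) < b" "\<And>y. y \<in> B \<Longrightarrow> a \<bullet> y > b"
      using separating_hyperplane_closed_point[of B "x - z"] B by (auto simp: convex_body_def compact_imp_closed)
    obtain y where "y \<in> B" using B interior_subset by (auto simp: convex_body_def)
    with ab have a: "a \<noteq> 0" by fastforce
    have "B \<inter> {x. x \<bullet> a < b} = {}" using ab by (force simp: inner_commute)
    then have "vol (A \<inter> {x. x \<bullet> a < b + z \<bullet> a}) = 0" using cut[OF a, of "b + z \<bullet> a"] by simp
    moreover have "x \<in> A \<inter> {x. x \<bullet> a < b + z \<bullet> a}" using x ab by (simp add: inner_diff_right inner_commute)
    ultimately show False using vol_Int_open_pos[OF A op[of a "b + z \<bullet> a"]] by auto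
  qed
  moreover have "z + y \<in> A" if y: "y \<in> B" for y
  proof (rule ccontr)
    assume "z + y \<notin> A"
    then obtain a b where ab: "a \<bullet> (z + y) < b" "\<And>x. x \<in> A \<Longrightarrow> a \<bullet> x > b"
      using separating_hyperplane_closed_point[of A "z + y"] A by (auto simp: convex_body_def compact_imp_closed)
    obtain x where "x \<in> A" using A interior_subset by (auto simp: convex_body_def)
    with ab have a: "a \<noteq> 0" by fastforce
    have "A \<inter> {x. x \<bullet> a < b} = {}" using ab by (force simp: inner_commute)
    then have "vol (B \<inter> {x. x \<bullet> a < b - z \<bullet> a}) = 0" using cut[OF a, of b] by simp
    moreover have "y \<in> B \<inter> {x. x \<bullet> a < b - z \<bullet> a}" using y ab by (simp add: inner_add_right inner_commute)
    ultimately show False using vol_Int_open_pos[OF B op[of a "b - z \<bullet> a"]] by auto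
  qed
  ultimately have "A = (+) z ` B" by (force simp: image_iff)
  then show ?thesis by blast
qed

text \<open>Besides prisms over sections, with a unit normal \<open>u\<close>, these sets describe the result of stretching along an
  arbitrary vector.\<close>
section \<open>Volumes of hyperplane sections\<close>

definition prism :: "'a::euclidean_space \<Rightarrow> real \<Rightarrow> 'a set \<Rightarrow> 'a set" where
  "prism u l S = {x + \<tau> *\<^sub>R u |x \<tau>. x \<in> S \<and> 0 \<le> \<tau> \<and> \<tau> \<le> l}"

abbreviation slice :: "'a::euclidean_space \<Rightarrow> 'a set \<Rightarrow> real \<Rightarrow> 'a set" where
  "slice u K t \<equiv> K \<inter> {x. x \<bullet> u = t}"

text \<open>The \<open>(d-1)\<close>-volume of a section, expressed as the \<open>d\<close>-volume of the prism of height one over it. In this form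
  statements about sections follow from full-dimensional ones.\<close>
definition sec :: "'a::euclidean_space \<Rightarrow> 'a set \<Rightarrow> real \<Rightarrow> real" where
  "sec u K t = vol (prism u 1 (slice u K t))"

lemma inner_unit: "norm u = 1 \<Longrightarrow> u \<bullet> u = 1" for u :: "'a::real_inner"
  by (simp add: norm_eq_1)

lemma prism_slice_iff:
  assumes u: "norm u = 1"
  shows "x \<in> prism u l (slice u K t) \<longleftrightarrow> 0 \<le> x \<bullet> u - t \<and> x \<bullet> u - t \<le> l \<and> x - (x \<bullet> u - t) *\<^sub>R u \<in> K"
proof
  assume "x \<in> prism u l (slice u K t)"
  then obtain y \<tau> where "x = y + \<tau> *\<^sub>R u" "y \<in> K" "y \<bullet> u = t" "0 \<le> \<tau>" "\<tau> \<le> l"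
    by (auto simp: prism_def)
  then show "0 \<le> x \<bullet> u - t \<and> x \<bullet> u - t \<le> l \<and> x - (x \<bullet> u - t) *\<^sub>R u \<in> K"
    using inner_unit[OF u] by (simp add: inner_add_left)
next
  assume *: "0 \<le> x \<bullet> u - t \<and> x \<bullet> u - t \<le> l \<and> x - (x \<bullet> u - t) *\<^sub>R u \<in> K"
  then have "x - (x \<bullet> u - t) *\<^sub>R u \<in> slice u K t"
    using inner_unit[OF u] by (simp add: inner_diff_left)
  then show "x \<in> prism u l (slice u K t)"
    using * unfolding prism_def by (intro CollectI exI[of _ "x - (x \<bullet> u - t) *\<^sub>R u"] exI[of _ "x \<bullet> u - t"]) auto
qed

lemma prism_eq: "prism u l S = (\<lambda>(x, \<tau>). x + \<tau> *\<^sub>R u) ` (S \<times> {0..l})"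
proof (intro equalityI subsetI)
  fix x assume "x \<in> prism u l S"
  then obtain y \<tau> where "x = y + \<tau> *\<^sub>R u" "y \<in> S" "0 \<le> \<tau>" "\<tau> \<le> l" by (auto simp: prism_def)
  then show "x \<in> (\<lambda>(x, \<tau>). x + \<tau> *\<^sub>R u) ` (S \<times> {0..l})" by (intro image_eqI[of _ _ "(y, \<tau>)"]) auto
next
  fix x assume "x \<in> (\<lambda>(x, \<tau>). x + \<tau> *\<^sub>R u) ` (S \<times> {0..l})"
  then obtain y \<tau> where "x = y + \<tau> *\<^sub>R u" "y \<in> S" "0 \<le> \<tau>" "\<tau> \<le> l" by auto
  then show "x \<in> prism u l S" unfolding prism_def by blast
qed

lemma compact_prism: "compact S \<Longrightarrow> compact (prism u l S)"
  unfolding prism_eq by (intro compact_continuous_image compact_Times) (auto intro!: continuous_intros simp: case_prod_beta)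

lemma convex_prism: "convex S \<Longrightarrow> convex (prism u l S)"
proof -
  assume "convex S"
  then have "convex ((\<lambda>(x, \<tau>). x + \<tau> *\<^sub>R u) ` (S \<times> {0..l}))"
    by (intro convex_linear_image convex_Times)
       (auto simp: linear_iff scaleR_add_left scaleR_add_right)
  then show ?thesis by (simp add: prism_eq)
qed

lemma prism_mono: "S \<subseteq> S' \<Longrightarrow> prism u l S \<subseteq> prism u l S'"
  by (auto simp: prism_def)

lemma compact_prism_slice: "compact K \<Longrightarrow> compact (prism u l (slice u K t))"
  by (intro compact_prism compact_cut)

lemma emeasure_compact_vol: "compact S \<Longrightarrow> emeasure lborel S = ennreal (vol S)"
  using emeasure_compact_finite[of S]
  by (simp add: emeasure_eq_ennreal_measure borel_compact measure_completion less_top)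

text \<open>The prism over the section at level \<open>t\<close> consists of the \<open>x\<close> with \<open>x - (x \<bullet> u - t) u \<in> K\<close> and \<open>0 \<le> x \<bullet> u - t \<le> 1\<close>.
  After exchanging integrals and substituting \<open>t = x \<bullet> u - \<tau>\<close> for fixed \<open>x\<close>, the integral of the volumes of the prisms becomes the average over \<open>\<tau>\<close>
  in \<open>[0, 1]\<close> of the volumes of the translates \<open>K + \<tau> u\<close>.\<close>
lemma fubini_sections:
  fixes K :: "'a::euclidean_space set"
  assumes u: "norm u = 1" and K: "compact K"
  shows "(\<lambda>t. sec u K t) \<in> borel_measurable borel"
    and "(\<integral>\<^sup>+t. ennreal (sec u K t) \<partial>lborel) = ennreal (vol K)"
proof -
  define W where "W = {(x, t). 0 \<le> x \<bullet> u - t \<and> x \<bullet> u - t \<le> 1 \<and> x - (x \<bullet> u - t) *\<^sub>R u \<in> K}"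
  have Kc: "closed K" using K by (rule compact_imp_closed)
  have "closed W"
  proof -
    have "W = {z. 0 \<le> fst z \<bullet> u - snd z} \<inter> {z. fst z \<bullet> u - snd z \<le> 1} \<inter>
        (\<lambda>z. fst z - (fst z \<bullet> u - snd z) *\<^sub>R u) -` K"
      by (auto simp: W_def)
    also have "closed \<dots>"
      by (intro closed_Int closed_Collect_le closed_vimage[OF Kc] continuous_intros)
    finally show ?thesis .
  qed
  then have W[measurable]: "W \<in> sets (borel \<Otimes>\<^sub>M borel)" by (metis borel_closed borel_prod)
  have sec: "ennreal (sec u K t) = (\<integral>\<^sup>+x. indicator W (x, t) \<partial>lborel)" for t
  proof -
    have "ennreal (sec u K t) = emeasure lborel (prism u 1 (slice u K t))"
      unfolding sec_def by (rule emeasure_compact_vol[symmetric]) (rule compact_prism_slice[OF K])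
    also have "\<dots> = (\<integral>\<^sup>+x. indicator (prism u 1 (slice u K t)) x \<partial>lborel)"
      by (intro nn_integral_indicator[symmetric]) (simp add: borel_compact compact_prism_slice[OF K])
    also have "\<dots> = (\<integral>\<^sup>+x. indicator W (x, t) \<partial>lborel)"
      by (intro nn_integral_cong) (auto simp: W_def prism_slice_iff[OF u] split: split_indicator)
    finally show ?thesis .
  qed
  have "(\<lambda>t. \<integral>\<^sup>+x. indicator W (x, t) \<partial>lborel) \<in> borel_measurable borel"
    by measurable
  then have "(\<lambda>t. ennreal (sec u K t)) \<in> borel_measurable borel" unfolding sec .
  then have "(\<lambda>t. enn2real (ennreal (sec u K t))) \<in> borel_measurable borel" by measurable
  then show "(\<lambda>t. sec u K t) \<in> borel_measurable borel" by (simp add: sec_def)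
  have [measurable]: "K \<in> sets borel" using K by (rule borel_compact)
  have "(\<integral>\<^sup>+t. ennreal (sec u K t) \<partial>lborel) = (\<integral>\<^sup>+t. \<integral>\<^sup>+x. indicator W (x, t) \<partial>lborel \<partial>lborel)"
    by (simp add: sec)
  also have "\<dots> = (\<integral>\<^sup>+x. \<integral>\<^sup>+t. indicator W (x, t) \<partial>lborel \<partial>lborel)"
    by (rule lborel_pair.Fubini') simp
  also have "\<dots> = (\<integral>\<^sup>+x. \<integral>\<^sup>+\<tau>. indicator {0..1} \<tau> * indicator K (x - \<tau> *\<^sub>R u) \<partial>lborel \<partial>lborel)"
  proof (rule nn_integral_cong)
    fix x :: 'a
    have "(\<integral>\<^sup>+t. indicator W (x, t) \<partial>lborel) = ennreal \<bar>-1\<bar> * (\<integral>\<^sup>+\<tau>. indicator W (x, x \<bullet> u + -1 * \<tau>) \<partial>lborel)"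
      by (rule nn_integral_real_affine) auto
    also have "\<dots> = (\<integral>\<^sup>+\<tau>. indicator {0..1} \<tau> * indicator K (x - \<tau> *\<^sub>R u) \<partial>lborel)"
      by (simp, intro nn_integral_cong) (auto simp: W_def split: split_indicator)
    finally show "(\<integral>\<^sup>+t. indicator W (x, t) \<partial>lborel) = (\<integral>\<^sup>+\<tau>. indicator {0..1} \<tau> * indicator K (x - \<tau> *\<^sub>R u) \<partial>lborel)" .
  qed
  also have "\<dots> = (\<integral>\<^sup>+\<tau>. \<integral>\<^sup>+x. indicator {0..1} \<tau> * indicator K (x - \<tau> *\<^sub>R u) \<partial>lborel \<partial>lborel)"
    by (rule lborel_pair.Fubini'[symmetric]) measurable
  also have "\<dots> = (\<integral>\<^sup>+\<tau>. indicator {0..1::real} \<tau> * ennreal (vol K) \<partial>lborel)"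
  proof (rule nn_integral_cong)
    fix \<tau> :: real
    have "(\<integral>\<^sup>+x. indicator K (x - \<tau> *\<^sub>R u) \<partial>lborel) = (\<integral>\<^sup>+x. indicator K x \<partial>distr lborel borel ((+) (- (\<tau> *\<^sub>R u))))"
      by (subst nn_integral_distr) (auto simp: algebra_simps)
    also have "\<dots> = ennreal (vol K)"
      unfolding lborel_distr_plus by (simp add: emeasure_compact_vol[OF K])
    finally show "(\<integral>\<^sup>+x. indicator {0..1} \<tau> * indicator K (x - \<tau> *\<^sub>R u) \<partial>lborel) = indicator {0..1::real} \<tau> * ennreal (vol K)"
      by (subst nn_integral_cmult) auto
  qed
  also have "\<dots> = ennreal (vol K)"
    by (subst nn_integral_multc) auto
  finally show "(\<integral>\<^sup>+t. ennreal (sec u K t) \<partial>lborel) = ennreal (vol K)" .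
qed

lemma sec_nonneg: "0 \<le> sec u K t" by (simp add: sec_def)

lemma sec_empty: "slice u K t = {} \<Longrightarrow> sec u K t = 0"
  by (simp add: sec_def prism_def)

lemma sec_mono:
  assumes "compact K" "compact K'" "slice u K t \<subseteq> slice u K' t"
  shows "sec u K t \<le> sec u K' t"
  unfolding sec_def using assms
  by (intro measure_mono_fmeasurable prism_mono) (auto intro!: lmeasurable_compact compact_prism_slice fmeasurableD)

lemma sec_translation: "sec u ((+) z ` K) (z \<bullet> u + t) = sec u K t"
proof -
  have "slice u ((+) z ` K) (z \<bullet> u + t) = (+) z ` slice u K t"
    by (auto simp: inner_add_left)
  moreover have "prism u 1 ((+) z ` S) = (+) z ` prism u 1 S" for S
    by (auto simp: prism_def image_iff ac_simps) (metis add.assoc)+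
  ultimately show ?thesis by (simp add: sec_def measure_translation)
qed

text \<open>All sections of the prism in its range of levels are translates of the base; apply Fubini.\<close>
lemma vol_prism_slice:
  assumes u: "norm u = 1" and K: "compact K" and l: "0 \<le> l"
  shows "vol (prism u l (slice u K t)) = l * sec u K t"
proof -
  let ?P = "prism u l (slice u K t)"
  have P: "compact ?P" using K by (rule compact_prism_slice)
  have "sec u ?P s = indicator {t..t + l} s * sec u K t" for s
  proof (cases "s \<in> {t..t + l}")
    case True
    have "slice u ?P s = (+) ((s - t) *\<^sub>R u) ` slice u K t"
    proof (intro equalityI subsetI)
      fix x assume "x \<in> slice u ?P s"
      then have "x \<bullet> u = s" "x - (s - t) *\<^sub>R u \<in> K" using prism_slice_iff[OF u, of x l K t] by auto
      then show "x \<in> (+) ((s - t) *\<^sub>R u) ` slice u K t"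
        using inner_unit[OF u] by (intro image_eqI[of _ _ "x - (s - t) *\<^sub>R u"]) (auto simp: inner_diff_left)
    next
      fix x assume "x \<in> (+) ((s - t) *\<^sub>R u) ` slice u K t"
      then show "x \<in> slice u ?P s"
        using True inner_unit[OF u] by (auto simp: prism_slice_iff[OF u] inner_add_left)
    qed
    also have "\<dots> = slice u ((+) ((s - t) *\<^sub>R u) ` K) s"
      using inner_unit[OF u] by (auto simp: inner_add_left)
    finally have "sec u ?P s = sec u ((+) ((s - t) *\<^sub>R u) ` K) s" by (simp add: sec_def)
    also have "\<dots> = sec u K t" using sec_translation[of u "(s - t) *\<^sub>R u" K t] inner_unit[OF u] by simp
    finally show ?thesis using True by simp
  next
    case False
    then have "slice u ?P s = {}" by (auto simp: prism_slice_iff[OF u])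
    then show ?thesis using False sec_empty by auto
  qed
  then have "ennreal (vol ?P) = (\<integral>\<^sup>+s. indicator {t..t + l} s * ennreal (sec u K t) \<partial>lborel)"
    unfolding fubini_sections(2)[OF u P, symmetric]
    by (intro nn_integral_cong) (auto split: split_indicator)
  also have "\<dots> = ennreal (l * sec u K t)"
    using l by (subst nn_integral_multc) (auto simp: ennreal_mult sec_nonneg)
  finally show ?thesis using l by (simp add: sec_nonneg)
qed

lemma sec_scale:
  fixes K :: "'a::euclidean_space set"
  assumes u: "norm u = 1" and K: "compact K" and c: "c > 0"
  shows "sec u ((*\<^sub>R) c ` K) (c * t) = c ^ (DIM('a) - 1) * sec u K t"
proof -
  have sl: "slice u ((*\<^sub>R) c ` K) (c * t) = (*\<^sub>R) c ` slice u K t" using c by auto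
  have "prism u 1 ((*\<^sub>R) c ` S) = (*\<^sub>R) c ` prism u (1 / c) S" for S
  proof (intro equalityI subsetI)
    fix x assume "x \<in> prism u 1 ((*\<^sub>R) c ` S)"
    then obtain y \<tau> where "x = c *\<^sub>R y + \<tau> *\<^sub>R u" "y \<in> S" "0 \<le> \<tau>" "\<tau> \<le> 1" by (auto simp: prism_def)
    then show "x \<in> (*\<^sub>R) c ` prism u (1 / c) S"
      using c by (intro image_eqI[of _ _ "y + (\<tau> / c) *\<^sub>R u"])
        (auto simp: prism_def scaleR_add_right divide_right_mono intro!: exI[of _ y] exI[of _ "\<tau> / c"])
  next
    fix x assume "x \<in> (*\<^sub>R) c ` prism u (1 / c) S"
    then obtain y \<tau> where "x = c *\<^sub>R (y + \<tau> *\<^sub>R u)" "y \<in> S" "0 \<le> \<tau>" "\<tau> \<le> 1 / c" by (auto simp: prism_def)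
    then show "x \<in> prism u 1 ((*\<^sub>R) c ` S)"
      using c by (auto simp: prism_def scaleR_add_right field_simps intro!: exI[of _ "c *\<^sub>R y"] exI[of _ "c * \<tau>"])
  qed
  then have "sec u ((*\<^sub>R) c ` K) (c * t) = c ^ DIM('a) * (1 / c * sec u K t)"
    unfolding sec_def[of u "(*\<^sub>R) c ` K"] sl using vol_prism_slice[OF u K, of "1 / c" t] c by (simp add: vol_scale)
  also have "c ^ DIM('a) = c * c ^ (DIM('a) - 1)"
    by (metis DIM_positive Suc_diff_1 power_Suc)
  finally show ?thesis using c by simp
qed

lemma sec_reflect:
  assumes u: "norm u = 1"
  shows "sec (- u) K (- t) = sec u K t"
proof -
  have "slice (- u) K (- t) = slice u K t" by auto
  moreover have "prism (- u) 1 S = (+) (- u) ` prism u 1 S" for S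
  proof (intro equalityI subsetI)
    fix x assume "x \<in> prism (- u) 1 S"
    then obtain y \<tau> where "x = y + \<tau> *\<^sub>R - u" "y \<in> S" "0 \<le> \<tau>" "\<tau> \<le> 1" by (auto simp: prism_def)
    then show "x \<in> (+) (- u) ` prism u 1 S"
      by (intro image_eqI[of _ _ "y + (1 - \<tau>) *\<^sub>R u"])
        (auto simp: prism_def algebra_simps intro!: exI[of _ y] exI[of _ "1 - \<tau>"])
  next
    fix x assume "x \<in> (+) (- u) ` prism u 1 S"
    then obtain y \<tau> where "x = - u + (y + \<tau> *\<^sub>R u)" "y \<in> S" "0 \<le> \<tau>" "\<tau> \<le> 1" by (auto simp: prism_def)
    then show "x \<in> prism (- u) 1 S"
      by (auto simp: prism_def algebra_simps intro!: exI[of _ y] exI[of _ "1 - \<tau>"])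
  qed
  ultimately show ?thesis unfolding sec_def by (metis measure_translation)
qed

text \<open>Section volume is upper semicontinuous: prisms over sections at levels tending to \<open>\<tau>\<close> eventually lie
  in prisms over thinner and thinner slabs, and the latter shrink to the prism over the section at \<open>\<tau>\<close>.\<close>
lemma closed_sec_superlevel:
  assumes u: "norm u = 1" and K: "compact K"
  shows "closed {t. s \<le> sec u K t}"
  unfolding closed_sequential_limits
proof (intro allI impI, elim conjE)
  fix x \<tau> assume x: "\<forall>n. x n \<in> {t. s \<le> sec u K t}" and lim: "x \<longlonglongrightarrow> \<tau>"
  define U where "U m = prism u 1 (K \<inter> {y. \<bar>y \<bullet> u - \<tau>\<bar> \<le> 1 / Suc m})" for m
  have cU: "compact (U m)" for m
  proof -
    have "closed {y. \<bar>y \<bullet> u - \<tau>\<bar> \<le> 1 / Suc m}" by (intro closed_Collect_le continuous_intros)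
    then show ?thesis unfolding U_def by (intro compact_prism compact_Int_closed K)
  qed
  have "s \<le> vol (U m)" for m
  proof -
    obtain n where "dist (x n) \<tau> < 1 / Suc m"
      using lim unfolding lim_sequentially by (metis order_refl of_nat_0_less_iff zero_less_Suc zero_less_divide_1_iff)
    then have "sec u K (x n) \<le> vol (U m)"
      unfolding sec_def U_def
      using cU[of m] by (intro measure_mono_fmeasurable prism_mono)
        (auto simp: dist_real_def U_def intro!: lmeasurable_compact compact_prism_slice fmeasurableD K)
    then show ?thesis using x by (auto intro: order_trans)
  qed
  moreover have "(\<lambda>m. vol (U m)) \<longlonglongrightarrow> vol (\<Inter>m. U m)"
  proof (rule Lim_measure_decseq)
    show "range U \<subseteq> sets lebesgue" using cU by (auto intro!: fmeasurableD lmeasurable_compact)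
    show "decseq U"
    proof (rule decseq_SucI)
      fix m
      have "1 / real (Suc (Suc m)) \<le> 1 / real (Suc m)" by (simp add: field_simps)
      then show "U (Suc m) \<le> U m" unfolding U_def by (intro prism_mono) auto
    qed
    show "emeasure lebesgue (U m) \<noteq> \<infinity>" for m
      by (metis fmeasurableD2 infinity_ennreal_def lmeasurable_compact cU)
  qed
  ultimately have "s \<le> vol (\<Inter>m. U m)" by (meson LIMSEQ_le_const)
  also have "\<dots> \<le> sec u K \<tau>"
    unfolding sec_def
  proof (rule measure_mono_fmeasurable)
    show "(\<Inter>m. U m) \<subseteq> prism u 1 (slice u K \<tau>)"
    proof
      fix z assume "z \<in> (\<Inter>m. U m)"
      then have "\<forall>m. \<exists>y \<sigma>. z = y + \<sigma> *\<^sub>R u \<and> y \<in> K \<and> \<bar>y \<bullet> u - \<tau>\<bar> \<le> 1 / Suc m \<and> 0 \<le> \<sigma> \<and> \<sigma> \<le> 1"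
        by (fastforce simp: U_def prism_def)
      then obtain y \<sigma> where y: "\<And>m. z = y m + \<sigma> m *\<^sub>R u" "\<And>m. y m \<in> K" "\<And>m. \<bar>y m \<bullet> u - \<tau>\<bar> \<le> 1 / Suc m"
        "\<And>m. 0 \<le> \<sigma> m" "\<And>m. \<sigma> m \<le> 1" by metis
      have ys: "\<sigma> m = z \<bullet> u - y m \<bullet> u" for m
        using arg_cong[OF y(1)[of m], of "\<lambda>x. x \<bullet> u"] inner_unit[OF u] by (simp add: inner_add_left)
      have "(\<lambda>m. y m \<bullet> u - \<tau>) \<longlonglongrightarrow> 0"
        by (rule Lim_null_comparison[OF _ LIMSEQ_inverse_real_of_nat]) (use y(3) in \<open>auto simp: inverse_eq_divide\<close>)
      then have "(\<lambda>m. z \<bullet> u - \<tau> - (y m \<bullet> u - \<tau>)) \<longlonglongrightarrow> z \<bullet> u - \<tau> - 0" by (intro tendsto_intros)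
      moreover have "\<sigma> = (\<lambda>m. z \<bullet> u - \<tau> - (y m \<bullet> u - \<tau>))" using ys by auto
      ultimately have sl: "\<sigma> \<longlonglongrightarrow> z \<bullet> u - \<tau>" by simp
      then have "(\<lambda>m. z - \<sigma> m *\<^sub>R u) \<longlonglongrightarrow> z - (z \<bullet> u - \<tau>) *\<^sub>R u" by (intro tendsto_intros)
      moreover have "z - \<sigma> m *\<^sub>R u \<in> K" for m using y(1,2)[of m] by (metis add_diff_cancel_right')
      ultimately have "z - (z \<bullet> u - \<tau>) *\<^sub>R u \<in> K"
        using compact_imp_closed[OF K] by (meson closed_sequentially)
      moreover have "0 \<le> z \<bullet> u - \<tau>" "z \<bullet> u - \<tau> \<le> 1"
        using LIMSEQ_le_const[OF sl] LIMSEQ_le_const2[OF sl] y(4,5) by blast+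
      ultimately show "z \<in> prism u 1 (slice u K \<tau>)" by (simp add: prism_slice_iff[OF u])
    qed
    have "closed (\<Inter>m. U m)" using cU by (auto intro: compact_imp_closed)
    then show "(\<Inter>m. U m) \<in> sets lebesgue" by (simp add: borel_closed)
  qed (intro lmeasurable_compact compact_prism_slice K)
  finally show "\<tau> \<in> {t. s \<le> sec u K t}" by simp
qed

lemma sec_pos_imp_slice:
  assumes "0 < sec u K t" obtains x where "x \<in> K" "x \<bullet> u = t"
  using assms sec_empty[of K u t] by fastforce

lemma compact_sec_superlevel:
  assumes u: "norm u = 1" and K: "compact K" and s: "s > 0"
  shows "compact {t. s \<le> sec u K t}"
proof -
  obtain lo hi where "\<And>x. x \<in> K \<Longrightarrow> lo < x \<bullet> u \<and> x \<bullet> u < hi"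
    using bounded_vol_outside[of K u] K u compact_imp_bounded by (metis norm_zero zero_neq_one)
  then have "{t. s \<le> sec u K t} \<subseteq> {lo..hi}"
    using s sec_pos_imp_slice[of u K] by (smt (verit) atLeastAtMost_iff mem_Collect_eq subsetI)
  then show ?thesis
    using closed_sec_superlevel[OF u K] compact_Icc by (metis closed_Int_compact inf.absorb1)
qed

text \<open>The superlevel sets for values below the supremum are nested, compact and nonempty; the supremum is attained on their intersection.\<close>
lemma sec_max_attained:
  fixes K :: "'a::euclidean_space set"
  assumes u: "norm u = 1" and K: "convex_body K"
  obtains t0 where "0 < sec u K t0" "\<And>t. sec u K t \<le> sec u K t0"
proof -
  have Kc: "compact K" using K by (simp add: convex_body_def)
  have "\<exists>t. 0 < sec u K t"
  proof (rule ccontr)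
    assume "\<nexists>t. 0 < sec u K t"
    then have "sec u K t = 0" for t using sec_nonneg[of u K t] by (metis less_eq_real_def)
    then show False using fubini_sections(2)[OF u Kc] vol_convex_body_pos[OF K] by simp
  qed
  then obtain t1 where t1: "0 < sec u K t1" by blast
  have bdd: "bdd_above (range (sec u K))"
  proof (rule bdd_aboveI2)
    fix t show "sec u K t \<le> vol (prism u 1 K)"
      unfolding sec_def using Kc
      by (intro measure_mono_fmeasurable prism_mono fmeasurableD lmeasurable_compact compact_prism compact_cut) auto
  qed
  define M where "M = (SUP t. sec u K t)"
  have M: "sec u K t \<le> M" for t unfolding M_def using bdd by (intro cSUP_upper) auto
  have M0: "0 < M" using M[of t1] t1 by linarith
  let ?I = "\<lambda>n. {t. M * (1 - 1 / real (Suc (Suc n))) \<le> sec u K t}"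
  have pos: "0 < M * (1 - 1 / real (Suc (Suc n)))" "M * (1 - 1 / real (Suc (Suc n))) < M" for n
  proof -
    have "0 < 1 - 1 / real (Suc (Suc n))" "1 - 1 / real (Suc (Suc n)) < 1" by simp_all
    then show "0 < M * (1 - 1 / real (Suc (Suc n)))" "M * (1 - 1 / real (Suc (Suc n))) < M"
      using M0 mult_strict_left_mono[of "1 - 1 / real (Suc (Suc n))" 1 M] by auto
  qed
  have "(\<Inter>n. ?I n) \<noteq> {}"
  proof (rule compact_nest)
    show "compact (?I n)" for n by (rule compact_sec_superlevel[OF u Kc pos(1)])
    show "?I n \<noteq> {}" for n
      using less_cSUP_iff[OF _ bdd, of "M * (1 - 1 / real (Suc (Suc n)))"] pos(2)[of n]
      unfolding M_def[symmetric] by (auto intro: less_imp_le)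
    show "?I n \<subseteq> ?I m" if "m \<le> n" for m n
    proof -
      have "1 / real (Suc (Suc n)) \<le> 1 / real (Suc (Suc m))" using that by (intro divide_left_mono) auto
      then have "M * (1 - 1 / real (Suc (Suc m))) \<le> M * (1 - 1 / real (Suc (Suc n)))" using M0 by (intro mult_left_mono) auto
      then show ?thesis by auto
    qed
  qed
  then obtain t0 where t0: "\<And>n. M * (1 - 1 / real (Suc (Suc n))) \<le> sec u K t0" by auto
  have "(\<lambda>n. 1 / real (Suc (Suc n))) \<longlonglongrightarrow> 0"
    using LIMSEQ_Suc[OF LIMSEQ_inverse_real_of_nat] unfolding inverse_eq_divide .
  then have "(\<lambda>n. M * (1 - 1 / real (Suc (Suc n)))) \<longlonglongrightarrow> M * (1 - 0)"
    by (intro tendsto_intros)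
  then have "M \<le> sec u K t0" using t0 by (intro LIMSEQ_le_const2) auto
  then show ?thesis using that[of t0] M M0 by (meson less_le_trans order_trans)
qed

lemma prism_slice_mcomb_subset:
  assumes u: "norm u = 1" and pq: "p > 0" "q > 0" and AB: "mcomb p A q B \<subseteq> C"
  shows "mcomb p (prism u r (slice u A t)) q (prism u r' (slice u B t'))
     \<subseteq> prism u (p * r + q * r') (slice u C (p * t + q * t'))"
proof
  fix z assume "z \<in> mcomb p (prism u r (slice u A t)) q (prism u r' (slice u B t'))"
  then obtain a b \<tau> \<tau>' where z: "z = p *\<^sub>R (a + \<tau> *\<^sub>R u) + q *\<^sub>R (b + \<tau>' *\<^sub>R u)"
    and a: "a \<in> A" "a \<bullet> u = t" "0 \<le> \<tau>" "\<tau> \<le> r" and b: "b \<in> B" "b \<bullet> u = t'" "0 \<le> \<tau>'" "\<tau>' \<le> r'"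
    by (auto simp: mcomb_def prism_def)
  have "z = (p *\<^sub>R a + q *\<^sub>R b) + (p * \<tau> + q * \<tau>') *\<^sub>R u" by (simp add: z algebra_simps)
  moreover have "p *\<^sub>R a + q *\<^sub>R b \<in> slice u C (p * t + q * t')"
    using AB mcombI[OF a(1) b(1), of p q] a b by (auto simp: inner_add_left)
  moreover have "0 \<le> p * \<tau> + q * \<tau>'" "p * \<tau> + q * \<tau>' \<le> p * r + q * r'"
    using a b pq by (auto intro!: add_mono mult_left_mono)
  ultimately show "z \<in> prism u (p * r + q * r') (slice u C (p * t + q * t'))"
    unfolding prism_def by blast
qed

text \<open>Over sections of volumes at least \<open>r ^ (d-1)\<close> and \<open>r' ^ (d-1)\<close> erect prisms of heights \<open>r\<close> and \<open>r'\<close>. Their volumes are at least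
  \<open>r ^ d\<close> and \<open>r' ^ d\<close>, and their combination lies in a prism of height \<open>p r + q r'\<close> over a section of \<open>C\<close>.\<close>
theorem sec_brunn_minkowski:
  fixes A B C :: "'a::euclidean_space set"
  assumes u: "norm u = 1" and A: "compact A" "convex A" and B: "compact B" "convex B" and C: "compact C"
    and pq: "p > 0" "q > 0" and AB: "mcomb p A q B \<subseteq> C" and r: "r > 0" "r' > 0"
    and s: "r ^ (DIM('a) - 1) \<le> sec u A t" "r' ^ (DIM('a) - 1) \<le> sec u B t'"
  shows "(p * r + q * r') ^ (DIM('a) - 1) \<le> sec u C (p * t + q * t')"
proof -
  have d: "x ^ DIM('a) = x * x ^ (DIM('a) - 1)" for x :: real
    by (metis DIM_positive Suc_diff_1 power_Suc)
  let ?m = "p * r + q * r'"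
  have m: "?m > 0" using pq r by (simp add: add_pos_pos)
  have "?m ^ DIM('a) \<le> vol (mcomb p (prism u r (slice u A t)) q (prism u r' (slice u B t')))"
    using A B pq r s
    by (intro brunn_minkowski_convex compact_prism_slice convex_prism convex_cut) (auto simp: vol_prism_slice[OF u] d)
  also have "\<dots> \<le> vol (prism u ?m (slice u C (p * t + q * t')))"
    using A B C prism_slice_mcomb_subset[OF u pq AB]
    by (intro measure_mono_fmeasurable) (auto intro!: lmeasurable_compact compact_mcomb compact_prism_slice fmeasurableD)
  also have "\<dots> = ?m * sec u C (p * t + q * t')" using m C by (intro vol_prism_slice[OF u]) auto
  finally show ?thesis using m by (simp add: d)
qed

lemma prism_inj_slice:
  assumes u: "norm u = 1"
  shows "slice u (prism u 1 (slice u K t)) t = slice u K t"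
  using inner_unit[OF u] by (auto simp: prism_slice_iff[OF u])

text \<open>Prisms of unit height over the sections are full-dimensional bodies with equality in the
  Brunn-Minkowski inequality, and a translation between such prisms is one between their bases.\<close>
theorem sec_brunn_minkowski_equality:
  fixes A B C :: "'a::euclidean_space set"
  assumes u: "norm u = 1" and A: "compact A" "convex A" and B: "compact B" "convex B" and C: "compact C" "convex C"
    and pq: "p > 0" "q > 0" "p + q = 1" and AB: "mcomb p A q B \<subseteq> C"
    and s: "sec u A t = 1" "sec u B t' = 1" "sec u C (p * t + q * t') \<le> 1"
  obtains z where "slice u A t = (+) z ` slice u B t'"
    "slice u C (p * t + q * t') = mcomb p (slice u A t) q (slice u B t')"
proof -
  let ?X = "prism u 1 (slice u A t)" and ?Y = "prism u 1 (slice u B t')" and ?Z = "prism u 1 (slice u C (p * t + q * t'))"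
  have cv: "compact ?X" "convex ?X" "compact ?Y" "convex ?Y" "compact ?Z" "convex ?Z"
    using A B C by (auto intro!: compact_prism_slice convex_prism convex_cut)
  have v: "vol ?X = 1" "vol ?Y = 1" "vol ?Z \<le> 1" using s by (auto simp: sec_def)
  have sub: "mcomb p ?X q ?Y \<subseteq> ?Z"
    using prism_slice_mcomb_subset[OF u pq(1,2) AB, of 1 t 1 t'] pq by simp
  have c: "compact (mcomb p ?X q ?Y)" using cv by (intro compact_mcomb)
  have le: "vol (mcomb p ?X q ?Y) \<le> vol ?Z"
    using sub c cv by (intro measure_mono_fmeasurable) (auto intro!: lmeasurable_compact fmeasurableD)
  have ge: "1 \<le> vol (mcomb p ?X q ?Y)"
    using brunn_minkowski_convex[OF cv(1-4) pq(1,2), of 1 1] v pq by simp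
  have bX: "convex_body ?X" "convex_body ?Y" "convex_body ?Z"
    using cv v ge le by (auto intro!: convex_body_if_vol_pos)
  obtain z where z: "?X = (+) z ` ?Y"
    using brunn_minkowski_equality[OF bX(1,2) pq] v le by auto
  have Zeq: "mcomb p ?X q ?Y = ?Z"
    using c sub v le ge by (intro convex_body_subset_eq bX) auto
  have ne: "slice u A t \<noteq> {}" "slice u B t' \<noteq> {}" using s sec_empty[of A u t] sec_empty[of B u t'] by auto
  have z1: "z \<bullet> u = t - t'"
  proof (rule antisym)
    obtain b where b: "b \<in> slice u B t'" using ne by blast
    then have "b \<in> ?Y" using inner_unit[OF u] by (auto simp: prism_slice_iff[OF u])
    then have "z + b \<in> ?X" using z by auto
    then show "t - t' \<le> z \<bullet> u" using b by (auto simp: prism_slice_iff[OF u] inner_add_left)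
    obtain a where a: "a \<in> slice u A t" using ne by blast
    then have "a \<in> ?X" using inner_unit[OF u] by (auto simp: prism_slice_iff[OF u])
    then obtain y where "y \<in> ?Y" "a = z + y" using z by auto
    then show "z \<bullet> u \<le> t - t'" using a by (auto simp: prism_slice_iff[OF u] inner_add_left)
  qed
  have "slice u A t = slice u ?X t" using prism_inj_slice[OF u] by simp
  also have "\<dots> = (+) z ` slice u ?Y t'" unfolding z using z1 by (auto simp: inner_add_left)
  also have "\<dots> = (+) z ` slice u B t'" using prism_inj_slice[OF u] by simp
  finally have 1: "slice u A t = (+) z ` slice u B t'" .
  have "slice u C (p * t + q * t') = slice u ?Z (p * t + q * t')" using prism_inj_slice[OF u] by simp
  also have "\<dots> \<subseteq> mcomb p (slice u A t) q (slice u B t')"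
  proof
    fix w assume w: "w \<in> slice u ?Z (p * t + q * t')"
    then obtain x y where xy: "x \<in> ?X" "y \<in> ?Y" "w = p *\<^sub>R x + q *\<^sub>R y" unfolding Zeq[symmetric] by (auto simp: mcomb_def)
    have ge: "t \<le> x \<bullet> u" "t' \<le> y \<bullet> u" using xy by (auto simp: prism_slice_iff[OF u])
    have "p * (x \<bullet> u - t) + q * (y \<bullet> u - t') = 0" using w xy(3) by (simp add: inner_add_left algebra_simps)
    moreover have "0 \<le> p * (x \<bullet> u - t)" "0 \<le> q * (y \<bullet> u - t')" using ge pq by auto
    ultimately have "p * (x \<bullet> u - t) = 0" "q * (y \<bullet> u - t') = 0" by linarith+
    then have "x \<bullet> u = t" "y \<bullet> u = t'" using pq by auto
    then have "x \<in> slice u A t" "y \<in> slice u B t'" using xy by (auto simp: prism_slice_iff[OF u])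
    then show "w \<in> mcomb p (slice u A t) q (slice u B t')" using xy(3) by (auto simp: mcomb_def)
  qed
  finally have "slice u C (p * t + q * t') = mcomb p (slice u A t) q (slice u B t')"
    using AB by (auto simp: mcomb_def inner_add_left)
  with 1 show ?thesis by (rule that)
qed

text \<open>The properties of section volume as a function of the level: superlevel sets at positive heights are compact intervals, and the
  \<open>n\<close>-th root is concave where the function is positive. The latter is stated through lower bounds \<open>r ^ n\<close>, which is the form in
  which the Brunn-Minkowski inequality provides it.\<close>
section \<open>Profiles with equality in Bonnesen's inequality\<close>

locale concave_profile =
  fixes n :: nat and f :: "real \<Rightarrow> real"
  assumes n_pos: "n > 0"
    and nonneg: "\<And>t. 0 \<le> f t"
    and meas: "f \<in> borel_measurable borel"
    and compact_super: "\<And>s. s > 0 \<Longrightarrow> compact {t. s \<le> f t}"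
    and conc: "\<And>t t' r r' x. \<lbrakk>0 < r; 0 < r'; r ^ n \<le> f t; r' ^ n \<le> f t'; 0 < x; x < 1\<rbrakk>
      \<Longrightarrow> ((1 - x) * r + x * r') ^ n \<le> f ((1 - x) * t + x * t')"
    and top: "\<exists>t. 1 \<le> f t"
begin

text \<open>The left end of the superlevel set at height \<open>r ^ n\<close>. Parametrised by \<open>r\<close> instead of the
  height itself it is a convex function.\<close>
definition lend :: "real \<Rightarrow> real" where "lend r = Inf {t. r ^ n \<le> f t}"
definition rend :: "real \<Rightarrow> real" where "rend r = Sup {t. r ^ n \<le> f t}"

lemma super_compact: "0 < r \<Longrightarrow> compact {t. r ^ n \<le> f t}"
  by (rule compact_super) simp

lemma super_nonempty: "0 < r \<Longrightarrow> r \<le> 1 \<Longrightarrow> {t. r ^ n \<le> f t} \<noteq> {}"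
  using top power_le_one[of r n] by (metis (mono_tags) empty_iff less_eq_real_def mem_Collect_eq order_trans)

lemma lend_mem: "0 < r \<Longrightarrow> r \<le> 1 \<Longrightarrow> r ^ n \<le> f (lend r)"
  and rend_mem: "0 < r \<Longrightarrow> r \<le> 1 \<Longrightarrow> r ^ n \<le> f (rend r)"
proof -
  assume r: "0 < r" "r \<le> 1"
  have "Inf {t. r ^ n \<le> f t} \<in> {t. r ^ n \<le> f t}" "Sup {t. r ^ n \<le> f t} \<in> {t. r ^ n \<le> f t}"
    by (rule closed_contains_Inf closed_contains_Sup; use r super_nonempty super_compact[of r] in
        \<open>simp add: compact_imp_closed compact_imp_bounded bounded_imp_bdd_below bounded_imp_bdd_above\<close>)+
  then show "r ^ n \<le> f (lend r)" "r ^ n \<le> f (rend r)" unfolding lend_def rend_def by auto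
qed

lemma lend_le: "0 < r \<Longrightarrow> r ^ n \<le> f t \<Longrightarrow> lend r \<le> t"
  unfolding lend_def using super_compact[of r]
  by (intro cInf_lower bounded_imp_bdd_below compact_imp_bounded) auto

lemma rend_ge: "0 < r \<Longrightarrow> r ^ n \<le> f t \<Longrightarrow> t \<le> rend r"
  unfolding rend_def using super_compact[of r]
  by (intro cSup_upper bounded_imp_bdd_above compact_imp_bounded) auto

lemma between:
  assumes "0 < r" "r ^ n \<le> f a" "r ^ n \<le> f b" "a \<le> t" "t \<le> b"
  shows "r ^ n \<le> f t"
proof (cases "a < t \<and> t < b")
  case True
  define x where "x = (t - a) / (b - a)"
  have "0 < x" "x < 1" "x * (b - a) = t - a" using True by (auto simp: x_def)
  then have "(1 - x) * a + x * b = t" "(1 - x) * r + x * r = r" by (auto simp: algebra_simps)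
  then show ?thesis using conc[OF assms(1) assms(1) assms(2,3) \<open>0 < x\<close> \<open>x < 1\<close>] by simp
next
  case False
  then have "t = a \<or> t = b" using assms by auto
  then show ?thesis using assms by auto
qed

lemma super_eq: "0 < r \<Longrightarrow> r \<le> 1 \<Longrightarrow> {t. r ^ n \<le> f t} = {lend r..rend r}"
proof (intro equalityI subsetI)
  fix t assume "0 < r" "r \<le> 1" "t \<in> {lend r..rend r}"
  then show "t \<in> {t. r ^ n \<le> f t}" by (intro CollectI between[of r "lend r" "rend r" t] lend_mem rend_mem) simp_all
qed (simp add: lend_le rend_ge)

lemma lend_le_rend: "0 < r \<Longrightarrow> r \<le> 1 \<Longrightarrow> lend r \<le> rend r"
  using lend_mem rend_ge by blast

lemma lend_mono: "0 < r \<Longrightarrow> r \<le> r' \<Longrightarrow> r' \<le> 1 \<Longrightarrow> lend r \<le> lend r'"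
  using lend_mem[of r'] power_mono[of r r' n] by (intro lend_le) auto

lemma lend_convex: "convex_on {0<..<1} lend"
proof (rule convex_onI)
  fix t x y :: real assume t: "0 < t" "t < 1" and xy: "x \<in> {0<..<1}" "y \<in> {0<..<1}"
  have "((1 - t) * x + t * y) ^ n \<le> f ((1 - t) * lend x + t * lend y)"
    using t xy by (intro conc lend_mem) auto
  then show "lend ((1 - t) *\<^sub>R x + t *\<^sub>R y) \<le> (1 - t) * lend x + t * lend y"
    using t xy by (intro lend_le) (auto intro!: add_pos_pos)
qed simp

lemma lend_continuous: "continuous_on {0<..<1} lend"
  by (rule convex_on_continuous[OF _ lend_convex]) simp

text \<open>If \<open>c < lend 1\<close>, then for each \<open>r < 1\<close> the point \<open>c\<close> lies between \<open>lend r\<close> and \<open>lend 1\<close>, so the value at \<open>c\<close> is at least \<open>r ^ n\<close>.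
  Hence it is at least one, which puts \<open>lend 1\<close> to the left of \<open>c\<close>.\<close>
lemma lend_1_le:
  assumes "\<And>r. 0 < r \<Longrightarrow> r < 1 \<Longrightarrow> lend r \<le> c"
  shows "lend 1 \<le> c"
proof (rule ccontr)
  assume "\<not> lend 1 \<le> c"
  then have c: "c < lend 1" by simp
  have ge: "r ^ n \<le> f c" if r: "r \<in> {0<..<1}" for r
  proof (rule between[of r "lend r" "lend 1"])
    have "r ^ n \<le> 1" using r by (simp add: power_le_one)
    moreover have "1 \<le> f (lend 1)" using lend_mem[of 1] by simp
    ultimately show "r ^ n \<le> f (lend 1)" by linarith
    show "r ^ n \<le> f (lend r)" "lend r \<le> c" using r assms lend_mem by simp_all
  qed (use r c in simp_all)
  have "((\<lambda>r. r ^ n) \<longlongrightarrow> 1 ^ n) (at_left (1::real))" by (intro tendsto_intros)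
  moreover have "\<forall>\<^sub>F r in at_left (1::real). r ^ n \<le> f c"
    by (rule eventually_mono[OF eventually_at_left_real[of 0 "1::real"] ge]) simp_all
  ultimately have "1 \<le> f c"
    using tendsto_upperbound[of "\<lambda>r::real. r ^ n" "1 ^ n" "at_left 1" "f c"] by simp
  then show False using lend_le[of 1 c] c by simp
qed

lemma super_iff_lend:
  assumes "0 < r" "r \<le> 1" "t \<le> lend 1"
  shows "r ^ n \<le> f t \<longleftrightarrow> lend r \<le> t"
proof
  assume "lend r \<le> t"
  moreover have "r ^ n \<le> f (lend 1)" using lend_mem[of 1] power_le_one[of r n] assms by auto
  ultimately show "r ^ n \<le> f t" using between[of r "lend r" "lend 1" t] lend_mem[of r] assms by auto
qed (use lend_le assms in auto)

lemma layer_cake: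
  "(\<integral>\<^sup>+t. ennreal (f t) \<partial>lborel) = (\<integral>\<^sup>+s. indicator {0<..} s * emeasure lborel {t. s \<le> f t} \<partial>lborel)"
  and layer_meas: "(\<lambda>s. indicator {0<..} s * emeasure lborel {t. s \<le> f t}) \<in> borel_measurable borel"
proof -
  note [measurable] = meas
  define W where "W = {(t, s). 0 < s \<and> s \<le> f t}"
  have "W = {z \<in> space (borel \<Otimes>\<^sub>M borel). 0 < snd z \<and> snd z \<le> f (fst z)}"
    by (auto simp: W_def space_pair_measure)
  then have W[measurable]: "W \<in> sets (borel \<Otimes>\<^sub>M borel)" by simp
  have inner: "(\<integral>\<^sup>+t. indicator W (t, s) \<partial>lborel) = indicator {0<..} s * emeasure lborel {t. s \<le> f t}" for s
  proof -
    have "(\<integral>\<^sup>+t. indicator W (t, s) \<partial>lborel) = (\<integral>\<^sup>+t. indicator {0<..} s * indicator {t. s \<le> f t} t \<partial>lborel)"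
      by (intro nn_integral_cong) (auto simp: W_def split: split_indicator)
    also have "\<dots> = indicator {0<..} s * emeasure lborel {t. s \<le> f t}"
      by (subst nn_integral_cmult) auto
    finally show ?thesis .
  qed
  have "(\<lambda>s. \<integral>\<^sup>+t. indicator W (t, s) \<partial>lborel) \<in> borel_measurable borel" by measurable
  then show "(\<lambda>s. indicator {0<..} s * emeasure lborel {t. s \<le> f t}) \<in> borel_measurable borel"
    unfolding inner .
  have "(\<integral>\<^sup>+t. ennreal (f t) \<partial>lborel) = (\<integral>\<^sup>+t. \<integral>\<^sup>+s. indicator W (t, s) \<partial>lborel \<partial>lborel)"
  proof (rule nn_integral_cong)
    fix t
    have "(\<integral>\<^sup>+s. indicator W (t, s) \<partial>lborel) = (\<integral>\<^sup>+s. indicator {0<..f t} s \<partial>lborel)"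
      by (intro nn_integral_cong) (auto simp: W_def split: split_indicator)
    then show "ennreal (f t) = (\<integral>\<^sup>+s. indicator W (t, s) \<partial>lborel)" using nonneg[of t] by simp
  qed
  also have "\<dots> = (\<integral>\<^sup>+s. \<integral>\<^sup>+t. indicator W (t, s) \<partial>lborel \<partial>lborel)"
    by (rule lborel_pair.Fubini'[symmetric]) simp
  finally show "(\<integral>\<^sup>+t. ennreal (f t) \<partial>lborel) = (\<integral>\<^sup>+s. indicator {0<..} s * emeasure lborel {t. s \<le> f t} \<partial>lborel)"
    unfolding inner .
qed

lemma root_super: "0 < s \<Longrightarrow> s \<le> 1 \<Longrightarrow> {t. s \<le> f t} = {lend (root n s)..rend (root n s)}"
  using super_eq[of "root n s"] n_pos by (simp add: real_root_le_1_iff)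

lemma emeasure_super: "0 < s \<Longrightarrow> s \<le> 1 \<Longrightarrow> emeasure lborel {t. s \<le> f t} = ennreal (rend (root n s) - lend (root n s))"
  using root_super[of s] lend_le_rend[of "root n s"] n_pos by (simp add: real_root_le_1_iff)

end

text \<open>Two profiles with maximum one, and a profile \<open>h\<close> that dominates their combination while its integral
  is only \<open>p a + q b\<close>. Superlevel sets of \<open>h\<close> contain the combinations of those of \<open>f\<close> and \<open>g\<close>, so integration of their
  lengths shows that \<open>p a + q b\<close> is the least value possible.\<close>
locale bonnesen_profiles = A: concave_profile n f + B: concave_profile n g + C: concave_profile n h
  for n :: nat and f g h :: "real \<Rightarrow> real" +
  fixes p q a b :: real
  assumes pq: "p > 0" "q > 0" "p + q = 1" and ab: "a > 0" "b > 0"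
    and le1: "\<And>t. f t \<le> 1" "\<And>t. g t \<le> 1"
    and cross: "\<And>t t' r r'. \<lbrakk>0 < r; 0 < r'; r ^ n \<le> f t; r' ^ n \<le> g t'\<rbrakk>
      \<Longrightarrow> (p * r + q * r') ^ n \<le> h (p * t + q * t')"
    and int: "(\<integral>\<^sup>+t. ennreal (f t) \<partial>lborel) = ennreal a" "(\<integral>\<^sup>+t. ennreal (g t) \<partial>lborel) = ennreal b"
      "(\<integral>\<^sup>+t. ennreal (h t) \<partial>lborel) = ennreal (p * a + q * b)"
begin

lemma comb_same: "p * r + q * r = r" for r :: real
  using pq by (simp flip: distrib_right)

lemma super_comb: "0 < r \<Longrightarrow> r ^ n \<le> f t \<Longrightarrow> r ^ n \<le> g t' \<Longrightarrow> r ^ n \<le> h (p * t + q * t')"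
  using cross[of r r t t'] comb_same by simp

lemma lend_C_le: "0 < r \<Longrightarrow> r \<le> 1 \<Longrightarrow> C.lend r \<le> p * A.lend r + q * B.lend r"
  using super_comb A.lend_mem B.lend_mem by (intro C.lend_le) auto

lemma rend_C_ge: "0 < r \<Longrightarrow> r \<le> 1 \<Longrightarrow> p * A.rend r + q * B.rend r \<le> C.rend r"
  using super_comb A.rend_mem B.rend_mem by (intro C.rend_ge) auto

lemma emeasure_super_C:
  assumes s: "0 < s"
  shows "ennreal p * emeasure lborel {t. s \<le> f t} + ennreal q * emeasure lborel {t. s \<le> g t}
     \<le> emeasure lborel {t. s \<le> h t}"
    and "s < 1 \<Longrightarrow> 0 \<le> e \<Longrightarrow> e \<le> p * A.lend (root n s) + q * B.lend (root n s) - C.lend (root n s) \<Longrightarrow>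
      ennreal p * emeasure lborel {t. s \<le> f t} + ennreal q * emeasure lborel {t. s \<le> g t} + ennreal e \<le> emeasure lborel {t. s \<le> h t}"
proof -
  have *: "ennreal p * emeasure lborel {t. s \<le> f t} + ennreal q * emeasure lborel {t. s \<le> g t} + ennreal e \<le> emeasure lborel {t. s \<le> h t}"
    if e: "0 \<le> e" "e \<le> p * A.lend (root n s) + q * B.lend (root n s) - C.lend (root n s)" and "s \<le> 1" for e
  proof -
    let ?r = "root n s"
    have r: "0 < ?r" "?r \<le> 1" using s \<open>s \<le> 1\<close> A.n_pos by (auto simp: real_root_le_1_iff)
    have nn: "0 \<le> p * (A.rend ?r - A.lend ?r)" "0 \<le> q * (B.rend ?r - B.lend ?r)"
      using pq A.lend_le_rend[OF r] B.lend_le_rend[OF r] by simp_all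
    have "ennreal (p * (A.rend ?r - A.lend ?r) + q * (B.rend ?r - B.lend ?r) + e)
        = ennreal (p * (A.rend ?r - A.lend ?r)) + ennreal (q * (B.rend ?r - B.lend ?r)) + ennreal e"
      using nn e by (simp only: ennreal_plus add_nonneg_nonneg)
    also have "\<dots> = ennreal p * emeasure lborel {t. s \<le> f t} + ennreal q * emeasure lborel {t. s \<le> g t} + ennreal e"
      using A.emeasure_super[OF s \<open>s \<le> 1\<close>] B.emeasure_super[OF s \<open>s \<le> 1\<close>] pq A.lend_le_rend[OF r] B.lend_le_rend[OF r]
      by (simp only: ennreal_mult less_imp_le diff_ge_0_iff_ge)
    finally have "ennreal p * emeasure lborel {t. s \<le> f t} + ennreal q * emeasure lborel {t. s \<le> g t} + ennreal e
        = ennreal (p * (A.rend ?r - A.lend ?r) + q * (B.rend ?r - B.lend ?r) + e)" by (rule sym)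
    also have "\<dots> \<le> ennreal (C.rend ?r - C.lend ?r)"
      using rend_C_ge[OF r] e by (intro ennreal_leI) (simp add: algebra_simps)
    also have "\<dots> = emeasure lborel {t. s \<le> h t}" using C.emeasure_super[OF s \<open>s \<le> 1\<close>] by simp
    finally show ?thesis .
  qed
  then show "s < 1 \<Longrightarrow> 0 \<le> e \<Longrightarrow> e \<le> p * A.lend (root n s) + q * B.lend (root n s) - C.lend (root n s) \<Longrightarrow>
      ennreal p * emeasure lborel {t. s \<le> f t} + ennreal q * emeasure lborel {t. s \<le> g t} + ennreal e \<le> emeasure lborel {t. s \<le> h t}" by simp
  show "ennreal p * emeasure lborel {t. s \<le> f t} + ennreal q * emeasure lborel {t. s \<le> g t} \<le> emeasure lborel {t. s \<le> h t}"
  proof (cases "s \<le> 1")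
    case True
    have "0 < root n s" "root n s \<le> 1" using s True A.n_pos by (auto simp: real_root_le_1_iff)
    then show ?thesis using *[of 0] True lend_C_le[of "root n s"] by simp
  next
    case False
    then have "{t. s \<le> f t} = {}" "{t. s \<le> g t} = {}" using le1 by (auto intro: order_trans simp: not_le) (meson le1 not_le order_trans)+
    then show ?thesis by simp
  qed
qed

text \<open>The integrals leave no room for a uniform gap between the superlevel sets over an interval of levels.\<close>
lemma no_gap:
  assumes s: "0 \<le> s1" "s1 < s2" and e: "e > 0"
    and gap: "\<And>s. s1 < s \<Longrightarrow> s < s2 \<Longrightarrow> ennreal p * emeasure lborel {t. s \<le> f t} + ennreal q * emeasure lborel {t. s \<le> g t} + ennreal e
     \<le> emeasure lborel {t. s \<le> h t}"
  shows False
proof -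
  let ?F = "\<lambda>s. indicator {0<..} s * emeasure lborel {t. s \<le> f t}"
  let ?G = "\<lambda>s. indicator {0<..} s * emeasure lborel {t. s \<le> g t}"
  note [measurable] = A.layer_meas B.layer_meas
  have "ennreal (p * a + q * b) + ennreal (e * (s2 - s1)) =
     (\<integral>\<^sup>+s. ennreal p * ?F s + ennreal q * ?G s + ennreal e * indicator {s1<..<s2} s \<partial>lborel)"
    using pq ab e s int(1,2)
    by (simp add: nn_integral_add nn_integral_cmult A.layer_cake[symmetric] B.layer_cake[symmetric] ennreal_mult' ennreal_plus)
  also have "\<dots> \<le> (\<integral>\<^sup>+s. indicator {0<..} s * emeasure lborel {t. s \<le> h t} \<partial>lborel)"
  proof (rule nn_integral_mono)
    fix s :: real
    show "ennreal p * ?F s + ennreal q * ?G s + ennreal e * indicator {s1<..<s2} s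
      \<le> indicator {0<..} s * emeasure lborel {t. s \<le> h t}"
      using gap[of s] emeasure_super_C(1)[of s] s by (auto split: split_indicator)
  qed
  also have "\<dots> = ennreal (p * a + q * b)" using int(3) C.layer_cake by simp
  finally have "ennreal (p * a + q * b + e * (s2 - s1)) \<le> ennreal (p * a + q * b)"
    using pq ab e s by (subst ennreal_plus) auto
  moreover have "0 < e * (s2 - s1)" "0 \<le> p * a + q * b" using pq ab e s by auto
  ultimately show False using e s by (simp add: ennreal_le_iff)
qed

text \<open>The left ends depend continuously on the height, so a strict inequality would persist over an
  interval of heights.\<close>
lemma lend_C_eq:
  assumes r0: "0 < r0" "r0 < 1"
  shows "C.lend r0 = p * A.lend r0 + q * B.lend r0"
proof (rule ccontr)
  let ?D = "\<lambda>r. p * A.lend r + q * B.lend r - C.lend r"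
  assume "C.lend r0 \<noteq> p * A.lend r0 + q * B.lend r0"
  then have D0: "?D r0 > 0" using lend_C_le[of r0] r0 by simp
  have "continuous_on {0<..<1} ?D"
    by (intro continuous_intros A.lend_continuous B.lend_continuous C.lend_continuous)
  then have "isCont ?D r0" using r0 by (simp add: continuous_on_eq_continuous_at)
  then have "(?D \<longlongrightarrow> ?D r0) (nhds r0)"
    using tendsto_at_iff_tendsto_nhds[of ?D r0] unfolding isCont_def by simp
  then have "\<forall>\<^sub>F r in nhds r0. ?D r0 / 2 < ?D r"
    by (rule order_tendstoD(1)) (use D0 in simp)
  moreover have "\<forall>\<^sub>F r in nhds r0. r \<in> {0<..<1}" using r0 by (intro eventually_nhds_in_open) auto
  ultimately have "\<forall>\<^sub>F r in nhds r0. ?D r0 / 2 < ?D r \<and> r \<in> {0<..<1}" by (rule eventually_conj)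
  then obtain d where d: "d > 0" "\<And>r. dist r r0 < d \<Longrightarrow> ?D r0 / 2 < ?D r \<and> r \<in> {0<..<1}"
    unfolding eventually_nhds_metric by blast
  define r1 where "r1 = r0 + d / 2"
  have r1: "r0 < r1" "r1 \<in> {0<..<1}" using d(1) d(2)[of r1] by (auto simp: r1_def dist_real_def)
  show False
  proof (rule no_gap[of "r0 ^ n" "r1 ^ n" "?D r0 / 2"])
    fix s assume s: "r0 ^ n < s" "s < r1 ^ n"
    have s0: "0 < s" using s r0 by (meson less_trans zero_less_power)
    have n: "n > 0" by (rule A.n_pos)
    have "r0 < root n s" "root n s < r1"
      using real_root_less_mono[OF n s(1)] real_root_less_mono[OF n s(2)] r0 r1 n by (auto simp: real_root_power_cancel)
    then have "dist (root n s) r0 < d" using d(1) by (simp add: r1_def dist_real_def)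
    moreover have "s < 1" using s r1 power_le_one[of r1 n] by auto
    ultimately show "ennreal p * emeasure lborel {t. s \<le> f t} + ennreal q * emeasure lborel {t. s \<le> g t} + ennreal (?D r0 / 2)
       \<le> emeasure lborel {t. s \<le> h t}"
      using emeasure_super_C(2)[OF s0, of "?D r0 / 2"] d(2)[of "root n s"] D0 by auto
  qed (use r0 r1 D0 A.n_pos in \<open>auto intro: power_strict_mono\<close>)
qed

text \<open>A value above one would, by concavity towards another point where \<open>h\<close> is positive, give superlevel sets of positive
  length over an interval of heights above one, where \<open>f\<close> and \<open>g\<close> contribute nothing.\<close>
lemma profile_C_le_1: "h t0 \<le> 1"
proof (rule ccontr)
  assume "\<not> h t0 \<le> 1"
  then have h0: "1 < h t0" by simp
  have n: "n > 0" by (rule A.n_pos)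
  have "\<exists>t1. t1 \<noteq> t0 \<and> 0 < h t1"
  proof (rule ccontr)
    assume "\<not> (\<exists>t1. t1 \<noteq> t0 \<and> 0 < h t1)"
    then have z: "h t = 0" if "t \<noteq> t0" for t using C.nonneg[of t] that by (metis less_eq_real_def)
    have "AE t in lborel. ennreal (h t) = 0"
      using AE_lborel_singleton[of t0] by eventually_elim (simp add: z)
    then have "(\<integral>\<^sup>+t. ennreal (h t) \<partial>lborel) = (\<integral>\<^sup>+t. 0 \<partial>(lborel :: real measure))"
      by (rule nn_integral_cong_AE)
    then have "p * a + q * b \<le> 0" using int(3) by (simp add: ennreal_eq_0_iff)
    then show False using pq ab by (smt (verit) mult_pos_pos)
  qed
  then obtain t1 where t1: "t1 \<noteq> t0" "0 < h t1" by blast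
  define r0 r1 where "r0 = root n (h t0)" and "r1 = root n (h t1)"
  have r0: "1 < r0" "r0 ^ n = h t0" and r1: "0 < r1" "r1 ^ n = h t1"
    using h0 t1 n by (auto simp: r0_def r1_def)
  define \<rho> where "\<rho> = (1 + r0) / 2"
  have rho: "1 < \<rho>" "\<rho> < r0" using r0 by (auto simp: \<rho>_def)
  define x where "x = 1 - \<rho> / r0"
  have x: "0 < x" "x < 1" "(1 - x) * r0 = \<rho>" using rho r0 by (auto simp: x_def)
  have big: "\<rho> ^ n \<le> h ((1 - y) * t0 + y * t1)" if y: "0 \<le> y" "y \<le> x" for y
  proof (cases "y = 0")
    case True
    then show ?thesis using rho r0 power_mono[of \<rho> r0 n] by simp
  next
    case False
    have "\<rho> \<le> (1 - y) * r0" using y r0 x(3) mult_right_mono[of "1 - x" "1 - y" r0] by simp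
    also have "\<dots> \<le> (1 - y) * r0 + y * r1" using y r1 by simp
    finally have "\<rho> ^ n \<le> ((1 - y) * r0 + y * r1) ^ n" using rho by (intro power_mono) auto
    also have "\<dots> \<le> h ((1 - y) * t0 + y * t1)" using False y x r0 r1 by (intro C.conc) auto
    finally show ?thesis .
  qed
  define e where "e = x * \<bar>t1 - t0\<bar>"
  have e: "e > 0" using x t1 by (simp add: e_def)
  show False
  proof (rule no_gap[of 1 "\<rho> ^ n" e])
    fix s assume s: "1 < s" "s < \<rho> ^ n"
    have "{t. s \<le> f t} = {}" "{t. s \<le> g t} = {}" using le1 s by (auto simp: not_le intro: le_less_trans)
    moreover have "ennreal e \<le> emeasure lborel {t. s \<le> h t}"
    proof -
      let ?z = "(1 - x) * t0 + x * t1"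
      have "{min t0 ?z..max t0 ?z} \<subseteq> {t. s \<le> h t}"
      proof
        fix t assume t: "t \<in> {min t0 ?z..max t0 ?z}"
        define y where "y = (t - t0) / (t1 - t0)"
        have "y * (t1 - t0) = t - t0" using t1 by (simp add: y_def)
        then have yt: "(1 - y) * t0 + y * t1 = t" by (simp add: algebra_simps)
        have z: "?z = t0 + x * (t1 - t0)" by (simp add: algebra_simps)
        have "0 \<le> y \<and> y \<le> x"
        proof (cases "t0 < t1")
          case True
          then have "0 < x * (t1 - t0)" using x by simp
          then show ?thesis using t True unfolding z y_def by (auto simp: field_simps)
        next
          case False
          then have lt: "t1 < t0" using t1 by simp
          then have "x * (t1 - t0) < 0" using x by (simp add: mult_pos_neg)
          then show ?thesis using t lt unfolding z y_def by (auto simp: field_simps divide_le_eq)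
        qed
        then show "t \<in> {t. s \<le> h t}" using big[of y] yt s by auto
      qed
      then have "emeasure lborel {min t0 ?z..max t0 ?z} \<le> emeasure lborel {t. s \<le> h t}"
        using C.meas by (intro emeasure_mono) auto
      moreover have "max t0 ?z - min t0 ?z = e"
        using x unfolding e_def by (auto simp: max_def min_def abs_if algebra_simps not_le mult_less_cancel_left)
      ultimately show ?thesis by simp
    qed
    ultimately show "ennreal p * emeasure lborel {t. s \<le> f t} + ennreal q * emeasure lborel {t. s \<le> g t} + ennreal e
       \<le> emeasure lborel {t. s \<le> h t}" by simp
  qed (use rho e n in \<open>auto intro: one_less_power\<close>)
qed

text \<open>The combination of points at heights \<open>t ^ n\<close> and \<open>t' ^ n\<close> reaches height \<open>m ^ n\<close> for \<open>m = p t + q t'\<close>, so it lies to the right of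
  the left end \<open>p A.lend m + q B.lend m\<close> of \<open>h\<close>. This is the hypothesis under which a difference is constant.\<close>
lemma lend_shift:
  obtains k where "\<And>r. 0 < r \<Longrightarrow> r \<le> 1 \<Longrightarrow> A.lend r = B.lend r + k"
    "\<And>r. 0 < r \<Longrightarrow> r \<le> 1 \<Longrightarrow> C.lend r = A.lend r - q * k"
proof -
  have "\<exists>k. \<forall>t\<in>{0<..<1}. - A.lend t = - B.lend t + k"
  proof (rule diff_const_if_diagonal_maximal[OF _ _ pq])
    show "continuous_on {0<..<1} (\<lambda>t. - A.lend t)" "continuous_on {0<..<1} (\<lambda>t. - B.lend t)"
      by (intro continuous_intros A.lend_continuous B.lend_continuous)+
    fix t t' :: real assume t: "t \<in> {0<..<1}" "t' \<in> {0<..<1}"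
    let ?m = "p * t + q * t'"
    have m: "?m \<in> {0<..<1}" using t pq convexD[of "{0<..<1::real}" t t' p q] by auto
    have "?m ^ n \<le> h (p * A.lend t + q * B.lend t')"
      using t by (intro cross A.lend_mem B.lend_mem) auto
    then have "C.lend ?m \<le> p * A.lend t + q * B.lend t'" using m by (intro C.lend_le) auto
    then show "p * - A.lend t + q * - B.lend t' \<le> p * - A.lend ?m + q * - B.lend ?m"
      using lend_C_eq[of ?m] m by simp
  qed
  then obtain k where "\<forall>t\<in>{0<..<1}. - A.lend t = - B.lend t + k" by blast
  then have k: "A.lend r = B.lend r + - k" if "0 < r" "r < 1" for r using that by force
  have kc: "C.lend r = A.lend r - q * - k" if "0 < r" "r < 1" for r
  proof -
    have "B.lend r = A.lend r + k" using k[OF that] by simp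
    then show ?thesis using lend_C_eq[OF that] comb_same[of "A.lend r"] by (simp add: distrib_left)
  qed
  have A1: "A.lend 1 = B.lend 1 + - k"
  proof (rule antisym)
    show "A.lend 1 \<le> B.lend 1 + - k"
      using k B.lend_mono[of _ 1] by (intro A.lend_1_le) auto
    have "B.lend 1 \<le> A.lend 1 + k"
      using k A.lend_mono[of _ 1] by (intro B.lend_1_le) (smt (verit))
    then show "B.lend 1 + - k \<le> A.lend 1" by simp
  qed
  have C1: "C.lend 1 = A.lend 1 - q * - k"
  proof (rule antisym)
    show "C.lend 1 \<le> A.lend 1 - q * - k"
      using kc A.lend_mono[of _ 1] by (intro C.lend_1_le) auto
    have "A.lend 1 \<le> C.lend 1 + q * - k"
      using kc C.lend_mono[of _ 1] by (intro A.lend_1_le) (smt (verit))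
    then show "A.lend 1 - q * - k \<le> C.lend 1" by simp
  qed
  show ?thesis
    using k kc A1 C1 by (intro that[of "- k"]) (metis less_eq_real_def)+
qed

text \<open>To the left of the maximum a profile is determined by its left ends, and these agree up to a shift.\<close>
theorem profiles_agree_left:
  shows "C.lend 1 = p * A.lend 1 + q * B.lend 1"
    and "\<tau> < 0 \<Longrightarrow> f (A.lend 1 + \<tau>) = g (B.lend 1 + \<tau>)"
    and "\<tau> < 0 \<Longrightarrow> h (C.lend 1 + \<tau>) = f (A.lend 1 + \<tau>)"
proof -
  obtain k where k: "\<And>r. 0 < r \<Longrightarrow> r \<le> 1 \<Longrightarrow> A.lend r = B.lend r + k"
    "\<And>r. 0 < r \<Longrightarrow> r \<le> 1 \<Longrightarrow> C.lend r = A.lend r - q * k"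
    using lend_shift by metis
  have n: "n > 0" by (rule A.n_pos)
  show "C.lend 1 = p * A.lend 1 + q * B.lend 1"
    using k(1)[of 1] k(2)[of 1] comb_same[of "B.lend 1"] comb_same[of k] by (simp add: distrib_left)
  have eq: "x = y" if "0 \<le> x" "x < 1" "0 \<le> y" "y < 1" and iff: "\<And>r. 0 < r \<Longrightarrow> r \<le> 1 \<Longrightarrow> r ^ n \<le> x \<longleftrightarrow> r ^ n \<le> y" for x y :: real
  proof -
    have le: "v \<le> w" if "0 \<le> v" "v < 1" "0 \<le> w" "\<And>r. 0 < r \<Longrightarrow> r \<le> 1 \<Longrightarrow> r ^ n \<le> v \<Longrightarrow> r ^ n \<le> w" for v w :: real
    proof (cases "v = 0")
      case False
      then have "0 < root n v" "root n v \<le> 1" using that n by (auto simp: real_root_le_1_iff)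
      then show ?thesis using that(4)[of "root n v"] that n by simp
    qed (use that in simp)
    show ?thesis using le[of x y] le[of y x] that by (intro antisym) auto
  qed
  have A1: "f (A.lend 1 + \<tau>) < 1" and B1: "g (B.lend 1 + \<tau>) < 1" and C1: "h (C.lend 1 + \<tau>) < 1" if "\<tau> < 0"
    using that A.lend_le[of 1 "A.lend 1 + \<tau>"] B.lend_le[of 1 "B.lend 1 + \<tau>"] C.lend_le[of 1 "C.lend 1 + \<tau>"] by force+
  show "f (A.lend 1 + \<tau>) = g (B.lend 1 + \<tau>)" if "\<tau> < 0"
    using k(1)[of 1] k(1) A1[OF that] B1[OF that] A.nonneg B.nonneg that
    by (intro eq) (auto simp: A.super_iff_lend B.super_iff_lend)
  show "h (C.lend 1 + \<tau>) = f (A.lend 1 + \<tau>)" if "\<tau> < 0"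
    using k(2)[of 1] k(2) A1[OF that] C1[OF that] A.nonneg C.nonneg that
    by (intro eq) (auto simp: A.super_iff_lend C.super_iff_lend)
qed

end

section \<open>The structure of bodies with equality\<close>

lemma mem_translation_iff: "v \<in> (+) x ` S \<longleftrightarrow> v - x \<in> S" for x :: "'a::ab_group_add"
  by (auto intro: image_eqI[of _ _ "v - x"])

lemma mcomb_self_subset:
  assumes "convex K" "0 \<le> p" "0 \<le> q" "p + q = 1"
  shows "mcomb p K q K \<subseteq> K"
  using assms by (auto simp: mcomb_def convex_def)

lemma mcomb_translate_self:
  assumes K: "convex K" and pq: "0 \<le> p" "0 \<le> q" "p + q = 1"
  shows "mcomb p ((+) a ` K) q ((+) b ` K) = (+) (p *\<^sub>R a + q *\<^sub>R b) ` K"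
proof (intro equalityI subsetI)
  fix x assume "x \<in> mcomb p ((+) a ` K) q ((+) b ` K)"
  then obtain k k' where k: "k \<in> K" "k' \<in> K" "x = p *\<^sub>R (a + k) + q *\<^sub>R (b + k')"
    by (auto simp: mcomb_def)
  then have "x = (p *\<^sub>R a + q *\<^sub>R b) + (p *\<^sub>R k + q *\<^sub>R k')" by (simp add: algebra_simps)
  moreover have "p *\<^sub>R k + q *\<^sub>R k' \<in> K" using K k pq by (auto simp: convex_def)
  ultimately show "x \<in> (+) (p *\<^sub>R a + q *\<^sub>R b) ` K" by blast
next
  fix x assume "x \<in> (+) (p *\<^sub>R a + q *\<^sub>R b) ` K"
  then obtain k where k: "k \<in> K" "x = (p *\<^sub>R a + q *\<^sub>R b) + k" by auto
  then have "x = p *\<^sub>R (a + k) + q *\<^sub>R (b + k)"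
    using pq scaleR_left.add[of p q k] by (simp add: algebra_simps)
  then show "x \<in> mcomb p ((+) a ` K) q ((+) b ` K)" using k by (auto intro: mcombI)
qed

lemma translate_eq_imp_eq:
  fixes P :: "'a::euclidean_space set"
  assumes P: "compact P" "P \<noteq> {}" and eq: "(+) w ` P = (+) w' ` P"
  shows "w = w'"
proof -
  define d where "d = w - w'"
  have step: "d + x \<in> P" if "x \<in> P" for x
  proof -
    have "w + x \<in> (+) w' ` P" using that eq by blast
    then show ?thesis by (auto simp: d_def algebra_simps)
  qed
  \<comment> \<open>A farthest point of \<open>P\<close> in direction \<open>d\<close> cannot be moved by \<open>d\<close> inside \<open>P\<close>.\<close>
  obtain x where x: "x \<in> P" "\<And>y. y \<in> P \<Longrightarrow> y \<bullet> d \<le> x \<bullet> d"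
    using continuous_attains_sup[OF P, of "\<lambda>x. x \<bullet> d"]
    by (metis bounded_linear_inner_left linear_continuous_on)
  have "d \<bullet> d \<le> 0" using x(2)[OF step[OF x(1)]] by (simp add: inner_add_left)
  then have "d = 0" using inner_ge_zero[of d] by (metis antisym inner_eq_zero_iff)
  then show ?thesis by (simp add: d_def)
qed

lemma concave_profile_sec:
  fixes K :: "'a::euclidean_space set"
  assumes u: "norm u = 1" and dim: "DIM('a) \<ge> 2" and K: "convex_body K" and top: "\<exists>t. 1 \<le> sec u K t"
  shows "concave_profile (DIM('a) - 1) (sec u K)"
proof
  have Kc: "compact K" "convex K" using K by (auto simp: convex_body_def)
  show "0 < DIM('a) - 1" using dim by simp
  show "0 \<le> sec u K t" for t by (rule sec_nonneg)
  show "sec u K \<in> borel_measurable borel" using fubini_sections(1)[OF u Kc(1)] .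
  show "compact {t. s \<le> sec u K t}" if "0 < s" for s by (rule compact_sec_superlevel[OF u Kc(1) that])
  show "((1 - x) * r + x * r') ^ (DIM('a) - 1) \<le> sec u K ((1 - x) * t + x * t')"
    if "0 < r" "0 < r'" "r ^ (DIM('a) - 1) \<le> sec u K t" "r' ^ (DIM('a) - 1) \<le> sec u K t'" "0 < x" "x < 1"
    for t t' r r' x
    using that Kc by (intro sec_brunn_minkowski[OF u Kc Kc Kc(1)] mcomb_self_subset) auto
  show "\<exists>t. 1 \<le> sec u K t" by (rule top)
qed

text \<open>Both volumes are integrals of the section volume over the levels below the cut.\<close>
lemma vol_left_eq:
  fixes A B :: "'a::euclidean_space set"
  assumes u: "norm u = 1" and A: "compact A" and B: "compact B"
    and eq: "\<And>\<tau>. \<tau> < 0 \<Longrightarrow> sec u A (a + \<tau>) = sec u B (b + \<tau>)"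
  shows "vol (A \<inter> {x. x \<bullet> u \<le> a}) = vol (B \<inter> {x. x \<bullet> u \<le> b})"
proof -
  have *: "ennreal (vol (K \<inter> {x. x \<bullet> u \<le> c})) = (\<integral>\<^sup>+\<tau>. indicator {..<0} \<tau> * ennreal (sec u K (c + \<tau>)) \<partial>lborel)"
    if K: "compact K" for K c
  proof -
    note [measurable] = fubini_sections(1)[OF u K]
    have "sec u (K \<inter> {x. x \<bullet> u \<le> c}) t = indicator {..c} t * sec u K t" for t
    proof (cases "t \<le> c")
      case True
      then have "slice u (K \<inter> {x. x \<bullet> u \<le> c}) t = slice u K t" by auto
      then show ?thesis using True by (simp add: sec_def)
    next
      case False
      then have "slice u (K \<inter> {x. x \<bullet> u \<le> c}) t = {}" by auto
      then show ?thesis using False sec_empty by auto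
    qed
    then have "ennreal (vol (K \<inter> {x. x \<bullet> u \<le> c})) = (\<integral>\<^sup>+t. indicator {..c} t * ennreal (sec u K t) \<partial>lborel)"
      unfolding fubini_sections(2)[OF u compact_cut(1)[OF K], symmetric]
      by (intro nn_integral_cong) (auto split: split_indicator)
    also have "\<dots> = (\<integral>\<^sup>+t. indicator {..<c} t * ennreal (sec u K t) \<partial>lborel)"
      using AE_lborel_singleton[of c]
      by (intro nn_integral_cong_AE, eventually_elim) (auto split: split_indicator)
    also have "\<dots> = ennreal \<bar>1\<bar> * (\<integral>\<^sup>+\<tau>. indicator {..<c} (c + 1 * \<tau>) * ennreal (sec u K (c + 1 * \<tau>)) \<partial>lborel)"
      by (rule nn_integral_real_affine) auto
    also have "\<dots> = (\<integral>\<^sup>+\<tau>. indicator {..<0} \<tau> * ennreal (sec u K (c + \<tau>)) \<partial>lborel)"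
      by (simp, intro nn_integral_cong) (auto split: split_indicator)
    finally show ?thesis .
  qed
  have "ennreal (vol (A \<inter> {x. x \<bullet> u \<le> a})) = ennreal (vol (B \<inter> {x. x \<bullet> u \<le> b}))"
    unfolding *[OF A] *[OF B] by (intro nn_integral_cong) (auto simp: eq split: split_indicator)
  then show ?thesis by simp
qed

text \<open>The lowest level of a section of volume one. For a body whose largest section volume is one, the highest such level is
  \<open>- ltop (- u) K\<close>.\<close>
definition ltop :: "'a::euclidean_space \<Rightarrow> 'a set \<Rightarrow> real" where
  "ltop u K = Inf {t. 1 \<le> sec u K t}"

locale bonnesen_bodies =
  fixes u :: "'a::euclidean_space" and A B :: "'a set" and p q :: real
  assumes u: "norm u = 1" and dim: "DIM('a) \<ge> 2"
    and A: "convex_body A" and B: "convex_body B"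
    and pq: "p > 0" "q > 0" "p + q = 1"
    and maxA: "\<And>t. sec u A t \<le> 1" "\<exists>t. 1 \<le> sec u A t"
    and maxB: "\<And>t. sec u B t \<le> 1" "\<exists>t. 1 \<le> sec u B t"
    and eq: "vol (mcomb p A q B) = p * vol A + q * vol B"
begin

abbreviation "C \<equiv> mcomb p A q B"

lemma compact_convex: "compact A" "convex A" "compact B" "convex B" "compact C" "convex C"
  using A B by (auto simp: convex_body_def intro: compact_mcomb convex_mcomb)

lemma convex_body_C: "convex_body C"
proof -
  have "0 < p * vol A" "0 < q * vol B"
    using vol_convex_body_pos[OF A] vol_convex_body_pos[OF B] pq by auto
  then show ?thesis using compact_convex eq by (intro convex_body_if_vol_pos) auto
qed

sublocale prof: bonnesen_profiles "DIM('a) - 1" "sec u A" "sec u B" "sec u C" p q "vol A" "vol B"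
proof -
  have pr: "concave_profile (DIM('a) - 1) (sec u A)" "concave_profile (DIM('a) - 1) (sec u B)"
    using concave_profile_sec[OF u dim] A B maxA maxB by auto
  obtain t t' where t: "1 \<le> sec u A t" "1 \<le> sec u B t'" using maxA maxB by auto
  have cr: "(p * r + q * r') ^ (DIM('a) - 1) \<le> sec u C (p * t + q * t')"
    if "0 < r" "0 < r'" "r ^ (DIM('a) - 1) \<le> sec u A t" "r' ^ (DIM('a) - 1) \<le> sec u B t'" for r r' t t'
    using that compact_convex pq by (intro sec_brunn_minkowski[OF u compact_convex(1-5)]) auto
  have "1 \<le> sec u C (p * t + q * t')" using cr[of 1 1 t t'] t pq by simp
  then have "concave_profile (DIM('a) - 1) (sec u C)"
    using concave_profile_sec[OF u dim convex_body_C] by auto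
  then show "bonnesen_profiles (DIM('a) - 1) (sec u A) (sec u B) (sec u C) p q (vol A) (vol B)"
    using pr cr pq maxA maxB vol_convex_body_pos[OF A] vol_convex_body_pos[OF B] fubini_sections(2)[OF u] compact_convex eq
    by (auto simp: bonnesen_profiles_def bonnesen_profiles_axioms_def)
qed

lemma lend_ltop: "prof.A.lend 1 = ltop u A" "prof.B.lend 1 = ltop u B" "prof.C.lend 1 = ltop u C"
  unfolding prof.A.lend_def prof.B.lend_def prof.C.lend_def ltop_def by simp_all

lemma maxC: "sec u C t \<le> 1" by (rule prof.profile_C_le_1)

lemma ltop_C: "ltop u C = p * ltop u A + q * ltop u B"
  using prof.profiles_agree_left(1) unfolding lend_ltop .

lemma sec_ltop: "sec u A (ltop u A) = 1" "sec u B (ltop u B) = 1"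
  using prof.A.lend_mem[of 1] prof.B.lend_mem[of 1] maxA(1) maxB(1)
  unfolding lend_ltop by (simp_all add: antisym)

lemma slice_translates:
  assumes "sec u A t = 1" "sec u B t' = 1"
  obtains z where "slice u A t = (+) z ` slice u B t'" "slice u C (p * t + q * t') = mcomb p (slice u A t) q (slice u B t')"
  using sec_brunn_minkowski_equality[OF u compact_convex pq subset_refl assms maxC] by metis

text \<open>By agreement of the profiles, the caps of \<open>A\<close>, \<open>B\<close> and \<open>p A + q B\<close> below their lowest maximal sections have equal volumes, and
  the cap of \<open>p A + q B\<close> contains the combination of the other two. So the caps of \<open>A\<close> and \<open>B\<close> realise equality in the
  Brunn-Minkowski inequality. Caps of volume zero are the maximal sections themselves, for which the
  equality case for sections is used.\<close>
lemma left_translate: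
  obtains z where "A \<inter> {x. x \<bullet> u \<le> ltop u A} = (+) z ` (B \<inter> {x. x \<bullet> u \<le> ltop u B})"
    "z \<bullet> u = ltop u A - ltop u B"
proof -
  let ?A = "A \<inter> {x. x \<bullet> u \<le> ltop u A}" and ?B = "B \<inter> {x. x \<bullet> u \<le> ltop u B}" and ?C = "C \<inter> {x. x \<bullet> u \<le> ltop u C}"
  have cc: "compact ?A" "convex ?A" "compact ?B" "convex ?B" "compact ?C" "convex ?C"
    by (intro compact_cut convex_cut compact_convex)+
  have u0: "u \<noteq> 0" using u by auto
  have vB: "vol ?B = vol ?A"
    using prof.profiles_agree_left(2)[symmetric] unfolding lend_ltop by (intro vol_left_eq[OF u] compact_convex)
  have vC: "vol ?C = vol ?A"
    using prof.profiles_agree_left(3) unfolding lend_ltop by (intro vol_left_eq[OF u] compact_convex)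
  have sub: "mcomb p ?A q ?B \<subseteq> ?C"
    unfolding ltop_C using pq by (auto simp: mcomb_def inner_add_left intro!: add_mono mult_left_mono)
  have "\<exists>z. ?A = (+) z ` ?B"
  proof (cases "vol ?A > 0")
    case True
    have "vol (mcomb p ?A q ?B) \<le> vol ?C"
      using sub cc by (intro measure_mono_fmeasurable) (auto intro!: lmeasurable_compact compact_mcomb fmeasurableD)
    then show ?thesis
      using cc vB vC pq True by (intro brunn_minkowski_equality convex_body_if_vol_pos) auto
  next
    case False
    then have v0: "vol ?A = 0" by (metis zero_less_measure_iff)
    have deg: "K \<inter> {x. x \<bullet> u \<le> c} = slice u K c" if "convex_body K" "vol (K \<inter> {x. x \<bullet> u \<le> c}) = 0" for K c
    proof (rule ccontr)
      assume "K \<inter> {x. x \<bullet> u \<le> c} \<noteq> slice u K c"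
      then have "K \<inter> {x. x \<bullet> u < c} \<noteq> {}" by force
      moreover have "open {x. x \<bullet> u < c}" using open_halfspace_lt[of u c] by (simp add: inner_commute)
      ultimately have "0 < vol (K \<inter> {x. x \<bullet> u < c})" using that by (intro vol_Int_open_pos)
      then show False using that vol_cut_closed(1)[OF convex_body_lmeasurable[OF that(1)] u0] by simp
    qed
    show ?thesis
      using slice_translates[OF sec_ltop] deg[OF A v0] deg[OF B, of "ltop u B"] v0 vB by (metis (no_types, lifting))
  qed
  then obtain z where z: "?A = (+) z ` ?B" by blast
  have ne: "slice u A (ltop u A) \<noteq> {}" "slice u B (ltop u B) \<noteq> {}"
    using sec_ltop sec_empty[of A u "ltop u A"] sec_empty[of B u "ltop u B"] by auto
  have "z \<bullet> u = ltop u A - ltop u B"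
  proof (rule antisym)
    obtain x where x: "x \<in> B" "x \<bullet> u = ltop u B" using ne by blast
    then have "z + x \<in> ?A" unfolding z by auto
    then show "z \<bullet> u \<le> ltop u A - ltop u B" using x by (simp add: inner_add_left)
    obtain y where y: "y \<in> A" "y \<bullet> u = ltop u A" using ne by blast
    then have "y \<in> (+) z ` ?B" unfolding z[symmetric] by auto
    then obtain x where "y = z + x" "x \<in> ?B" by blast
    then show "ltop u A - ltop u B \<le> z \<bullet> u" using y by (simp add: inner_add_left)
  qed
  with z show ?thesis by (rule that)
qed

lemma reflected: "bonnesen_bodies (- u) A B p q"
proof -
  have r: "sec (- u) K t = sec u K (- t)" for K t using sec_reflect[OF u, of K "- t"] by simp
  obtain tA tB where "1 \<le> sec u A tA" "1 \<le> sec u B tB" using maxA(2) maxB(2) by blast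
  then have "1 \<le> sec (- u) A (- tA)" "1 \<le> sec (- u) B (- tB)" by (simp_all add: r)
  then have ex: "\<exists>t. 1 \<le> sec (- u) A t" "\<exists>t. 1 \<le> sec (- u) B t" by blast+
  show ?thesis
    by (rule bonnesen_bodies.intro; (rule dim A B pq ex eq)?) (simp_all add: u r maxA(1) maxB(1))
qed

lemma swapped: "bonnesen_bodies u B A q p"
proof -
  have "mcomb q B p A = C" by (auto simp: mcomb_def) (metis add.commute)+
  then show ?thesis
    using bonnesen_bodies.intro[OF u dim B A pq(2,1) _ maxB maxA] pq(3) eq by (simp add: add.commute)
qed

end

lemma slices_between_translates:
  fixes K :: "'a::euclidean_space set"
  assumes u: "norm u = 1" and K: "compact K" "convex K" and le1: "\<And>t. sec u K t \<le> 1"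
    and s: "sec u K a = 1" "sec u K b = 1" and th: "0 \<le> \<theta>" "\<theta> \<le> 1"
  shows "slice u K ((1 - \<theta>) * a + \<theta> * b) = mcomb (1 - \<theta>) (slice u K a) \<theta> (slice u K b)"
proof -
  have ne: "slice u K a \<noteq> {}" "slice u K b \<noteq> {}" using s sec_empty[of K u a] sec_empty[of K u b] by auto
  consider "\<theta> = 0" | "\<theta> = 1" | "0 < \<theta>" "\<theta> < 1" using th by linarith
  then show ?thesis
  proof cases
    case 1
    then show ?thesis using ne by (auto simp: mcomb_def)
  next
    case 2
    then show ?thesis using ne by (auto simp: mcomb_def)
  next
    case 3
    have "mcomb (1 - \<theta>) K \<theta> K \<subseteq> K" using 3 K by (intro mcomb_self_subset) auto
    moreover have "1 - \<theta> > 0" "1 - \<theta> + \<theta> = 1" using 3 by simp_all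
    ultimately show ?thesis
      using sec_brunn_minkowski_equality[OF u K K K, of "1 - \<theta>" \<theta> a b] 3 s le1 by blast
  qed
qed

lemma segment_in_convex:
  fixes K :: "'a::real_vector set"
  assumes K: "convex K" and e: "w + s1 *\<^sub>R z \<in> K" "w + s2 *\<^sub>R z \<in> K" and s: "s1 \<le> s" "s \<le> s2"
  shows "w + s *\<^sub>R z \<in> K"
proof (cases "s1 = s2")
  case False
  define c where "c = (s - s1) / (s2 - s1)"
  have c: "0 \<le> c" "c \<le> 1" "c * (s2 - s1) = s - s1" using False s by (auto simp: c_def)
  have "(1 - c) *\<^sub>R (w + s1 *\<^sub>R z) + c *\<^sub>R (w + s2 *\<^sub>R z) = w + (s1 + c * (s2 - s1)) *\<^sub>R z"
    by (simp add: algebra_simps)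
  then show ?thesis using convexD_alt[OF K e c(1,2)] c(3) by simp
qed (use assms in auto)

text \<open>Suppose that \<open>K\<close> contains a copy of \<open>P\<close> at height \<open>s0\<close> along \<open>z\<close>, while at height \<open>s1\<close> it does not
  reach outside \<open>P\<close>. Then a point of \<open>K\<close> on the other side of height \<open>s1\<close> cannot lie over the outside of
  \<open>P\<close> either: joining it to the copy of its nearest point of \<open>P\<close> would give, at height \<open>s1\<close>, a nearer point.\<close>
lemma in_cylinder:
  fixes K P :: "'a::euclidean_space set"
  assumes K: "convex K" and P: "compact P" "P \<noteq> {}" and w: "\<pi> + s *\<^sub>R z \<in> K"
    and base: "\<And>x. x \<in> P \<Longrightarrow> x + s0 *\<^sub>R z \<in> K"
    and mid: "\<And>\<kappa> x. 0 \<le> \<kappa> \<Longrightarrow> \<kappa> \<le> 1 \<Longrightarrow> x \<in> P \<Longrightarrow> (1 - \<kappa>) * s + \<kappa> * s0 = s1 \<Longrightarrow>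
       (1 - \<kappa>) *\<^sub>R \<pi> + \<kappa> *\<^sub>R x + s1 *\<^sub>R z \<in> K \<Longrightarrow> (1 - \<kappa>) *\<^sub>R \<pi> + \<kappa> *\<^sub>R x \<in> P"
    and between: "s < s1 \<and> s1 < s0 \<or> s0 < s1 \<and> s1 < s"
  shows "\<pi> \<in> P"
proof -
  \<comment> \<open>The point dividing the segment from height \<open>s\<close> to height \<open>s0\<close> at height \<open>s1\<close>.\<close>
  define \<kappa> where "\<kappa> = (s1 - s) / (s0 - s)"
  have k: "0 < \<kappa>" "\<kappa> < 1" using between by (auto simp: \<kappa>_def divide_simps)
  have ks: "\<kappa> * (s0 - s) = s1 - s" using between by (auto simp: \<kappa>_def)
  then have ks1: "(1 - \<kappa>) * s + \<kappa> * s0 = s1" by (simp add: algebra_simps)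
  obtain x where x: "x \<in> P" "\<And>y. y \<in> P \<Longrightarrow> dist \<pi> x \<le> dist \<pi> y"
    using distance_attains_inf[OF compact_imp_closed[OF P(1)] P(2), of \<pi>] by blast
  have "(1 - \<kappa>) *\<^sub>R (\<pi> + s *\<^sub>R z) + \<kappa> *\<^sub>R (x + s0 *\<^sub>R z) \<in> K"
    using k by (intro convexD_alt[OF K w base[OF x(1)]]) auto
  also have "(1 - \<kappa>) *\<^sub>R (\<pi> + s *\<^sub>R z) + \<kappa> *\<^sub>R (x + s0 *\<^sub>R z) = (1 - \<kappa>) *\<^sub>R \<pi> + \<kappa> *\<^sub>R x + ((1 - \<kappa>) * s + \<kappa> * s0) *\<^sub>R z"
    by (simp add: algebra_simps)
  finally have "(1 - \<kappa>) *\<^sub>R \<pi> + \<kappa> *\<^sub>R x \<in> P"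
    using mid[of \<kappa> x] k x(1) ks1 by simp
  then have "dist \<pi> x \<le> dist \<pi> ((1 - \<kappa>) *\<^sub>R \<pi> + \<kappa> *\<^sub>R x)" by (rule x(2))
  also have "\<dots> = norm (\<kappa> *\<^sub>R (\<pi> - x))" by (simp add: dist_norm algebra_simps)
  also have "\<dots> = \<kappa> * dist \<pi> x" using k by (simp add: dist_norm)
  finally have "(1 - \<kappa>) * dist \<pi> x \<le> 0" by (simp add: algebra_simps)
  then have "dist \<pi> x = 0" using k by (metis diff_gt_0_iff_gt dist_eq_0_iff mult_le_0_iff not_le zero_less_dist_iff)
  then show ?thesis using x(1) by simp
qed

context bonnesen_bodies
begin

text \<open>Let \<open>P\<close> be the lowest maximal section of \<open>B\<close>. The lower caps of the bodies are translates by \<open>x\<close>, the upper ones by \<open>y\<close>,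
  and between the caps each body is a cylinder over \<open>P\<close>. Since \<open>p A + q B\<close> is a cylinder there too, the two axes are parallel: they are
  \<open>z\<close> for \<open>B\<close> and \<open>\<rho> z\<close> for \<open>A\<close>, so that \<open>y = x - (1 - \<rho>) z\<close>. If the cylinder of \<open>B\<close> has height zero, then \<open>x = y\<close> and the
  bodies are translates. Otherwise all of \<open>B\<close> lies over \<open>P\<close>, in the direction \<open>z\<close>, and lengthening the cylinder of
  \<open>A\<close> by \<open>(1 - \<rho>) z\<close> turns \<open>A\<close> into a translate of \<open>B\<close>.\<close>
theorem equality_structure:
  assumes wide: "- ltop (- u) A - ltop u A \<le> - ltop (- u) B - ltop u B"
  shows "(\<exists>x. A = (+) x ` B) \<or>
    (\<exists>z w l c. z \<noteq> 0 \<and> 0 \<le> l \<and> B = {a + w + \<tau> *\<^sub>R z |a \<tau>. a \<in> A \<and> 0 \<le> \<tau> \<and> \<tau> \<le> l} \<and>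
       (\<forall>a\<in>A. \<exists>s. a + s *\<^sub>R z \<in> slice u A c))"
proof -
  interpret R: bonnesen_bodies "- u" A B p q by (rule reflected)
  let ?a = "ltop u A" and ?b = "ltop u B"
  let ?a' = "- ltop (- u) A" and ?b' = "- ltop (- u) B"
  obtain x where x: "A \<inter> {y. y \<bullet> u \<le> ?a} = (+) x ` (B \<inter> {y. y \<bullet> u \<le> ?b})" "x \<bullet> u = ?a - ?b"
    using left_translate by blast
  obtain y where y0: "A \<inter> {v. v \<bullet> - u \<le> ltop (- u) A} = (+) y ` (B \<inter> {v. v \<bullet> - u \<le> ltop (- u) B})"
    and y1: "y \<bullet> - u = ltop (- u) A - ltop (- u) B"
    using R.left_translate by blast
  have y: "A \<inter> {v. ?a' \<le> v \<bullet> u} = (+) y ` (B \<inter> {v. ?b' \<le> v \<bullet> u})" "y \<bullet> u = ?a' - ?b'"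
  proof -
    have "{v. v \<bullet> - u \<le> c} = {v. - c \<le> v \<bullet> u}" for c by auto
    then show "A \<inter> {v. ?a' \<le> v \<bullet> u} = (+) y ` (B \<inter> {v. ?b' \<le> v \<bullet> u})" using y0 by simp
    show "y \<bullet> u = ?a' - ?b'" using y1 by simp
  qed
  have sec_r: "sec u A ?a' = 1" "sec u B ?b' = 1"
    using R.sec_ltop sec_reflect[OF u, of A ?a'] sec_reflect[OF u, of B ?b'] by auto
  have ord: "?a \<le> ?a'" "?b \<le> ?b'"
    using prof.A.lend_le[of 1 ?a'] prof.B.lend_le[of 1 ?b'] sec_r unfolding lend_ltop by auto
  define P where "P = slice u B ?b"
  have P: "compact P" "convex P" "P \<noteq> {}"
    unfolding P_def using sec_ltop(2) sec_empty[of B u ?b] by (auto intro: compact_cut convex_cut compact_convex)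
  have Bself: "mcomb p B q B \<subseteq> B" using mcomb_self_subset[OF compact_convex(4)] pq by simp
  have "\<exists>z. slice u B ?b' = (+) z ` P"
    unfolding P_def using sec_brunn_minkowski_equality[OF u compact_convex(3,4) compact_convex(3,4) compact_convex(3,4) pq Bself sec_r(2) sec_ltop(2) maxB(1)] by metis
  then obtain z where z: "slice u B ?b' = (+) z ` P" by blast
  obtain p0 where p0: "p0 \<in> P" using P by blast
  have zu: "z \<bullet> u = ?b' - ?b"
  proof -
    have "z + p0 \<in> slice u B ?b'" using z p0 by blast
    then show ?thesis using p0 by (simp add: P_def inner_add_left)
  qed
  have sA: "slice u A ?a = (+) x ` P"
  proof -
    have "slice u A ?a = (A \<inter> {y. y \<bullet> u \<le> ?a}) \<inter> {y. y \<bullet> u = ?a}" by auto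
    also have "\<dots> = (+) x ` P" unfolding x(1) P_def using x(2) by (auto simp: inner_add_left)
    finally show ?thesis .
  qed
  have sA': "slice u A ?a' = (+) (y + z) ` P"
  proof -
    have "slice u A ?a' = (A \<inter> {v. ?a' \<le> v \<bullet> u}) \<inter> {v. v \<bullet> u = ?a'}" by auto
    also have "\<dots> = (+) y ` slice u B ?b'" unfolding y(1) using y(2) by (auto simp: inner_add_left)
    finally show ?thesis unfolding z by (simp add: image_image add.assoc)
  qed
  have id0: "(+) 0 ` P = P" by simp
  \<comment> \<open>Between the extreme maximal sections the bodies are cylinders over \<open>P\<close>.\<close>
  have cylB: "slice u B ((1 - \<theta>) * ?b + \<theta> * ?b') = (+) (\<theta> *\<^sub>R z) ` P" if "0 \<le> \<theta>" "\<theta> \<le> 1" for \<theta>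
    using slices_between_translates[OF u compact_convex(3,4) maxB(1) sec_ltop(2) sec_r(2) that]
      mcomb_translate_self[OF P(2), of "1 - \<theta>" \<theta> 0 z] that unfolding z P_def[symmetric] by simp
  have cylA: "slice u A ((1 - \<theta>) * ?a + \<theta> * ?a') = (+) ((1 - \<theta>) *\<^sub>R x + \<theta> *\<^sub>R (y + z)) ` P" if "0 \<le> \<theta>" "\<theta> \<le> 1" for \<theta>
    using slices_between_translates[OF u compact_convex(1,2) maxA(1) sec_ltop(1) sec_r(1) that]
      mcomb_translate_self[OF P(2), of "1 - \<theta>" \<theta> x "y + z"] that unfolding sA sA' by simp
  have slC: "slice u C (p * t + q * t') = (+) (p *\<^sub>R w + q *\<^sub>R w') ` P" "sec u C (p * t + q * t') = 1"
    if st: "sec u A t = 1" "sec u B t' = 1" "slice u A t = (+) w ` P" "slice u B t' = (+) w' ` P" for t t' w w'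
  proof -
    have "slice u C (p * t + q * t') = mcomb p (slice u A t) q (slice u B t')"
      using slice_translates[OF st(1,2)] by metis
    also have "\<dots> = (+) (p *\<^sub>R w + q *\<^sub>R w') ` P"
      unfolding st(3,4) by (rule mcomb_translate_self[OF P(2)]) (use pq in auto)
    finally show "slice u C (p * t + q * t') = (+) (p *\<^sub>R w + q *\<^sub>R w') ` P" .
    show "sec u C (p * t + q * t') = 1"
      using prof.super_comb[of 1 t t'] st maxC by (auto intro: antisym)
  qed
  note C1 = slC[OF sec_ltop sA, of 0, unfolded id0, OF P_def[symmetric]]
  note C2 = slC[OF sec_r sA' z]
  note C3 = slC[OF sec_r(1) sec_ltop(2) sA', of 0, unfolded id0, OF P_def[symmetric]]
  \<comment> \<open>The cylinder in the Minkowski combination forces the two cylinder axes to be parallel.\<close>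
  obtain \<rho> where rho: "0 \<le> \<rho>" "\<rho> \<le> 1" "y + z - x = \<rho> *\<^sub>R z" and rho_u: "?a' - ?a = \<rho> * (?b' - ?b)"
  proof (cases "?b' = ?b")
    case True
    then have "?a' = ?a" using ord wide by simp
    have "z = 0" using translate_eq_imp_eq[OF P(1,3), of z 0] z True P_def by simp
    moreover have "y + z = x" using translate_eq_imp_eq[OF P(1,3)] sA sA' \<open>?a' = ?a\<close> by metis
    ultimately show ?thesis using True \<open>?a' = ?a\<close> by (intro that[of 0]) auto
  next
    case False
    then have eta: "0 < ?b' - ?b" using ord by simp
    define \<eta> \<eta>' where "\<eta> = ?b' - ?b" and "\<eta>' = ?a' - ?a"
    have e: "0 < \<eta>" "0 \<le> \<eta>'" "\<eta>' \<le> \<eta>" using eta ord wide by (auto simp: \<eta>_def \<eta>'_def)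
    have den: "0 < p * \<eta>' + q * \<eta>" using e pq by (simp add: add_nonneg_pos)
    \<comment> \<open>The section of \<open>p A + q B\<close> that combines the top of the cylinder of \<open>A\<close> with the bottom of that of \<open>B\<close> has two descriptions.\<close>
    define \<theta> where "\<theta> = p * \<eta>' / (p * \<eta>' + q * \<eta>)"
    have th: "0 \<le> \<theta>" "\<theta> \<le> 1" "\<theta> * (p * \<eta>' + q * \<eta>) = p * \<eta>'" using den e pq by (auto simp: \<theta>_def)
    have "(1 - \<theta>) * (p * ?a + q * ?b) + \<theta> * (p * ?a' + q * ?b') = (p * ?a + q * ?b) + \<theta> * (p * \<eta>' + q * \<eta>)"
      by (simp add: \<eta>_def \<eta>'_def algebra_simps)
    also have "\<dots> = p * ?a' + q * ?b" unfolding th(3) by (simp add: \<eta>'_def algebra_simps)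
    finally have lev: "(1 - \<theta>) * (p * ?a + q * ?b) + \<theta> * (p * ?a' + q * ?b') = p * ?a' + q * ?b" .
    have "(+) (p *\<^sub>R (y + z) + q *\<^sub>R 0) ` P = (+) ((1 - \<theta>) *\<^sub>R (p *\<^sub>R x + q *\<^sub>R 0) + \<theta> *\<^sub>R (p *\<^sub>R (y + z) + q *\<^sub>R z)) ` P"
      using slices_between_translates[OF u compact_convex(5,6) maxC C1(2) C2(2) th(1,2)] C3(1)
        mcomb_translate_self[OF P(2), of "1 - \<theta>" \<theta> "p *\<^sub>R x + q *\<^sub>R 0" "p *\<^sub>R (y + z) + q *\<^sub>R z"] th
      unfolding lev C1(1) C2(1) by simp
    from translate_eq_imp_eq[OF P(1,3) this]
    have "p *\<^sub>R (y + z) = (1 - \<theta>) *\<^sub>R (p *\<^sub>R x) + \<theta> *\<^sub>R (p *\<^sub>R (y + z) + q *\<^sub>R z)" by simp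
    then have par: "((1 - \<theta>) * p) *\<^sub>R (y + z - x) = (\<theta> * q) *\<^sub>R z" by (simp add: algebra_simps)
    have c1: "((1 - \<theta>) * p) * (p * \<eta>' + q * \<eta>) = p * (q * \<eta>)"
    proof -
      have "((1 - \<theta>) * p) * (p * \<eta>' + q * \<eta>) = p * ((p * \<eta>' + q * \<eta>) - \<theta> * (p * \<eta>' + q * \<eta>))"
        by (simp add: algebra_simps)
      then show ?thesis unfolding th(3) by simp
    qed
    have c2: "(\<theta> * q) * (p * \<eta>' + q * \<eta>) = q * (p * \<eta>')"
      using th(3) by (metis mult.assoc mult.commute)
    have "((1 - \<theta>) * p * (p * \<eta>' + q * \<eta>)) *\<^sub>R (y + z - x) = (\<theta> * q * (p * \<eta>' + q * \<eta>)) *\<^sub>R z"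
      using arg_cong[OF par, of "\<lambda>v. (p * \<eta>' + q * \<eta>) *\<^sub>R v"] by (simp add: mult.commute)
    then have "(p * q * \<eta>) *\<^sub>R (y + z - x) = (p * q * \<eta>') *\<^sub>R z"
      unfolding c1 c2 by (simp add: mult_ac)
    also have "\<dots> = (p * q * \<eta>) *\<^sub>R ((\<eta>' / \<eta>) *\<^sub>R z)" using e by simp
    finally have "(p * q * \<eta>) *\<^sub>R (y + z - x) = (p * q * \<eta>) *\<^sub>R ((\<eta>' / \<eta>) *\<^sub>R z)" .
    moreover have "p * q * \<eta> \<noteq> 0" using pq e by simp
    ultimately have "y + z - x = (\<eta>' / \<eta>) *\<^sub>R z" by (rule scaleR_left_imp_eq[rotated])
    then show ?thesis using e by (intro that[of "\<eta>' / \<eta>"]) (auto simp: \<eta>_def \<eta>'_def)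
  qed
  define l where "l = 1 - \<rho>"
  have l: "0 \<le> l" "l \<le> 1" using rho by (auto simp: l_def)
  have yx: "y = x - l *\<^sub>R z" using rho(3) by (simp add: l_def algebra_simps)
  have AL: "v \<in> A \<and> v \<bullet> u \<le> ?a \<longleftrightarrow> v - x \<in> B \<and> (v - x) \<bullet> u \<le> ?b" for v
  proof -
    show ?thesis using arg_cong[OF x(1), of "\<lambda>S. v \<in> S"] by (simp add: mem_translation_iff)
  qed
  have AR: "v \<in> A \<and> ?a' \<le> v \<bullet> u \<longleftrightarrow> v - y \<in> B \<and> ?b' \<le> (v - y) \<bullet> u" for v
  proof -
    show ?thesis using arg_cong[OF y(1), of "\<lambda>S. v \<in> S"] by (simp add: mem_translation_iff)
  qed
  show ?thesis
  proof (cases "?b' = ?b")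
    case True
    have "z = 0" using translate_eq_imp_eq[OF P(1,3), of z 0] z True P_def by simp
    then have "y = x" using yx by simp
    have "?a' = ?a" using ord wide True by simp
    have "v \<in> A \<longleftrightarrow> v - x \<in> B" for v
      using AL[of v] AR[of v] \<open>y = x\<close> \<open>?a' = ?a\<close> True x(2) by (auto simp: inner_diff_left)
    then have "A = (+) x ` B" by (simp add: set_eq_iff mem_translation_iff)
    then show ?thesis by blast
  next
    case False
    then have eta: "0 < ?b' - ?b" using ord by simp
    have z0: "z \<noteq> 0" using eta zu by auto
    have lev: "(\<pi> + s *\<^sub>R z) \<bullet> u = (1 - s) * ?b + s * ?b'" if "\<pi> \<bullet> u = ?b" for \<pi> s
    proof -
      have "(\<pi> + s *\<^sub>R z) \<bullet> u = ?b + s * (?b' - ?b)" using that zu by (simp add: inner_add_left)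
      then show ?thesis by (simp add: algebra_simps)
    qed
    have Blev: "\<pi> + s *\<^sub>R z \<in> B \<longleftrightarrow> \<pi> \<in> P" if "\<pi> \<bullet> u = ?b" "0 \<le> s" "s \<le> 1" for \<pi> s
      using arg_cong[OF cylB[OF that(2,3)], of "\<lambda>S. \<pi> + s *\<^sub>R z \<in> S"] lev[OF that(1), of s]
      by (simp only: mem_translation_iff Int_iff mem_Collect_eq add_diff_cancel_right' simp_thms)
    have Pu: "\<pi> \<bullet> u = ?b" if "\<pi> \<in> P" for \<pi> using that by (simp add: P_def)
    \<comment> \<open>The section halfway up the cylinder, at \<open>s = 1 / 2\<close>, confines both caps to lie over \<open>P\<close>.\<close>
    have coord: "\<exists>\<pi> s. v = \<pi> + s *\<^sub>R z \<and> \<pi> \<in> P" if v: "v \<in> B" for v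
    proof -
      define s where "s = (v \<bullet> u - ?b) / (?b' - ?b)"
      define \<pi> where "\<pi> = v - s *\<^sub>R z"
      have vs: "v = \<pi> + s *\<^sub>R z" by (simp add: \<pi>_def)
      have "s * (?b' - ?b) = v \<bullet> u - ?b" using eta by (simp add: s_def)
      then have pu: "\<pi> \<bullet> u = ?b" using zu by (simp add: \<pi>_def inner_diff_left)
      have pk: "((1 - \<kappa>) *\<^sub>R \<pi> + \<kappa> *\<^sub>R x') \<bullet> u = ?b" if "x' \<in> P" for \<kappa> x'
        using pu Pu[OF that] by (simp add: inner_add_left algebra_simps)
      have "\<pi> \<in> P"
      proof -
        consider "0 \<le> s" "s \<le> 1" | "s < 0" | "1 < s" by linarith
        then show ?thesis
        proof cases
          case 1
          then show ?thesis using Blev[OF pu] v vs by simp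
        next
          case 2
          show ?thesis
          proof (rule in_cylinder[OF compact_convex(4) P(1,3), of \<pi> s z 1 "1 / 2"])
            show "\<pi> + s *\<^sub>R z \<in> B" using v vs by simp
            show "x' + 1 *\<^sub>R z \<in> B" if "x' \<in> P" for x' using Blev[OF Pu[OF that], of 1] that by simp
            show "(1 - \<kappa>) *\<^sub>R \<pi> + \<kappa> *\<^sub>R x' \<in> P" if "x' \<in> P" "(1 - \<kappa>) *\<^sub>R \<pi> + \<kappa> *\<^sub>R x' + (1 / 2) *\<^sub>R z \<in> B" for \<kappa> x'
              using Blev[OF pk[OF that(1)], of "1 / 2" \<kappa>] that by simp
          qed (use 2 in auto)
        next
          case 3
          show ?thesis
          proof (rule in_cylinder[OF compact_convex(4) P(1,3), of \<pi> s z 0 "1 / 2"])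
            show "\<pi> + s *\<^sub>R z \<in> B" using v vs by simp
            show "x' + 0 *\<^sub>R z \<in> B" if "x' \<in> P" for x' using Blev[OF Pu[OF that], of 0] that by simp
            show "(1 - \<kappa>) *\<^sub>R \<pi> + \<kappa> *\<^sub>R x' \<in> P" if "x' \<in> P" "(1 - \<kappa>) *\<^sub>R \<pi> + \<kappa> *\<^sub>R x' + (1 / 2) *\<^sub>R z \<in> B" for \<kappa> x'
              using Blev[OF pk[OF that(1)], of "1 / 2" \<kappa>] that by simp
          qed (use 3 in auto)
        qed
      qed
      then show ?thesis using vs by blast
    qed
    have slev: "(\<pi> + s *\<^sub>R z) \<bullet> u \<le> ?b \<longleftrightarrow> s \<le> 0" "?b' \<le> (\<pi> + s *\<^sub>R z) \<bullet> u \<longleftrightarrow> 1 \<le> s" if "\<pi> \<in> P" for \<pi> s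
    proof -
      have "(\<pi> + s *\<^sub>R z) \<bullet> u = ?b + s * (?b' - ?b)" using lev[OF Pu[OF that], of s] by (simp add: algebra_simps)
      moreover have "s * (?b' - ?b) \<le> 0 \<longleftrightarrow> s \<le> 0" using eta by (simp add: mult_le_0_iff)
      moreover have "?b' - ?b \<le> s * (?b' - ?b) \<longleftrightarrow> 1 \<le> s" using eta by simp
      ultimately show "(\<pi> + s *\<^sub>R z) \<bullet> u \<le> ?b \<longleftrightarrow> s \<le> 0" "?b' \<le> (\<pi> + s *\<^sub>R z) \<bullet> u \<longleftrightarrow> 1 \<le> s" by linarith+
    qed
    have PB: "\<pi> + s *\<^sub>R z \<in> B" if "\<pi> \<in> P" "0 \<le> s" "s \<le> 1" for \<pi> s
      using Blev[OF Pu[OF that(1)] that(2,3)] that by simp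
    \<comment> \<open>Position of a point of \<open>A\<close> relative to \<open>B\<close>, separately for the two caps and the cylinder.\<close>
    have Acases: "\<exists>\<pi> s. a = x + (\<pi> + s *\<^sub>R z) \<and> \<pi> \<in> P \<and>
        (s \<le> 0 \<and> \<pi> + s *\<^sub>R z \<in> B \<or> \<rho> \<le> s \<and> \<pi> + (s + l) *\<^sub>R z \<in> B \<or> 0 \<le> s \<and> s \<le> \<rho>)" if a: "a \<in> A" for a
    proof -
      consider "a \<bullet> u \<le> ?a" | "?a' \<le> a \<bullet> u" | "?a < a \<bullet> u" "a \<bullet> u < ?a'" by linarith
      then show ?thesis
      proof cases
        case 1
        then have v: "a - x \<in> B" "(a - x) \<bullet> u \<le> ?b" using AL[of a] a by auto
        obtain \<pi> s where ps: "a - x = \<pi> + s *\<^sub>R z" "\<pi> \<in> P" using coord[OF v(1)] by blast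
        then have "s \<le> 0" "a = x + (\<pi> + s *\<^sub>R z)" using v slev(1)[OF ps(2), of s] by (auto simp: algebra_simps)
        then show ?thesis using ps v by metis
      next
        case 2
        then have v: "a - y \<in> B" "?b' \<le> (a - y) \<bullet> u" using AR[of a] a by auto
        obtain \<pi> s where ps: "a - y = \<pi> + s *\<^sub>R z" "\<pi> \<in> P" using coord[OF v(1)] by blast
        then have "1 \<le> s" using v slev(2)[OF ps(2), of s] by simp
        moreover have "a = x + (\<pi> + (s - l) *\<^sub>R z)"
          using ps(1) unfolding yx by (simp add: algebra_simps)
        moreover have "\<pi> + (s - l + l) *\<^sub>R z \<in> B" using ps v by simp
        moreover have "\<rho> \<le> s - l" using \<open>1 \<le> s\<close> by (simp add: l_def)
        ultimately show ?thesis using ps(2) by blast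
      next
        case 3
        define \<theta> where "\<theta> = (a \<bullet> u - ?a) / (?a' - ?a)"
        have th: "0 \<le> \<theta>" "\<theta> \<le> 1" "\<theta> * (?a' - ?a) = a \<bullet> u - ?a" using 3 by (auto simp: \<theta>_def)
        have "a \<in> slice u A ((1 - \<theta>) * ?a + \<theta> * ?a')" using a th(3) by (simp add: algebra_simps)
        then have "a \<in> (+) ((1 - \<theta>) *\<^sub>R x + \<theta> *\<^sub>R (y + z)) ` P" unfolding cylA[OF th(1,2)] .
        then obtain \<pi> where pp: "\<pi> \<in> P" "a = (1 - \<theta>) *\<^sub>R x + \<theta> *\<^sub>R (y + z) + \<pi>" by blast
        have "(1 - \<theta>) *\<^sub>R x + \<theta> *\<^sub>R (y + z) = x + \<theta> *\<^sub>R (y + z - x)" by (simp add: algebra_simps)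
        then have "a = x + (\<pi> + (\<theta> * \<rho>) *\<^sub>R z)" unfolding pp(2) rho(3) by (simp add: algebra_simps)
        moreover have "0 \<le> \<theta> * \<rho>" "\<theta> * \<rho> \<le> \<rho>" using th rho by (auto intro: mult_left_le_one_le)
        ultimately show ?thesis using pp(1) by blast
      qed
    qed
    have Pa: "x + \<pi> \<in> slice u A ?a" if "\<pi> \<in> P" for \<pi> unfolding sA using that by blast
    have cyl: "\<forall>a\<in>A. \<exists>s. a + s *\<^sub>R z \<in> slice u A ?a"
    proof
      fix a assume "a \<in> A"
      then obtain \<pi> s where "a = x + (\<pi> + s *\<^sub>R z)" "\<pi> \<in> P" using Acases by blast
      then have "a + (- s) *\<^sub>R z = x + \<pi>" "x + \<pi> \<in> slice u A ?a" using Pa by auto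
      then show "\<exists>s. a + s *\<^sub>R z \<in> slice u A ?a" by metis
    qed
    have "B = {a + - x + \<tau> *\<^sub>R z |a \<tau>. a \<in> A \<and> 0 \<le> \<tau> \<and> \<tau> \<le> l}"
    proof (intro equalityI subsetI)
      fix v assume v: "v \<in> B"
      obtain \<pi> s where ps: "v = \<pi> + s *\<^sub>R z" "\<pi> \<in> P" using coord[OF v] by blast
      have "\<exists>a \<tau>. v = a + - x + \<tau> *\<^sub>R z \<and> a \<in> A \<and> 0 \<le> \<tau> \<and> \<tau> \<le> l"
      proof -
        consider "s \<le> 0" | "1 \<le> s" | "0 < s" "s < 1" by linarith
        then show ?thesis
        proof cases
          case 1
          then have "x + v \<in> A" using AL[of "x + v"] v slev(1)[OF ps(2), of s] ps(1) by simp
          then show ?thesis using l by (intro exI[of _ "x + v"] exI[of _ 0]) simp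
        next
          case 2
          then have "y + v \<in> A" using AR[of "y + v"] v slev(2)[OF ps(2), of s] ps(1) by simp
          then show ?thesis using l by (intro exI[of _ "y + v"] exI[of _ l]) (simp add: yx)
        next
          case 3
          have e: "(x + \<pi>) + 0 *\<^sub>R z \<in> A" "(x + \<pi>) + \<rho> *\<^sub>R z \<in> A"
          proof -
            show "(x + \<pi>) + 0 *\<^sub>R z \<in> A" using Pa[OF ps(2)] by simp
            have "y + z + \<pi> \<in> A" using sA' ps(2) by blast
            moreover have "y + z + \<pi> = (x + \<pi>) + \<rho> *\<^sub>R z" using rho(3) by (simp add: algebra_simps)
            ultimately show "(x + \<pi>) + \<rho> *\<^sub>R z \<in> A" by simp
          qed
          \<comment> \<open>Use the cylinder of \<open>A\<close> as far as it reaches and stretching for the remainder.\<close>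
          define \<kappa> where "\<kappa> = min s \<rho>"
          have "(x + \<pi>) + \<kappa> *\<^sub>R z \<in> A"
            using segment_in_convex[OF compact_convex(2) e, of \<kappa>] 3 rho by (simp add: \<kappa>_def)
          then show ?thesis
            using 3 rho ps(1) by (intro exI[of _ "x + \<pi> + \<kappa> *\<^sub>R z"] exI[of _ "s - \<kappa>"])
              (auto simp: \<kappa>_def l_def algebra_simps min_def)
        qed
      qed
      then show "v \<in> {a + - x + \<tau> *\<^sub>R z |a \<tau>. a \<in> A \<and> 0 \<le> \<tau> \<and> \<tau> \<le> l}" by blast
    next
      fix v assume "v \<in> {a + - x + \<tau> *\<^sub>R z |a \<tau>. a \<in> A \<and> 0 \<le> \<tau> \<and> \<tau> \<le> l}"
      then obtain a \<tau> where a: "v = a + - x + \<tau> *\<^sub>R z" "a \<in> A" "0 \<le> \<tau>" "\<tau> \<le> l" by blast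
      obtain \<pi> s where ps: "a = x + (\<pi> + s *\<^sub>R z)" "\<pi> \<in> P"
        "s \<le> 0 \<and> \<pi> + s *\<^sub>R z \<in> B \<or> \<rho> \<le> s \<and> \<pi> + (s + l) *\<^sub>R z \<in> B \<or> 0 \<le> s \<and> s \<le> \<rho>"
        using Acases[OF a(2)] by blast
      have v: "v = \<pi> + (s + \<tau>) *\<^sub>R z" using a(1) ps(1) by (simp add: algebra_simps)
      from ps(3) show "v \<in> B"
      proof (elim disjE conjE)
        assume "s \<le> 0" "\<pi> + s *\<^sub>R z \<in> B"
        then show "v \<in> B" unfolding v using segment_in_convex[OF compact_convex(4) _ PB[OF ps(2), of 1], of s "s + \<tau>"] a l by simp
      next
        assume "\<rho> \<le> s" "\<pi> + (s + l) *\<^sub>R z \<in> B"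
        then show "v \<in> B" unfolding v using segment_in_convex[OF compact_convex(4) PB[OF ps(2), of 0], of "s + l" "s + \<tau>"] a l rho by simp
      next
        assume "0 \<le> s" "s \<le> \<rho>"
        then show "v \<in> B" unfolding v using a by (intro PB ps) (auto simp: l_def)
      qed
    qed
    then show ?thesis using z0 l(1) cyl by blast
  qed
qed

end

section \<open>Sections and flat Lebesgue measure\<close>

text \<open>Uniqueness of translation-invariant measures, specialised to the image of Lebesgue measure under an isometry:
  by Fubini the mass of the unit ball times the mass of \<open>T -` A\<close> equals the mass of the unit ball times that of \<open>A\<close>.\<close>
lemma emeasure_isometry_vimage:
  fixes T :: "'a::euclidean_space \<Rightarrow> 'a"
  assumes lin: "linear T" and iso: "\<And>x. norm (T x) = norm x" and A[measurable]: "A \<in> sets borel"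
  shows "emeasure lborel (T -` A) = emeasure lborel A"
proof -
  have [measurable]: "T \<in> borel_measurable borel"
    using lin by (intro borel_measurable_continuous_onI linear_continuous_on linear_conv_bounded_linear[THEN iffD1])
  have "inj T"
    using iso lin by (metis linear_injective_0 norm_eq_zero)
  then have surj: "surj T" using lin by (intro linear_injective_imp_surjective) simp_all
  let ?g = "indicator (ball 0 1) :: 'a \<Rightarrow> ennreal"
  have [measurable, simp]: "?g \<in> borel_measurable borel"
    by (auto intro!: borel_measurable_indicator borel_open)
  have shift: "(\<integral>\<^sup>+w. f (c + w) \<partial>lborel) = (\<integral>\<^sup>+w. f w \<partial>lborel)"
    if [measurable]: "f \<in> borel_measurable borel" for f :: "'a \<Rightarrow> ennreal" and c
  proof -
    have "(\<integral>\<^sup>+w. f w \<partial>lborel) = (\<integral>\<^sup>+w. f w \<partial>distr lborel borel ((+) c))" by (simp add: lborel_distr_plus)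
    then show ?thesis by (simp add: nn_integral_distr)
  qed
  define m where "m = emeasure lborel (ball (0::'a) 1)"
  have m: "m \<noteq> 0" "m \<noteq> \<infinity>"
  proof -
    have "\<not> negligible (ball (0::'a) 1)" by (simp add: open_not_negligible)
    then have "ball (0::'a) 1 \<notin> null_sets lebesgue" by (simp add: negligible_iff_null_sets)
    then show "m \<noteq> 0" unfolding m_def by (auto simp: null_sets_def)
    show "m \<noteq> \<infinity>" unfolding m_def using emeasure_lborel_ball_finite[of "0::'a" 1] by simp
  qed
  have gT: "(\<integral>\<^sup>+w. ?g (x - T w) \<partial>lborel) = m" for x
  proof -
    obtain w0 where w0: "x = T w0" using surj by blast
    have "norm (x - T (w0 + w)) = norm w" for w using lin by (simp add: w0 linear_add iso)
    then have "(\<integral>\<^sup>+w. ?g (x - T (w0 + w)) \<partial>lborel) = (\<integral>\<^sup>+w. ?g w \<partial>lborel)"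
      by (intro nn_integral_cong) (simp add: indicator_def)
    moreover have "(\<lambda>w. ?g (x - T w)) \<in> borel_measurable borel"
      by (rule measurable_compose[of "\<lambda>w. x - T w" borel borel ?g])
         (auto intro!: borel_measurable_indicator borel_open)
    ultimately show ?thesis using shift[of "\<lambda>w. ?g (x - T w)" w0] by (simp add: m_def)
  qed
  have "m * emeasure lborel (T -` A) = (\<integral>\<^sup>+x. ?g x * emeasure lborel (T -` A) \<partial>lborel)"
    by (subst nn_integral_multc) (auto simp: m_def)
  also have "\<dots> = (\<integral>\<^sup>+x. \<integral>\<^sup>+w. ?g x * indicator A (T w + x) \<partial>lborel \<partial>lborel)"
  proof (rule nn_integral_cong)
    fix x :: 'a
    obtain w0 where w0: "x = T w0" using surj by blast
    have "emeasure lborel (T -` A) = (\<integral>\<^sup>+w. indicator A (T w) \<partial>lborel)"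
      by (subst nn_integral_indicator[symmetric]) (auto intro!: nn_integral_cong measurable_sets_borel[of T borel, simplified] split: split_indicator)
    also have "\<dots> = (\<integral>\<^sup>+w. indicator A (T (w0 + w)) \<partial>lborel)"
      by (rule shift[of "\<lambda>w. indicator A (T w)" w0, symmetric]) measurable
    also have "\<dots> = (\<integral>\<^sup>+w. indicator A (T w + x) \<partial>lborel)"
      using lin by (simp add: w0 linear_add add.commute)
    finally show "?g x * emeasure lborel (T -` A) = (\<integral>\<^sup>+w. ?g x * indicator A (T w + x) \<partial>lborel)"
      by (subst nn_integral_cmult) auto
  qed
  also have "\<dots> = (\<integral>\<^sup>+w. \<integral>\<^sup>+x. ?g x * indicator A (T w + x) \<partial>lborel \<partial>lborel)"
    by (rule lborel_pair.Fubini'[symmetric]) measurable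
  also have "\<dots> = (\<integral>\<^sup>+w. \<integral>\<^sup>+x. ?g (x - T w) * indicator A x \<partial>lborel \<partial>lborel)"
    using shift[of "\<lambda>x. ?g (x - T w) * indicator A x" "T w" for w] by simp
  also have "\<dots> = (\<integral>\<^sup>+x. \<integral>\<^sup>+w. ?g (x - T w) * indicator A x \<partial>lborel \<partial>lborel)"
    by (rule lborel_pair.Fubini') measurable
  also have "\<dots> = (\<integral>\<^sup>+x. m * indicator A x \<partial>lborel)"
    by (intro nn_integral_cong, subst nn_integral_multc) (auto simp: gT)
  also have "\<dots> = m * emeasure lborel A" by (simp add: nn_integral_cmult)
  finally show ?thesis using m by (simp add: ennreal_mult_cancel_left)
qed

interpretation lborel_product: product_sigma_finite "\<lambda>_. lborel :: real measure" ..

text \<open>A linear isometry carries the standard basis to \<open>D\<close>, so the description of Lebesgue measure by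
  standard coordinates becomes one by coordinates along \<open>D\<close>.\<close>
lemma lborel_orthonormal:
  fixes D :: "'a::euclidean_space set"
  assumes D: "finite D" "pairwise orthogonal D" "\<And>e. e \<in> D \<Longrightarrow> norm e = 1" "card D = DIM('a)"
  shows "distr (Pi\<^sub>M D (\<lambda>_. lborel)) borel (\<lambda>f. \<Sum>e\<in>D. f e *\<^sub>R e) = lborel"
proof -
  obtain h where h: "bij_betw h (Basis :: 'a set) D"
    using finite_same_card_bij[OF finite_Basis D(1)] D(4) by auto
  define g where "g = inv_into Basis h"
  have g: "bij_betw g D Basis" "\<And>e. e \<in> D \<Longrightarrow> h (g e) = e" "\<And>b. b \<in> Basis \<Longrightarrow> g (h b) = b"
    using h by (auto simp: g_def bij_betw_inv_into bij_betw_inv_into_right bij_betw_inv_into_left)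
  have hD: "h b \<in> D" if "b \<in> Basis" for b using h that by (auto simp: bij_betw_def)
  have gB: "g e \<in> Basis" if "e \<in> D" for e using g that by (auto simp: bij_betw_def)
  define T where "T x = (\<Sum>b\<in>Basis. (x \<bullet> b) *\<^sub>R h b)" for x
  have "linear T" unfolding T_def
    by (rule linearI) (simp_all add: inner_add_left scaleR_add_left sum.distrib scaleR_sum_right)
  have orth: "h b \<bullet> h c = (if b = c then 1 else 0)" if "b \<in> Basis" "c \<in> Basis" for b c
  proof (cases "b = c")
    case True
    then show ?thesis using D(3)[OF hD[OF that(1)]] by (simp add: norm_eq_1)
  next
    case False
    then have "h b \<noteq> h c" using h that by (auto simp: bij_betw_def inj_on_def)
    then show ?thesis using D(2) hD that False by (auto simp: pairwise_def orthogonal_def)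
  qed
  have iso: "norm (T x) = norm x" for x
  proof -
    have row: "(\<Sum>c\<in>Basis. (x \<bullet> c) * (h c \<bullet> h b)) = x \<bullet> b" if "b \<in> Basis" for b
    proof -
      have "(\<Sum>c\<in>Basis. (x \<bullet> c) * (h c \<bullet> h b)) = (\<Sum>c\<in>Basis. if c = b then x \<bullet> c else 0)"
        by (intro sum.cong refl) (simp add: orth that)
      then show ?thesis using that by simp
    qed
    have "T x \<bullet> T x = (\<Sum>b\<in>Basis. (x \<bullet> b) * (\<Sum>c\<in>Basis. (x \<bullet> c) * (h c \<bullet> h b)))"
      by (simp add: T_def inner_sum_left inner_sum_right)
    also have "\<dots> = (\<Sum>b\<in>Basis. (x \<bullet> b) * (x \<bullet> b))" by (intro sum.cong refl) (simp add: row)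
    also have "\<dots> = x \<bullet> x" by (simp add: euclidean_inner[of x x])
    finally show ?thesis by (simp add: norm_eq_sqrt_inner)
  qed
  have Tm[measurable]: "T \<in> borel_measurable borel"
    using \<open>linear T\<close> by (intro borel_measurable_continuous_onI linear_continuous_on linear_conv_bounded_linear[THEN iffD1])
  have inv: "distr lborel borel T = lborel"
    by (rule measure_eqI) (auto simp: emeasure_distr emeasure_isometry_vimage[OF \<open>linear T\<close> iso])
  let ?r = "\<lambda>f. \<lambda>e\<in>D. f (g e)"
  have rm[measurable]: "?r \<in> measurable (Pi\<^sub>M Basis (\<lambda>_. lborel :: real measure)) (Pi\<^sub>M D (\<lambda>_. lborel))"
    using gB by (intro measurable_restrict measurable_component_singleton) auto
  \<comment> \<open>Rename the coordinates along the bijection of the two bases.\<close>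
  have reindex: "distr (Pi\<^sub>M Basis (\<lambda>_. lborel)) (Pi\<^sub>M D (\<lambda>_. lborel :: real measure)) ?r = Pi\<^sub>M D (\<lambda>_. lborel)"
  proof (rule lborel_product.PiM_eqI[OF D(1)])
    fix X :: "'a \<Rightarrow> real set" assume X: "\<And>e. e \<in> D \<Longrightarrow> X e \<in> sets lborel"
    have XE: "Pi\<^sub>E D X \<in> sets (Pi\<^sub>M D (\<lambda>_. lborel))" using X D(1) by (intro sets_PiM_I_finite) auto
    have "?r -` Pi\<^sub>E D X \<inter> space (Pi\<^sub>M Basis (\<lambda>_. lborel)) = Pi\<^sub>E Basis (\<lambda>b. X (h b))"
    proof (intro equalityI subsetI)
      fix f assume f: "f \<in> ?r -` Pi\<^sub>E D X \<inter> space (Pi\<^sub>M Basis (\<lambda>_. lborel))"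
      have "f b \<in> X (h b)" if "b \<in> Basis" for b
      proof -
        have "?r f (h b) \<in> X (h b)" using f hD[OF that] by blast
        then show ?thesis using hD[OF that] g(3)[OF that] by simp
      qed
      then show "f \<in> Pi\<^sub>E Basis (\<lambda>b. X (h b))" using f by (auto simp: space_PiM PiE_def)
    next
      fix f assume f: "f \<in> Pi\<^sub>E Basis (\<lambda>b. X (h b))"
      have "f (g e) \<in> X e" if "e \<in> D" for e
        using PiE_mem[OF f gB[OF that]] g(2)[OF that] by simp
      then show "f \<in> ?r -` Pi\<^sub>E D X \<inter> space (Pi\<^sub>M Basis (\<lambda>_. lborel))"
        using f by (auto simp: space_PiM PiE_def)
    qed
    then have "emeasure (distr (Pi\<^sub>M Basis (\<lambda>_. lborel)) (Pi\<^sub>M D (\<lambda>_. lborel)) ?r) (Pi\<^sub>E D X)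
      = emeasure (Pi\<^sub>M Basis (\<lambda>_. lborel)) (Pi\<^sub>E Basis (\<lambda>b. X (h b)))"
      using XE by (simp add: emeasure_distr[OF rm])
    also have "\<dots> = (\<Prod>b\<in>Basis. emeasure lborel (X (h b)))"
      using X hD by (intro lborel_product.emeasure_PiM) auto
    also have "\<dots> = (\<Prod>e\<in>D. emeasure lborel (X e))"
      by (rule prod.reindex_bij_betw[OF h])
    finally show "emeasure (distr (Pi\<^sub>M Basis (\<lambda>_. lborel)) (Pi\<^sub>M D (\<lambda>_. lborel)) ?r) (Pi\<^sub>E D X) = (\<Prod>e\<in>D. emeasure lborel (X e))" .
  qed simp
  have "distr (Pi\<^sub>M D (\<lambda>_. lborel)) borel (\<lambda>f. \<Sum>e\<in>D. f e *\<^sub>R e)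
      = distr (distr (Pi\<^sub>M Basis (\<lambda>_. lborel)) (Pi\<^sub>M D (\<lambda>_. lborel)) ?r) borel (\<lambda>f. \<Sum>e\<in>D. f e *\<^sub>R e)"
    by (simp add: reindex)
  also have "\<dots> = distr (Pi\<^sub>M Basis (\<lambda>_. lborel)) borel ((\<lambda>f. \<Sum>e\<in>D. f e *\<^sub>R e) \<circ> ?r)"
    by (rule distr_distr[OF _ rm]) measurable
  also have "(\<lambda>f. \<Sum>e\<in>D. f e *\<^sub>R e) \<circ> ?r = T \<circ> (\<lambda>f. \<Sum>b\<in>Basis. f b *\<^sub>R b)"
  proof
    fix f :: "'a \<Rightarrow> real"
    have "(\<Sum>e\<in>D. ?r f e *\<^sub>R e) = (\<Sum>b\<in>Basis. ?r f (h b) *\<^sub>R h b)"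
      by (rule sum.reindex_bij_betw[OF h, symmetric])
    also have "\<dots> = (\<Sum>b\<in>Basis. f b *\<^sub>R h b)" by (intro sum.cong) (auto simp: hD g(3))
    also have "\<dots> = T (\<Sum>b\<in>Basis. f b *\<^sub>R b)" unfolding T_def by (intro sum.cong) auto
    finally show "((\<lambda>f. \<Sum>e\<in>D. f e *\<^sub>R e) \<circ> ?r) f = (T \<circ> (\<lambda>f. \<Sum>b\<in>Basis. f b *\<^sub>R b)) f" by simp
  qed
  also have "distr (Pi\<^sub>M Basis (\<lambda>_. lborel)) borel (T \<circ> (\<lambda>f. \<Sum>b\<in>Basis. f b *\<^sub>R b)) = distr lborel borel T"
    by (subst (2) lborel_eq) (subst distr_distr, auto)
  finally show ?thesis by (simp add: inv)
qed

text \<open>Complete the chosen orthonormal basis of the hyperplane by the normal \<open>u\<close>. In these coordinates the prism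
  over a section is the product of the section with \<open>[0, 1]\<close>.\<close>
theorem flat_lborel_eq_sec:
  fixes K :: "'a::euclidean_space set"
  assumes u: "norm u = 1" and K: "compact K"
  shows "measure (flat_lborel {x. x \<bullet> u = t}) (K \<inter> {x. x \<bullet> u = t}) = sec u K t"
proof -
  let ?H = "{x. x \<bullet> u = t}" and ?L = "{x. u \<bullet> x = 0}"
  have uu: "u \<bullet> u = 1" using u by (rule inner_unit)
  have u0: "u \<noteq> 0" using u by auto
  define p where "p = (SOME p. p \<in> ?H)"
  have "t *\<^sub>R u \<in> ?H" using uu by simp
  then have p: "p \<bullet> u = t" unfolding p_def using someI_ex[of "\<lambda>p. p \<in> ?H"] by blast
  have L: "(\<lambda>x. x - p) ` ?H = ?L"
  proof -
    have "x \<in> (\<lambda>x. x - p) ` ?H" if "u \<bullet> x = 0" for x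
      using that p by (intro image_eqI[of _ _ "x + p"]) (auto simp: inner_add_right inner_commute)
    then show ?thesis using p by (auto simp: inner_diff_right inner_commute)
  qed
  have sL: "subspace ?L" by (rule subspace_hyperplane)
  \<comment> \<open>The point \<open>p\<close> and the basis \<open>E\<close> are those chosen in \<open>flat_lborel\<close>.\<close>
  define Q where "Q E \<longleftrightarrow> pairwise orthogonal E \<and> (\<forall>e\<in>E. norm e = 1) \<and> span E = (\<lambda>x. x - p) ` ?H" for E
  define E where "E = (SOME E. Q E)"
  obtain E0 where "E0 \<subseteq> ?L" "pairwise orthogonal E0" "\<And>x. x \<in> E0 \<Longrightarrow> norm x = 1" "span E0 = ?L"
    using orthonormal_basis_subspace[OF sL] by metis
  then have "Q E0" unfolding Q_def L by blast
  then have "Q E" unfolding E_def by (rule someI)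
  then have E: "pairwise orthogonal E" "\<And>e. e \<in> E \<Longrightarrow> norm e = 1" "span E = ?L" unfolding Q_def L by auto
  have indE: "independent E" using E(1,2) by (intro pairwise_orthogonal_independent) force+
  have finE: "finite E" using indE by (rule independent_imp_finite)
  have "card E = dim ?L" using indE E(3) by (metis dim_eq_card_independent dim_span)
  also have "\<dots> = DIM('a) - 1" using u0 by (rule dim_hyperplane)
  finally have cE: "card E = DIM('a) - 1" .
  have Eu: "e \<bullet> u = 0" if "e \<in> E" for e using span_base[OF that] E(3) by (auto simp: inner_commute)
  then have uE: "u \<notin> E" using uu by auto
  have D: "finite (insert u E)" "pairwise orthogonal (insert u E)" "\<And>e. e \<in> insert u E \<Longrightarrow> norm e = 1"
    "card (insert u E) = DIM('a)"
  proof -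
    show "pairwise orthogonal (insert u E)"
      using E(1) Eu by (auto simp: pairwise_insert orthogonal_def inner_commute)
    show "card (insert u E) = DIM('a)" using finE uE cE DIM_positive[where 'a='a] by simp
  qed (use finE E u in auto)
  define S where "S f = (\<Sum>e\<in>E. f e *\<^sub>R e)" for f :: "'a \<Rightarrow> real"
  have Su: "S f \<bullet> u = 0" for f by (simp add: S_def inner_sum_left Eu)
  have Sm[measurable]: "S \<in> borel_measurable (Pi\<^sub>M E (\<lambda>_. lborel))" unfolding S_def by measurable
  have Kb[measurable]: "K \<in> sets borel" using K by (rule borel_compact)
  have flat: "flat_lborel ?H = distr (Pi\<^sub>M E (\<lambda>_. lborel)) borel (\<lambda>f. p + S f)"
    unfolding flat_lborel_def Let_def p_def[symmetric] Q_def[symmetric] E_def[symmetric] S_def ..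
  let ?P = "prism u 1 (K \<inter> ?H)"
  have Pc: "compact ?P" using K by (rule compact_prism_slice)
  then have Pb[measurable]: "?P \<in> sets borel" by (rule borel_compact)
  have "emeasure lborel ?P = (\<integral>\<^sup>+x. indicator ?P x \<partial>lborel)" by simp
  also have "\<dots> = (\<integral>\<^sup>+x. indicator ?P (p + x) \<partial>lborel)"
    by (subst lborel_distr_plus[of p, symmetric], subst nn_integral_distr) auto
  also have "\<dots> = (\<integral>\<^sup>+f. indicator ?P (p + (\<Sum>e\<in>insert u E. f e *\<^sub>R e)) \<partial>Pi\<^sub>M (insert u E) (\<lambda>_. lborel))"
  proof -
    have "(\<integral>\<^sup>+x. indicator ?P (p + x) \<partial>lborel)
       = (\<integral>\<^sup>+x. indicator ?P (p + x) \<partial>distr (Pi\<^sub>M (insert u E) (\<lambda>_. lborel)) borel (\<lambda>f. \<Sum>e\<in>insert u E. f e *\<^sub>R e))"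
      by (simp only: lborel_orthonormal[OF D])
    also have "\<dots> = (\<integral>\<^sup>+f. indicator ?P (p + (\<Sum>e\<in>insert u E. f e *\<^sub>R e)) \<partial>Pi\<^sub>M (insert u E) (\<lambda>_. lborel))"
      by (rule nn_integral_distr) measurable
    finally show ?thesis .
  qed
  also have "\<dots> = (\<integral>\<^sup>+f. \<integral>\<^sup>+s. indicator ?P (p + (\<Sum>e\<in>insert u E. (f(u := s)) e *\<^sub>R e)) \<partial>lborel \<partial>Pi\<^sub>M E (\<lambda>_. lborel))"
    by (rule lborel_product.product_nn_integral_insert[OF finE uE]) measurable
  also have "\<dots> = (\<integral>\<^sup>+f. \<integral>\<^sup>+s. indicator K (p + S f) * indicator {0..1::real} s \<partial>lborel \<partial>Pi\<^sub>M E (\<lambda>_. lborel))"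
  proof -
    have "(indicator ?P (p + (\<Sum>e\<in>insert u E. (f(u := s)) e *\<^sub>R e)) :: ennreal) = indicator K (p + S f) * indicator {0..1} s" for f and s :: real
    proof -
      have "(\<Sum>e\<in>insert u E. (f(u := s)) e *\<^sub>R e) = s *\<^sub>R u + (\<Sum>e\<in>E. (f(u := s)) e *\<^sub>R e)" using finE uE by simp
      also have "(\<Sum>e\<in>E. (f(u := s)) e *\<^sub>R e) = S f" unfolding S_def using uE by (intro sum.cong) auto
      finally have eq: "p + (\<Sum>e\<in>insert u E. (f(u := s)) e *\<^sub>R e) = p + S f + s *\<^sub>R u" by simp
      have "(p + S f + s *\<^sub>R u) \<bullet> u - t = s" by (simp add: inner_add_left p Su uu)
      then have "p + S f + s *\<^sub>R u \<in> ?P \<longleftrightarrow> 0 \<le> s \<and> s \<le> 1 \<and> p + S f \<in> K"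
        by (simp only: prism_slice_iff[OF u] add_diff_cancel_right')
      then show ?thesis unfolding eq by (auto simp: indicator_def)
    qed
    then show ?thesis by (simp only:)
  qed
  also have "\<dots> = (\<integral>\<^sup>+f. indicator K (p + S f) \<partial>Pi\<^sub>M E (\<lambda>_. lborel))"
    by (intro nn_integral_cong, subst nn_integral_cmult) auto
  also have "\<dots> = (\<integral>\<^sup>+x. indicator K x \<partial>flat_lborel ?H)"
    unfolding flat by (subst nn_integral_distr) auto
  also have "\<dots> = emeasure (flat_lborel ?H) K"
    by (rule nn_integral_indicator) (simp add: flat)
  also have "\<dots> = emeasure (flat_lborel ?H) (K \<inter> ?H)"
  proof -
    have Hb: "?H \<in> sets borel" using closed_hyperplane[of u t] by (simp add: inner_commute borel_closed)
    have "(\<lambda>f. p + S f) -` (K \<inter> ?H) = (\<lambda>f. p + S f) -` K" by (auto simp: inner_add_left p Su)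
    then show ?thesis unfolding flat using Hb by (simp add: emeasure_distr)
  qed
  finally have "emeasure (flat_lborel ?H) (K \<inter> ?H) = emeasure lborel ?P" by simp
  then show ?thesis unfolding sec_def emeasure_compact_vol[OF Pc] by (simp add: measure_def)
qed

lemma hyperplane_unit_normal:
  fixes L :: "'a::euclidean_space set"
  assumes "subspace L" "dim L = DIM('a) - 1"
  obtains u where "norm u = 1" "\<And>H. affine_parallel L H \<longleftrightarrow> (\<exists>t. H = {x. x \<bullet> u = t})"
proof -
  obtain a where a: "a \<noteq> 0" "span L = {x. a \<bullet> x = 0}" using lowdim_eq_hyperplane[OF assms(2)] by blast
  define u where "u = a /\<^sub>R norm a"
  have u: "norm u = 1" using a by (simp add: u_def)
  have L: "L = {x. x \<bullet> u = 0}" using a span_eq_iff[of L] assms(1) by (auto simp: u_def inner_commute)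
  have tr: "(\<lambda>x. c + x) ` L = {x. x \<bullet> u = c \<bullet> u}" for c
    by (auto simp: L inner_add_left inner_diff_left intro!: image_eqI[of _ _ "_ - c"])
  have "affine_parallel L H \<longleftrightarrow> (\<exists>t. H = {x. x \<bullet> u = t})" for H
  proof
    assume "\<exists>t. H = {x. x \<bullet> u = t}"
    then obtain t where "H = {x. x \<bullet> u = t}" by blast
    then have "H = (\<lambda>x. t *\<^sub>R u + x) ` L" using tr[of "t *\<^sub>R u"] inner_unit[OF u] by simp
    then show "affine_parallel L H" unfolding affine_parallel_def by blast
  qed (auto simp: affine_parallel_def tr)
  with u show ?thesis by (rule that)
qed

lemma max_section_eqI:
  fixes K :: "'a::euclidean_space set"
  assumes u: "norm u = 1" and par: "\<And>H. affine_parallel L H \<longleftrightarrow> (\<exists>t. H = {x. x \<bullet> u = t})" and K: "compact K"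
    and m: "sec u K t0 = m" "\<And>t. sec u K t \<le> m"
  shows "max_section L K = m"
  unfolding max_section_def
proof (rule Greatest_equality)
  show "\<exists>H. affine_parallel L H \<and> m = measure (flat_lborel H) (K \<inter> H)"
    using par flat_lborel_eq_sec[OF u K, of t0] m(1) by metis
  show "y \<le> m" if "\<exists>H. affine_parallel L H \<and> y = measure (flat_lborel H) (K \<inter> H)" for y
    using that par flat_lborel_eq_sec[OF u K] m(2) by metis
qed

section \<open>Stretched bodies\<close>

lemma prismI: "x \<in> S \<Longrightarrow> 0 \<le> \<tau> \<Longrightarrow> \<tau> \<le> l \<Longrightarrow> x + \<tau> *\<^sub>R z \<in> prism z l S"
  unfolding prism_def by blast

text \<open>When all of \<open>K\<close> lies over its section at level \<open>h\<close>, stretching cuts \<open>K\<close> at this level and inserts a cylinder: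
  the lower part stays, the upper part is moved by \<open>l z\<close>.\<close>
lemma prism_cylinder_sec:
  fixes K :: "'a::euclidean_space set"
  assumes u: "norm u = 1" and K: "compact K" "convex K" and z: "0 < z \<bullet> u" and l: "0 \<le> l"
    and cyl: "\<And>k. k \<in> K \<Longrightarrow> \<exists>s. k + s *\<^sub>R z \<in> slice u K h"
  shows "sec u (prism z l K) t =
    (if t < h then sec u K t else if t \<le> h + l * (z \<bullet> u) then sec u K h else sec u K (t - l * (z \<bullet> u)))"
proof -
  let ?\<eta> = "z \<bullet> u"
  let ?K2 = "prism z l K"
  have coord: "\<exists>\<pi>. \<pi> \<in> slice u K h \<and> k = \<pi> + ((k \<bullet> u - h) / ?\<eta>) *\<^sub>R z" if k: "k \<in> K" for k
  proof -
    obtain s where s: "k + s *\<^sub>R z \<in> slice u K h" using cyl[OF k] by blast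
    then have "k \<bullet> u + s * ?\<eta> = h" by (simp add: inner_add_left)
    then have "(k \<bullet> u - h) / ?\<eta> = - s" using z by (simp add: field_simps)
    then have "k = (k + s *\<^sub>R z) + ((k \<bullet> u - h) / ?\<eta>) *\<^sub>R z" by simp
    with s show ?thesis by blast
  qed
  have tr: "sec u K' (t0 + s * ?\<eta>) = sec u K t0" if "slice u K' (t0 + s * ?\<eta>) = (+) (s *\<^sub>R z) ` slice u K t0" for K' t0 s
  proof -
    have "(+) (s *\<^sub>R z) ` slice u K t0 = slice u ((+) (s *\<^sub>R z) ` K) (t0 + s * ?\<eta>)" by (auto simp: inner_add_left)
    then have "sec u K' (t0 + s * ?\<eta>) = sec u ((+) (s *\<^sub>R z) ` K) ((s *\<^sub>R z) \<bullet> u + t0)"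
      unfolding sec_def that by (simp add: add.commute)
    then show ?thesis using sec_translation by metis
  qed
  consider "t < h" | "h \<le> t" "t \<le> h + l * ?\<eta>" | "h + l * ?\<eta> < t" by linarith
  then show ?thesis
  proof cases
    case 1
    have "slice u ?K2 t = slice u K t"
    proof (intro equalityI subsetI)
      fix w assume w: "w \<in> slice u ?K2 t"
      then obtain k \<tau> where k: "w = k + \<tau> *\<^sub>R z" "k \<in> K" "0 \<le> \<tau>" "\<tau> \<le> l" by (auto simp: prism_def)
      define s where "s = (k \<bullet> u - h) / ?\<eta>"
      obtain \<pi> where p: "\<pi> \<in> slice u K h" "k = \<pi> + s *\<^sub>R z" using coord[OF k(2)] unfolding s_def by blast
      have eq: "w = \<pi> + (s + \<tau>) *\<^sub>R z" using k(1) p(2) by (simp add: algebra_simps)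
      have "s + \<tau> \<le> 0"
      proof -
        have "w \<bullet> u = h + (s + \<tau>) * ?\<eta>" using eq p(1) by (simp add: inner_add_left)
        then have "(s + \<tau>) * ?\<eta> \<le> 0" using w 1 by simp
        then show ?thesis using z by (simp add: mult_le_0_iff)
      qed
      moreover have "\<pi> + s *\<^sub>R z \<in> K" using p(2) k(2) by metis
      moreover have "\<pi> + 0 *\<^sub>R z \<in> K" using p(1) by simp
      ultimately have "\<pi> + (s + \<tau>) *\<^sub>R z \<in> K"
        using k(3) segment_in_convex[OF K(2), of \<pi> s z 0 "s + \<tau>"] by simp
      then have "w \<in> K" by (simp only: eq)
      then show "w \<in> slice u K t" using w by blast
    next
      fix w assume "w \<in> slice u K t"
      then show "w \<in> slice u ?K2 t" using prismI[of w K 0 l z] l by simp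
    qed
    then show ?thesis using 1 by (simp add: sec_def)
  next
    case 2
    define s0 where "s0 = (t - h) / ?\<eta>"
    have s0: "0 \<le> s0" "s0 \<le> l" "t = h + s0 * ?\<eta>" using 2 z by (auto simp: s0_def field_simps)
    have "slice u ?K2 (h + s0 * ?\<eta>) = (+) (s0 *\<^sub>R z) ` slice u K h"
    proof (intro equalityI subsetI)
      fix w assume w: "w \<in> slice u ?K2 (h + s0 * ?\<eta>)"
      then obtain k \<tau> where k: "w = k + \<tau> *\<^sub>R z" "k \<in> K" by (auto simp: prism_def)
      obtain \<pi> s where p: "\<pi> \<in> slice u K h" "k = \<pi> + s *\<^sub>R z" using coord[OF k(2)] by blast
      have eq: "w = \<pi> + (s + \<tau>) *\<^sub>R z" using k(1) p(2) by (simp add: algebra_simps)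
      then have "(s + \<tau>) * ?\<eta> = s0 * ?\<eta>" using w p(1) by (simp add: inner_add_left)
      then have "w = s0 *\<^sub>R z + \<pi>" using eq z by simp
      then show "w \<in> (+) (s0 *\<^sub>R z) ` slice u K h" using p(1) by blast
    next
      fix w assume "w \<in> (+) (s0 *\<^sub>R z) ` slice u K h"
      then obtain \<pi> where "w = \<pi> + s0 *\<^sub>R z" "\<pi> \<in> K" "\<pi> \<bullet> u = h" by (auto simp: add.commute)
      then show "w \<in> slice u ?K2 (h + s0 * ?\<eta>)" using s0 by (auto simp: prism_def inner_add_left)
    qed
    from tr[OF this] show ?thesis using 2 s0 by simp
  next
    case 3
    have "slice u ?K2 ((t - l * ?\<eta>) + l * ?\<eta>) = (+) (l *\<^sub>R z) ` slice u K (t - l * ?\<eta>)"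
    proof (intro equalityI subsetI)
      fix w assume w: "w \<in> slice u ?K2 ((t - l * ?\<eta>) + l * ?\<eta>)"
      then obtain k \<tau> where k: "w = k + \<tau> *\<^sub>R z" "k \<in> K" "0 \<le> \<tau>" "\<tau> \<le> l" by (auto simp: prism_def)
      obtain \<pi> s where p: "\<pi> \<in> slice u K h" "k = \<pi> + s *\<^sub>R z" using coord[OF k(2)] by blast
      have eq: "w = \<pi> + (s + \<tau>) *\<^sub>R z" using k(1) p(2) by (simp add: algebra_simps)
      then have "w \<bullet> u = h + (s + \<tau>) * ?\<eta>" using p(1) by (simp add: inner_add_left)
      then have "l * ?\<eta> \<le> (s + \<tau>) * ?\<eta>" using w 3 by simp
      then have "l \<le> s + \<tau>" using z by simp
      moreover have "\<pi> + s *\<^sub>R z \<in> K" using p(2) k(2) by metis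
      moreover have "\<pi> + 0 *\<^sub>R z \<in> K" using p(1) by simp
      ultimately have "\<pi> + (s + \<tau> - l) *\<^sub>R z \<in> K"
        using k(4) segment_in_convex[OF K(2), of \<pi> 0 z s "s + \<tau> - l"] by simp
      moreover have "w = l *\<^sub>R z + (\<pi> + (s + \<tau> - l) *\<^sub>R z)" using eq by (simp add: algebra_simps)
      moreover have "(\<pi> + (s + \<tau> - l) *\<^sub>R z) \<bullet> u = t - l * ?\<eta>"
        using w calculation(2) by (simp add: inner_add_left algebra_simps)
      ultimately show "w \<in> (+) (l *\<^sub>R z) ` slice u K (t - l * ?\<eta>)" by blast
    next
      fix w assume "w \<in> (+) (l *\<^sub>R z) ` slice u K (t - l * ?\<eta>)"
      then obtain k where "w = k + l *\<^sub>R z" "k \<in> K" "k \<bullet> u = t - l * ?\<eta>" by (auto simp: add.commute)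
      then show "w \<in> slice u ?K2 ((t - l * ?\<eta>) + l * ?\<eta>)" using l by (auto simp: prism_def inner_add_left)
    qed
    from tr[OF this] show ?thesis using 3 l z by (auto simp: not_le) (smt (verit) mult_nonneg_nonneg)
  qed
qed

text \<open>Along \<open>z\<close>, every section is moved into the one at level \<open>h\<close>.\<close>
lemma prism_cylinder_max_section:
  fixes K :: "'a::euclidean_space set"
  assumes u: "norm u = 1" and K: "compact K" and z: "z \<bullet> u \<noteq> 0"
    and cyl: "\<And>k. k \<in> K \<Longrightarrow> \<exists>s. k + s *\<^sub>R z \<in> slice u K h"
  shows "sec u K t \<le> sec u K h"
proof -
  define s where "s = (t - h) / (z \<bullet> u)"
  have s: "t = (s *\<^sub>R z) \<bullet> u + h" using z by (simp add: s_def)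
  have "slice u K t \<subseteq> slice u ((+) (s *\<^sub>R z) ` K) t"
  proof
    fix k assume k: "k \<in> slice u K t"
    then obtain s' where s': "k + s' *\<^sub>R z \<in> slice u K h" using cyl by blast
    then have "t + s' * (z \<bullet> u) = h" using k by (simp add: inner_add_left)
    then have "s' = - s" using z by (simp add: s_def field_simps)
    then show "k \<in> slice u ((+) (s *\<^sub>R z) ` K) t" using s' k by (auto simp: mem_translation_iff)
  qed
  then have "sec u K t \<le> sec u ((+) (s *\<^sub>R z) ` K) t"
    using K by (intro sec_mono) (auto intro: compact_translation)
  also have "\<dots> = sec u K h" unfolding s by (rule sec_translation)
  finally show ?thesis .
qed

lemma vol_prism_cylinder:
  fixes K :: "'a::euclidean_space set"
  assumes u: "norm u = 1" and K: "compact K" "convex K" and z: "0 < z \<bullet> u" and l: "0 \<le> l"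
    and cyl: "\<And>k. k \<in> K \<Longrightarrow> \<exists>s. k + s *\<^sub>R z \<in> slice u K h"
  shows "vol (prism z l K) = vol K + l * (z \<bullet> u) * sec u K h"
proof -
  let ?e = "l * (z \<bullet> u)"
  have e: "0 \<le> ?e" using l z by simp
  note [measurable] = fubini_sections(1)[OF u K(1)]
  have c2: "compact (prism z l K)" using K(1) by (rule compact_prism)
  have "ennreal (vol (prism z l K)) = (\<integral>\<^sup>+t. ennreal (sec u (prism z l K) t) \<partial>lborel)"
    using fubini_sections(2)[OF u c2] by simp
  also have "\<dots> = (\<integral>\<^sup>+t. indicator {..<h} t * ennreal (sec u K t) + ennreal (sec u K h) * indicator {h..h + ?e} t
      + indicator {h + ?e<..} t * ennreal (sec u K (t - ?e)) \<partial>lborel)"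
  proof (rule nn_integral_cong)
    fix t
    have sc: "sec u (prism z l K) t = (if t < h then sec u K t else if t \<le> h + ?e then sec u K h else sec u K (t - ?e))"
      by (intro prism_cylinder_sec u K z l cyl)
    show "ennreal (sec u (prism z l K) t) = indicator {..<h} t * ennreal (sec u K t) + ennreal (sec u K h) * indicator {h..h + ?e} t
      + indicator {h + ?e<..} t * ennreal (sec u K (t - ?e))"
      unfolding sc using e by (auto split: split_indicator)
  qed
  also have "\<dots> = (\<integral>\<^sup>+t. indicator {..<h} t * ennreal (sec u K t) \<partial>lborel) + ennreal (sec u K h) * ennreal ?e
      + (\<integral>\<^sup>+t. indicator {h + ?e<..} t * ennreal (sec u K (t - ?e)) \<partial>lborel)"
    using e by (simp add: nn_integral_add nn_integral_cmult)
  also have "(\<integral>\<^sup>+t. indicator {h + ?e<..} t * ennreal (sec u K (t - ?e)) \<partial>lborel)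
      = ennreal \<bar>1\<bar> * (\<integral>\<^sup>+t. indicator {h + ?e<..} (?e + 1 * t) * ennreal (sec u K (?e + 1 * t - ?e)) \<partial>lborel)"
    by (rule nn_integral_real_affine) auto
  also have "\<dots> = (\<integral>\<^sup>+t. indicator {h<..} t * ennreal (sec u K t) \<partial>lborel)"
    by (simp, intro nn_integral_cong) (auto split: split_indicator)
  also have "(\<integral>\<^sup>+t. indicator {..<h} t * ennreal (sec u K t) \<partial>lborel) + ennreal (sec u K h) * ennreal ?e
      + (\<integral>\<^sup>+t. indicator {h<..} t * ennreal (sec u K t) \<partial>lborel)
    = ennreal (sec u K h) * ennreal ?e + (\<integral>\<^sup>+t. indicator {..<h} t * ennreal (sec u K t) + indicator {h<..} t * ennreal (sec u K t) \<partial>lborel)"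
    by (simp add: nn_integral_add add_ac)
  also have "(\<integral>\<^sup>+t. indicator {..<h} t * ennreal (sec u K t) + indicator {h<..} t * ennreal (sec u K t) \<partial>lborel)
     = (\<integral>\<^sup>+t. ennreal (sec u K t) \<partial>lborel)"
    using AE_lborel_singleton[of h]
    by (intro nn_integral_cong_AE, eventually_elim) (auto split: split_indicator)
  also have "\<dots> = ennreal (vol K)" by (rule fubini_sections(2)[OF u K(1)])
  finally have "ennreal (vol (prism z l K)) = ennreal (sec u K h * ?e + vol K)"
    using e by (simp add: ennreal_mult sec_nonneg)
  moreover have "0 \<le> sec u K h * ?e + vol K" using e sec_nonneg[of u K h] by simp
  ultimately have "vol (prism z l K) = sec u K h * ?e + vol K" using ennreal_inj measure_nonneg by metis
  then show ?thesis by (simp add: mult_ac)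
qed

text \<open>Translates of \<open>c K + [0, l z]\<close> form a family closed under Minkowski combinations, on which the volume
  and the maximal section are explicit polynomials; substituting them gives the equality.\<close>
lemma equality_for_stretched:
  fixes K :: "'a::euclidean_space set"
  assumes dim: "DIM('a) \<ge> 2" and u: "norm u = 1" and par: "\<And>H. affine_parallel L H \<longleftrightarrow> (\<exists>t. H = {x. x \<bullet> u = t})"
    and K: "convex_body K" and ab: "\<alpha> > 0" "\<beta> > 0" and c: "c1 > 0" "c2 > 0" and l: "0 \<le> l1" "0 \<le> l2"
    and cyl: "l1 = 0 \<and> l2 = 0 \<or> 0 < z \<bullet> u \<and> (\<forall>k\<in>K. \<exists>s. k + s *\<^sub>R z \<in> slice u K h)"
    and A: "A = (+) w1 ` prism z l1 ((*\<^sub>R) c1 ` K)" and B: "B = (+) w2 ` prism z l2 ((*\<^sub>R) c2 ` K)"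
    and M: "M = max_section L A" and N: "N = max_section L B"
  shows "vol ((*\<^sub>R) \<alpha> ` A + (*\<^sub>R) \<beta> ` B) =
    (\<alpha> * M powr (1 / real (DIM('a) - 1)) + \<beta> * N powr (1 / real (DIM('a) - 1))) ^ (DIM('a) - 1) *
    (\<alpha> * (vol A / M) + \<beta> * (vol B / N))"
proof -
  let ?n = "DIM('a) - 1"
  have n: "0 < ?n" using dim by simp
  have d: "x ^ DIM('a) = x * x ^ ?n" for x :: real
    by (metis DIM_positive Suc_diff_1 power_Suc)
  have Kc: "compact K" "convex K" using K by (auto simp: convex_body_def)
  obtain m e where m: "m > 0"
    and V: "\<And>c l. c > 0 \<Longrightarrow> 0 \<le> l \<Longrightarrow> (l1 = 0 \<and> l2 = 0 \<longrightarrow> l = 0) \<Longrightarrow>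
        vol (prism z l ((*\<^sub>R) c ` K)) = c * c ^ ?n * vol K + l * c ^ ?n * e"
    and S: "\<And>c l w. c > 0 \<Longrightarrow> 0 \<le> l \<Longrightarrow> (l1 = 0 \<and> l2 = 0 \<longrightarrow> l = 0) \<Longrightarrow>
        max_section L ((+) w ` prism z l ((*\<^sub>R) c ` K)) = c ^ ?n * m"
  proof -
    obtain t0 where t0: "0 < sec u K t0" "\<And>t. sec u K t \<le> sec u K t0" using sec_max_attained[OF u K] by blast
    have mx: "max_section L ((+) w ` prism z l ((*\<^sub>R) c ` K)) = c ^ ?n * sec u K t0"
      if c: "c > 0" and s: "\<exists>t. sec u (prism z l ((*\<^sub>R) c ` K)) t = c ^ ?n * sec u K t0"
        "\<And>t. \<exists>t'. sec u (prism z l ((*\<^sub>R) c ` K)) t \<le> sec u ((*\<^sub>R) c ` K) t'" for c l w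
    proof -
      have cK: "sec u ((*\<^sub>R) c ` K) t \<le> c ^ ?n * sec u K t0" for t
        using sec_scale[OF u Kc(1) c, of "t / c"] t0(2)[of "t / c"] c by simp
      obtain t where t: "sec u (prism z l ((*\<^sub>R) c ` K)) t = c ^ ?n * sec u K t0" using s(1) by blast
      show ?thesis
      proof (rule max_section_eqI[OF u par])
        show "compact ((+) w ` prism z l ((*\<^sub>R) c ` K))"
          using Kc by (intro compact_translation compact_prism compact_scaling)
        show "sec u ((+) w ` prism z l ((*\<^sub>R) c ` K)) (w \<bullet> u + t) = c ^ ?n * sec u K t0"
          unfolding sec_translation by (rule t)
        fix t
        have "sec u ((+) w ` prism z l ((*\<^sub>R) c ` K)) t = sec u (prism z l ((*\<^sub>R) c ` K)) (t - w \<bullet> u)"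
          using sec_translation[of u w "prism z l ((*\<^sub>R) c ` K)" "t - w \<bullet> u"] by simp
        then show "sec u ((+) w ` prism z l ((*\<^sub>R) c ` K)) t \<le> c ^ ?n * sec u K t0"
          using s(2)[of "t - w \<bullet> u"] cK by (metis order_trans)
      qed
    qed
    show ?thesis
    proof (cases "l1 = 0 \<and> l2 = 0")
      case True
      have p0: "prism z 0 S = S" for S :: "'a set" by (force simp: prism_eq)
      show ?thesis
      proof (rule that[OF t0(1), of 0])
        fix c l :: real and w :: 'a assume cl: "c > 0" "l1 = 0 \<and> l2 = 0 \<longrightarrow> l = (0::real)"
        then have "l = 0" using True by simp
        then show "vol (prism z l ((*\<^sub>R) c ` K)) = c * c ^ ?n * vol K + l * c ^ ?n * 0"
          using cl by (simp add: p0 vol_scale d)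
        show "max_section L ((+) w ` prism z l ((*\<^sub>R) c ` K)) = c ^ ?n * sec u K t0"
          using sec_scale[OF u Kc(1) cl(1), of t0] \<open>l = 0\<close> by (intro mx cl(1)) (auto simp: p0)
      qed
    next
      case False
      then have z: "0 < z \<bullet> u" and cy: "\<And>k. k \<in> K \<Longrightarrow> \<exists>s. k + s *\<^sub>R z \<in> slice u K h" using cyl by auto
      have h: "sec u K h = sec u K t0"
        using prism_cylinder_max_section[OF u Kc(1), of z h t0] z cy t0(2)[of h] by (auto intro: antisym)
      have cyc: "\<exists>s. k + s *\<^sub>R z \<in> slice u ((*\<^sub>R) c ` K) (c * h)" if "c > 0" and k: "k \<in> (*\<^sub>R) c ` K" for c k
      proof -
        obtain k' where k': "k = c *\<^sub>R k'" "k' \<in> K" using k by blast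
        obtain s where s: "k' + s *\<^sub>R z \<in> slice u K h" using cy[OF k'(2)] by blast
        then have "c *\<^sub>R (k' + s *\<^sub>R z) \<in> slice u ((*\<^sub>R) c ` K) (c * h)" by auto
        moreover have "c *\<^sub>R (k' + s *\<^sub>R z) = k + (c * s) *\<^sub>R z" by (simp add: k' algebra_simps)
        ultimately show ?thesis by metis
      qed
      have cc: "compact ((*\<^sub>R) c ` K)" "convex ((*\<^sub>R) c ` K)" for c
        using Kc by (auto intro: compact_scaling convex_scaling)
      show ?thesis
      proof (rule that[OF t0(1), of "(z \<bullet> u) * sec u K h"])
        fix c l :: real and w :: 'a assume cl: "c > 0" "0 \<le> l"
        have vp: "vol (prism z l ((*\<^sub>R) c ` K)) = vol ((*\<^sub>R) c ` K) + l * (z \<bullet> u) * sec u ((*\<^sub>R) c ` K) (c * h)"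
          using cl by (intro vol_prism_cylinder u cc z cyc)
        show "vol (prism z l ((*\<^sub>R) c ` K)) = c * c ^ ?n * vol K + l * c ^ ?n * ((z \<bullet> u) * sec u K h)"
          unfolding vp sec_scale[OF u Kc(1) cl(1)] vol_scale using cl by (simp add: d)
        have sc: "sec u (prism z l ((*\<^sub>R) c ` K)) t = (if t < c * h then sec u ((*\<^sub>R) c ` K) t
          else if t \<le> c * h + l * (z \<bullet> u) then sec u ((*\<^sub>R) c ` K) (c * h) else sec u ((*\<^sub>R) c ` K) (t - l * (z \<bullet> u)))" for t
          using cl by (intro prism_cylinder_sec u cc z cyc)
        show "max_section L ((+) w ` prism z l ((*\<^sub>R) c ` K)) = c ^ ?n * sec u K t0"
        proof (rule mx[OF cl(1)])
          have "sec u (prism z l ((*\<^sub>R) c ` K)) (c * h) = c ^ ?n * sec u K t0"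
            unfolding sc using cl z sec_scale[OF u Kc(1) cl(1), of h] h by simp
          then show "\<exists>t. sec u (prism z l ((*\<^sub>R) c ` K)) t = c ^ ?n * sec u K t0" by blast
          show "\<exists>t'. sec u (prism z l ((*\<^sub>R) c ` K)) t \<le> sec u ((*\<^sub>R) c ` K) t'" for t
            unfolding sc by (auto intro: order_refl)
        qed
      qed
    qed
  qed
  define c where "c = \<alpha> * c1 + \<beta> * c2"
  define l where "l = \<alpha> * l1 + \<beta> * l2"
  have cl: "0 < c" "0 \<le> l" "l1 = 0 \<and> l2 = 0 \<longrightarrow> l = 0"
    using ab c \<open>0 \<le> l1\<close> \<open>0 \<le> l2\<close> by (auto simp: c_def l_def add_pos_pos)
  have sum: "(*\<^sub>R) \<alpha> ` A + (*\<^sub>R) \<beta> ` B = (+) (\<alpha> *\<^sub>R w1 + \<beta> *\<^sub>R w2) ` prism z l ((*\<^sub>R) c ` K)"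
  proof (intro equalityI subsetI)
    fix x assume "x \<in> (*\<^sub>R) \<alpha> ` A + (*\<^sub>R) \<beta> ` B"
    then obtain k \<tau> k' \<tau>' where k: "k \<in> K" "0 \<le> \<tau>" "\<tau> \<le> l1" and k': "k' \<in> K" "0 \<le> \<tau>'" "\<tau>' \<le> l2"
      and x: "x = \<alpha> *\<^sub>R (w1 + (c1 *\<^sub>R k + \<tau> *\<^sub>R z)) + \<beta> *\<^sub>R (w2 + (c2 *\<^sub>R k' + \<tau>' *\<^sub>R z))"
      unfolding A B by (auto simp: prism_def set_plus_def)
    have "(\<alpha> * c1 / c) *\<^sub>R k + (\<beta> * c2 / c) *\<^sub>R k' \<in> K" (is "?k \<in> K")
    proof (rule convexD[OF Kc(2) k(1) k'(1)])
      show "\<alpha> * c1 / c + \<beta> * c2 / c = 1"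
        unfolding add_divide_distrib[symmetric] c_def[symmetric] using cl(1) by simp
    qed (use ab c cl(1) in simp_all)
    moreover have "c *\<^sub>R ?k = (\<alpha> * c1) *\<^sub>R k + (\<beta> * c2) *\<^sub>R k'" using cl(1) by (simp add: scaleR_add_right)
    then have "x = (\<alpha> *\<^sub>R w1 + \<beta> *\<^sub>R w2) + (c *\<^sub>R ?k + (\<alpha> * \<tau> + \<beta> * \<tau>') *\<^sub>R z)"
      unfolding x by (simp add: algebra_simps)
    moreover have "0 \<le> \<alpha> * \<tau> + \<beta> * \<tau>'" "\<alpha> * \<tau> + \<beta> * \<tau>' \<le> l"
      unfolding l_def using ab k k' by (auto intro!: add_mono mult_left_mono)
    ultimately show "x \<in> (+) (\<alpha> *\<^sub>R w1 + \<beta> *\<^sub>R w2) ` prism z l ((*\<^sub>R) c ` K)"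
      unfolding prism_def by blast
  next
    fix x assume "x \<in> (+) (\<alpha> *\<^sub>R w1 + \<beta> *\<^sub>R w2) ` prism z l ((*\<^sub>R) c ` K)"
    then obtain k \<tau> where k: "k \<in> K" "0 \<le> \<tau>" "\<tau> \<le> l" and x: "x = (\<alpha> *\<^sub>R w1 + \<beta> *\<^sub>R w2) + (c *\<^sub>R k + \<tau> *\<^sub>R z)"
      by (auto simp: prism_def)
    define \<theta> where "\<theta> = (if l = 0 then 0 else \<tau> / l)"
    have th: "0 \<le> \<theta>" "\<theta> \<le> 1" "\<theta> * l = \<tau>" using k cl(2) by (auto simp: \<theta>_def)
    have "w1 + (c1 *\<^sub>R k + (\<theta> * l1) *\<^sub>R z) \<in> A" "w2 + (c2 *\<^sub>R k + (\<theta> * l2) *\<^sub>R z) \<in> B"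
      unfolding A B using k(1) th \<open>0 \<le> l1\<close> \<open>0 \<le> l2\<close>
      by (auto intro!: imageI prismI mult_left_le_one_le)
    moreover have "x = \<alpha> *\<^sub>R (w1 + (c1 *\<^sub>R k + (\<theta> * l1) *\<^sub>R z)) + \<beta> *\<^sub>R (w2 + (c2 *\<^sub>R k + (\<theta> * l2) *\<^sub>R z))"
      unfolding x th(3)[symmetric] c_def l_def by (simp add: algebra_simps)
    ultimately show "x \<in> (*\<^sub>R) \<alpha> ` A + (*\<^sub>R) \<beta> ` B" by blast
  qed
  have M': "M = c1 ^ ?n * m" and N': "N = c2 ^ ?n * m"
    unfolding M N A B by (rule S; use c \<open>0 \<le> l1\<close> \<open>0 \<le> l2\<close> in simp)+
  have VA: "vol A = c1 * c1 ^ ?n * vol K + l1 * c1 ^ ?n * e" and VB: "vol B = c2 * c2 ^ ?n * vol K + l2 * c2 ^ ?n * e"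
    unfolding A B measure_translation by (rule V; use c \<open>0 \<le> l1\<close> \<open>0 \<le> l2\<close> in simp)+
  define r where "r = m powr (1 / real ?n)"
  have r: "r ^ ?n = m" using m n by (simp add: r_def powr_realpow[symmetric] powr_powr)
  have pw: "(x ^ ?n * m) powr (1 / real ?n) = x * r" if "x > 0" for x
    using that m n by (simp add: r_def powr_mult powr_realpow[symmetric] powr_powr)
  have q1: "vol A / M = (c1 * vol K + l1 * e) / m" "vol B / N = (c2 * vol K + l2 * e) / m"
    unfolding VA VB M' N' using c m by (simp_all add: field_simps)
  have "\<alpha> * M powr (1 / real ?n) + \<beta> * N powr (1 / real ?n) = c * r"
    unfolding M' N' pw[OF c(1)] pw[OF c(2)] c_def by (simp add: algebra_simps)
  then have "(\<alpha> * M powr (1 / real ?n) + \<beta> * N powr (1 / real ?n)) ^ ?n * (\<alpha> * (vol A / M) + \<beta> * (vol B / N))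
    = c ^ ?n * m * (\<alpha> * ((c1 * vol K + l1 * e) / m) + \<beta> * ((c2 * vol K + l2 * e) / m))"
    unfolding q1 by (simp only: power_mult_distrib r)
  also have "\<dots> = c ^ ?n * (\<alpha> * (c1 * vol K + l1 * e) + \<beta> * (c2 * vol K + l2 * e))"
    using m by (simp add: field_simps)
  also have "\<dots> = c * c ^ ?n * vol K + l * c ^ ?n * e"
  proof -
    have "\<alpha> * (c1 * vol K + l1 * e) + \<beta> * (c2 * vol K + l2 * e) = c * vol K + l * e"
      by (simp add: c_def l_def algebra_simps)
    then show ?thesis by (simp add: algebra_simps)
  qed
  also have "\<dots> = vol ((*\<^sub>R) \<alpha> ` A + (*\<^sub>R) \<beta> ` B)"
    unfolding sum measure_translation using V[OF cl] by simp
  finally show ?thesis by simp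
qed

lemma stretching_iff: "stretching v C K \<longleftrightarrow> (\<exists>l\<ge>0. \<exists>w. K = (+) w ` prism v l C)"
proof -
  have "C + closed_segment w (w + l *\<^sub>R v) = (+) w ` prism v l C" if l: "0 \<le> l" for l w
  proof (intro equalityI subsetI)
    fix x assume "x \<in> C + closed_segment w (w + l *\<^sub>R v)"
    then obtain c s where "c \<in> C" "0 \<le> s" "s \<le> 1" "x = c + ((1 - s) *\<^sub>R w + s *\<^sub>R (w + l *\<^sub>R v))"
      by (auto simp: set_plus_def closed_segment_def)
    moreover from this have "s * l \<le> l" using l by (intro mult_left_le_one_le)
    ultimately have "x = w + (c + (s * l) *\<^sub>R v)" "c \<in> C" "0 \<le> s * l" "s * l \<le> l"
      using l by (auto simp: algebra_simps)
    then show "x \<in> (+) w ` prism v l C" unfolding prism_def by blast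
  next
    fix x assume "x \<in> (+) w ` prism v l C"
    then obtain c \<tau> where c: "c \<in> C" "0 \<le> \<tau>" "\<tau> \<le> l" "x = w + (c + \<tau> *\<^sub>R v)" by (auto simp: prism_def)
    define s where "s = (if l = 0 then 0 else \<tau> / l)"
    have s: "0 \<le> s" "s \<le> 1" "s * l = \<tau>" using c l by (auto simp: s_def)
    have "(1 - s) *\<^sub>R w + s *\<^sub>R (w + l *\<^sub>R v) = w + \<tau> *\<^sub>R v" unfolding s(3)[symmetric] by (simp add: algebra_simps)
    then have "w + \<tau> *\<^sub>R v \<in> closed_segment w (w + l *\<^sub>R v)" using s unfolding closed_segment_def by force
    moreover have "x = c + (w + \<tau> *\<^sub>R v)" using c by simp
    ultimately show "x \<in> C + closed_segment w (w + l *\<^sub>R v)" using c(1) by blast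
  qed
  then show ?thesis unfolding stretching_def by metis
qed

lemma proj_perp_image_section_iff:
  assumes v: "norm v = 1"
  shows "proj_perp v ` K = proj_perp v ` (K \<inter> H) \<longleftrightarrow> (\<forall>k\<in>K. \<exists>s. k + s *\<^sub>R v \<in> K \<inter> H)"
proof
  assume eq: "proj_perp v ` K = proj_perp v ` (K \<inter> H)"
  show "\<forall>k\<in>K. \<exists>s. k + s *\<^sub>R v \<in> K \<inter> H"
  proof
    fix k assume "k \<in> K"
    then obtain y where y: "y \<in> K \<inter> H" "proj_perp v k = proj_perp v y" using eq by blast
    then have "k + (y \<bullet> v - k \<bullet> v) *\<^sub>R v = y" by (simp add: proj_perp_def algebra_simps)
    then show "\<exists>s. k + s *\<^sub>R v \<in> K \<inter> H" using y(1) by metis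
  qed
next
  assume *: "\<forall>k\<in>K. \<exists>s. k + s *\<^sub>R v \<in> K \<inter> H"
  have pp: "proj_perp v (k + s *\<^sub>R v) = proj_perp v k" for k s
    using inner_unit[OF v] by (simp add: proj_perp_def inner_add_left algebra_simps)
  have "proj_perp v k \<in> proj_perp v ` (K \<inter> H)" if "k \<in> K" for k
    using * that pp by (metis imageI)
  then show "proj_perp v ` K = proj_perp v ` (K \<inter> H)" by auto
qed

section \<open>The equality case\<close>

lemma convex_body_scale:
  assumes "convex_body K" "c > 0" shows "convex_body ((*\<^sub>R) c ` K)"
  using assms vol_convex_body_pos[OF assms(1)]
  by (intro convex_body_if_vol_pos) (auto simp: convex_body_def vol_scale intro: compact_scaling convex_scaling)

lemma scale_image_image: "(*\<^sub>R) c ` (*\<^sub>R) c' ` S = (*\<^sub>R) (c * c') ` S" for S :: "'a::real_vector set"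
  by (simp add: image_image)

lemma scale_set_plus: "(*\<^sub>R) c ` (S + T) = (*\<^sub>R) c ` S + (*\<^sub>R) c ` T" for S :: "'a::real_vector set"
  unfolding set_plus_image image_image by (force simp: scaleR_add_right)

text \<open>Undoing the normalisation: the body that is stretched in the normalised situation is, up to scaling, a common core of
  both bodies, so it serves for \<open>A'\<close> and, scaled, for \<open>B'\<close>. The section condition is given for both of
  them, so that their roles can be exchanged.\<close>
lemma stretched_if_normalised:
  fixes A B :: "'a::euclidean_space set"
  assumes u: "norm u = 1" and par: "\<And>H. affine_parallel L H \<longleftrightarrow> (\<exists>t. H = {x. x \<bullet> u = t})"
    and A: "convex_body A" and mu: "\<mu> > 0" "\<nu> > 0"
    and A1: "A1 = (*\<^sub>R) (1 / \<mu>) ` A" and B1: "B1 = (*\<^sub>R) (1 / \<nu>) ` B"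
    and st: "(\<exists>x. A1 = (+) x ` B1) \<or>
      (\<exists>z w l c. z \<noteq> 0 \<and> 0 \<le> l \<and> B1 = {a + w + \<tau> *\<^sub>R z |a \<tau>. a \<in> A1 \<and> 0 \<le> \<tau> \<and> \<tau> \<le> l} \<and>
       (\<forall>a\<in>A1. \<exists>s. a + s *\<^sub>R z \<in> slice u A1 c))"
  shows "homothetic A B \<or> (\<exists>v\<in>sphere 0 1. \<exists>A' B' H H'.
    convex_body A' \<and> convex_body B' \<and> homothetic A' B' \<and> affine_parallel L H \<and> affine_parallel L H' \<and>
    proj_perp v ` A' = proj_perp v ` (A' \<inter> H) \<and> proj_perp v ` B' = proj_perp v ` (B' \<inter> H') \<and>
    stretching v A' A \<and> stretching v B' B)"
proof -
  have AA: "A = (*\<^sub>R) \<mu> ` A1" and BB: "B = (*\<^sub>R) \<nu> ` B1"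
    using mu by (simp_all add: A1 B1 scale_image_image)
  from st show ?thesis
  proof (elim disjE exE conjE)
    fix x assume x: "A1 = (+) x ` B1"
    have "A = (\<lambda>y. \<mu> *\<^sub>R x + (\<mu> / \<nu>) *\<^sub>R y) ` B"
      unfolding AA BB x using mu by (simp add: image_image scaleR_add_right)
    then show ?thesis using mu unfolding homothetic_def by (metis divide_pos_pos)
  next
    fix z w l c
    assume z: "z \<noteq> 0" and l: "0 \<le> l" and B1': "B1 = {a + w + \<tau> *\<^sub>R z |a \<tau>. a \<in> A1 \<and> 0 \<le> \<tau> \<and> \<tau> \<le> l}"
      and cyl: "\<forall>a\<in>A1. \<exists>s. a + s *\<^sub>R z \<in> slice u A1 c"
    define v where "v = z /\<^sub>R norm z"
    have v: "norm v = 1" "z = norm z *\<^sub>R v" using z by (simp_all add: v_def)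
    have proj: "proj_perp v ` ((*\<^sub>R) r ` A1) = proj_perp v ` ((*\<^sub>R) r ` A1 \<inter> {x. x \<bullet> u = r * c})" if "r > 0" for r
      unfolding proj_perp_image_section_iff[OF v(1)]
    proof
      fix k assume "k \<in> (*\<^sub>R) r ` A1"
      then obtain a where a: "a \<in> A1" "k = r *\<^sub>R a" by blast
      obtain s where s: "a + s *\<^sub>R z \<in> slice u A1 c" using cyl a by blast
      have "k + (r * s * norm z) *\<^sub>R v = r *\<^sub>R (a + s *\<^sub>R (norm z *\<^sub>R v))" unfolding a by (simp add: algebra_simps)
      also have "\<dots> = r *\<^sub>R (a + s *\<^sub>R z)" using v(2) by simp
      also have "\<dots> \<in> (*\<^sub>R) r ` A1 \<inter> {x. x \<bullet> u = r * c}" using s by auto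
      finally show "\<exists>s. k + s *\<^sub>R v \<in> (*\<^sub>R) r ` A1 \<inter> {x. x \<bullet> u = r * c}" by blast
    qed
    let ?B' = "(*\<^sub>R) \<nu> ` A1"
    have B': "?B' = (\<lambda>y. 0 + (\<nu> / \<mu>) *\<^sub>R y) ` A"
      unfolding A1 using mu by (simp add: image_image)
    have "stretching v A A"
    proof -
      have "A = (+) 0 ` prism v 0 A" by (force simp: prism_eq)
      then show ?thesis unfolding stretching_iff by (metis order_refl)
    qed
    moreover have "stretching v ?B' B"
    proof -
      have "B = (+) (\<nu> *\<^sub>R w) ` prism v (\<nu> * l * norm z) ?B'"
      proof (intro equalityI subsetI)
        fix x assume "x \<in> B"
        then obtain a \<tau> where a: "a \<in> A1" "0 \<le> \<tau>" "\<tau> \<le> l" "x = \<nu> *\<^sub>R (a + w + \<tau> *\<^sub>R z)" unfolding BB B1' by blast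
        have "x = \<nu> *\<^sub>R (a + w + \<tau> *\<^sub>R (norm z *\<^sub>R v))" using a(4) v(2) by simp
        also have "\<dots> = \<nu> *\<^sub>R w + (\<nu> *\<^sub>R a + (\<nu> * \<tau> * norm z) *\<^sub>R v)" by (simp add: algebra_simps)
        finally show "x \<in> (+) (\<nu> *\<^sub>R w) ` prism v (\<nu> * l * norm z) ?B'"
          using a mu by (auto intro!: imageI prismI mult_right_mono mult_left_mono)
      next
        fix x assume "x \<in> (+) (\<nu> *\<^sub>R w) ` prism v (\<nu> * l * norm z) ?B'"
        then obtain a \<tau> where a: "a \<in> A1" "0 \<le> \<tau>" "\<tau> \<le> \<nu> * l * norm z" "x = \<nu> *\<^sub>R w + (\<nu> *\<^sub>R a + \<tau> *\<^sub>R v)"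
          by (auto simp: prism_def)
        define \<tau>' where "\<tau>' = \<tau> / (\<nu> * norm z)"
        have t: "0 \<le> \<tau>'" "\<tau>' \<le> l" "\<tau> = \<nu> * \<tau>' * norm z" using a mu z by (auto simp: \<tau>'_def field_simps)
        have "x = \<nu> *\<^sub>R (a + w + \<tau>' *\<^sub>R (norm z *\<^sub>R v))" unfolding a(4) t(3) by (simp add: algebra_simps)
        then have "x = \<nu> *\<^sub>R (a + w + \<tau>' *\<^sub>R z)" using v(2) by simp
        then show "x \<in> B" unfolding BB B1' using a(1) t by blast
      qed
      moreover have "0 \<le> \<nu> * l * norm z" using mu l by simp
      ultimately show ?thesis unfolding stretching_iff by blast
    qed
    moreover have "homothetic A ?B'" unfolding homothetic_def B' using mu by (metis divide_pos_pos)
    moreover have "convex_body ?B'"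
      using convex_body_scale[OF A, of "\<nu> / \<mu>"] mu unfolding B' by simp
    moreover have "affine_parallel L {x. x \<bullet> u = r * c}" for r unfolding par by blast
    moreover have "v \<in> sphere 0 1" using v by simp
    ultimately show ?thesis using A proj[OF mu(1)] proj[OF mu(2)] unfolding AA[symmetric] by blast
  qed
qed

text \<open>After scaling each body so that its largest section has volume one, the equality becomes
  \<open>vol (p A + q B) = p vol A + q vol B\<close>, and the body with the wider family of maximal sections is
  the stretched one.\<close>
lemma equality_imp_stretched:
  fixes A B :: "'a::euclidean_space set"
  assumes dim: "DIM('a) \<ge> 2" and u: "norm u = 1" and par: "\<And>H. affine_parallel L H \<longleftrightarrow> (\<exists>t. H = {x. x \<bullet> u = t})"
    and A: "convex_body A" and B: "convex_body B" and ab: "\<alpha> > 0" "\<beta> > 0"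
    and M: "M = max_section L A" and N: "N = max_section L B"
    and eq: "vol ((*\<^sub>R) \<alpha> ` A + (*\<^sub>R) \<beta> ` B) =
      (\<alpha> * M powr (1 / real (DIM('a) - 1)) + \<beta> * N powr (1 / real (DIM('a) - 1))) ^ (DIM('a) - 1) *
      (\<alpha> * (vol A / M) + \<beta> * (vol B / N))"
  shows "homothetic A B \<or> (\<exists>v\<in>sphere 0 1. \<exists>A' B' H.
    convex_body A' \<and> convex_body B' \<and> homothetic A' B' \<and> affine_parallel L H \<and>
    proj_perp v ` A' = proj_perp v ` (A' \<inter> H) \<and> stretching v A' A \<and> stretching v B' B)"
proof -
  let ?n = "DIM('a) - 1"
  have n: "0 < ?n" using dim by simp
  have d: "x ^ DIM('a) = x * x ^ ?n" for x :: real
    by (metis DIM_positive Suc_diff_1 power_Suc)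
  have cA: "compact A" and cB: "compact B" using A B by (auto simp: convex_body_def)
  \<comment> \<open>The scaling factor is the reciprocal of the \<open>n\<close>-th root of the largest section volume.\<close>
  have norml: "\<exists>c. c > 0 \<and> c ^ ?n = m \<and> m powr (1 / real ?n) = c \<and> (\<forall>t. sec u ((*\<^sub>R) (1 / c) ` K) t \<le> 1) \<and>
      (\<exists>t. 1 \<le> sec u ((*\<^sub>R) (1 / c) ` K) t) \<and> vol ((*\<^sub>R) (1 / c) ` K) = vol K / (c * m)"
    if K: "convex_body K" and m: "m = max_section L K" for K m
  proof -
    have Kc: "compact K" using K by (simp add: convex_body_def)
    obtain t0 where t0: "0 < sec u K t0" "\<And>t. sec u K t \<le> sec u K t0" using sec_max_attained[OF u K] by blast
    have ms: "m = sec u K t0" unfolding m by (rule max_section_eqI[OF u par Kc refl t0(2)])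
    define c where "c = m powr (1 / real ?n)"
    have c: "c > 0" "c ^ ?n = m" using t0(1) n ms by (simp_all add: c_def powr_realpow[symmetric] powr_powr)
    have sc: "sec u ((*\<^sub>R) (1 / c) ` K) t = sec u K (c * t) / m" for t
    proof -
      have "(1 / c) * (c * t) = t" "(1 / c) ^ ?n = 1 / m" using c by (simp_all add: power_one_over)
      then show ?thesis using sec_scale[OF u Kc, of "1 / c" "c * t"] c(1) by (simp only: zero_less_divide_1_iff) simp
    qed
    have f1: "sec u ((*\<^sub>R) (1 / c) ` K) t \<le> 1" for t unfolding sc using t0 ms by simp
    have "1 \<le> sec u ((*\<^sub>R) (1 / c) ` K) (t0 / c)" unfolding sc using t0 ms c by simp
    then have f2: "\<exists>t. 1 \<le> sec u ((*\<^sub>R) (1 / c) ` K) t" ..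
    have f3: "vol ((*\<^sub>R) (1 / c) ` K) = vol K / (c * m)"
    proof -
      have "\<bar>1 / c\<bar> = 1 / c" "(1 / c) ^ ?n = 1 / m" using c by (simp_all add: power_one_over)
      then show ?thesis by (simp only: vol_scale d) simp
    qed
    show ?thesis by (rule exI[of _ c]) (intro conjI allI f1 f2 f3 c c_def[symmetric])
  qed
  obtain \<mu> where mu: "\<mu> > 0" "\<mu> ^ ?n = M" "M powr (1 / real ?n) = \<mu>" and A1: "\<And>t. sec u ((*\<^sub>R) (1 / \<mu>) ` A) t \<le> 1"
    "\<exists>t. 1 \<le> sec u ((*\<^sub>R) (1 / \<mu>) ` A) t" "vol ((*\<^sub>R) (1 / \<mu>) ` A) = vol A / (\<mu> * M)"
    using norml[OF A M] by blast
  obtain \<nu> where nu: "\<nu> > 0" "\<nu> ^ ?n = N" "N powr (1 / real ?n) = \<nu>" and B1: "\<And>t. sec u ((*\<^sub>R) (1 / \<nu>) ` B) t \<le> 1"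
    "\<exists>t. 1 \<le> sec u ((*\<^sub>R) (1 / \<nu>) ` B) t" "vol ((*\<^sub>R) (1 / \<nu>) ` B) = vol B / (\<nu> * N)"
    using norml[OF B N] by blast
  let ?A = "(*\<^sub>R) (1 / \<mu>) ` A" and ?B = "(*\<^sub>R) (1 / \<nu>) ` B"
  define s where "s = \<alpha> * \<mu> + \<beta> * \<nu>"
  have s: "s > 0" using ab mu nu by (simp add: s_def add_pos_pos)
  define p q where "p = \<alpha> * \<mu> / s" and "q = \<beta> * \<nu> / s"
  have pq: "p > 0" "q > 0" "p + q = 1" using ab mu nu s by (simp_all add: p_def q_def flip: add_divide_distrib) (simp add: s_def)
  have MN: "M > 0" "N > 0" using mu nu by auto
  have comb: "mcomb p ?A q ?B = (*\<^sub>R) (1 / s) ` ((*\<^sub>R) \<alpha> ` A + (*\<^sub>R) \<beta> ` B)"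
  proof -
    have "mcomb p ?A q ?B = (*\<^sub>R) (\<alpha> / s) ` A + (*\<^sub>R) (\<beta> / s) ` B"
      unfolding mcomb_eq scale_image_image using mu nu by (simp add: p_def q_def)
    also have "\<dots> = (*\<^sub>R) (1 / s) ` ((*\<^sub>R) \<alpha> ` A + (*\<^sub>R) \<beta> ` B)"
      unfolding scale_set_plus scale_image_image by simp
    finally show ?thesis .
  qed
  have "vol (mcomb p ?A q ?B) = (1 / s) ^ DIM('a) * (s ^ ?n * (\<alpha> * (vol A / M) + \<beta> * (vol B / N)))"
    unfolding comb vol_scale eq mu(3) nu(3) s_def[symmetric] using s by simp
  also have "\<dots> = (\<alpha> * (vol A / M) + \<beta> * (vol B / N)) / s"
    unfolding d using s by (simp add: power_one_over)
  also have "\<dots> = p * vol ?A + q * vol ?B"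
    unfolding A1(3) B1(3) p_def q_def using mu nu s MN by (simp add: add_divide_distrib mult.commute)
  finally have veq: "vol (mcomb p ?A q ?B) = p * vol ?A + q * vol ?B" .
  interpret bb: bonnesen_bodies u ?A ?B p q
    using u dim convex_body_scale[OF A, of "1 / \<mu>"] convex_body_scale[OF B, of "1 / \<nu>"] mu(1) nu(1) pq A1(1,2) B1(1,2) veq
    by unfold_locales auto
  interpret bs: bonnesen_bodies u ?B ?A q p by (rule bb.swapped)
  have hsym: "homothetic X Y \<Longrightarrow> homothetic Y X" for X Y :: "'a set"
    unfolding homothetic_def by blast
  show ?thesis
  proof (cases "- ltop (- u) ?A - ltop u ?A \<le> - ltop (- u) ?B - ltop u ?B")
    case True
    from stretched_if_normalised[OF u par A mu(1) nu(1) refl refl bb.equality_structure[OF True]]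
    show ?thesis
    proof (elim disjE bexE exE conjE)
      fix v A' B' H
      assume v: "v \<in> sphere 0 1" and c: "convex_body A'" "convex_body B'" "homothetic A' B'" "affine_parallel L H"
        "proj_perp v ` A' = proj_perp v ` (A' \<inter> H)" "stretching v A' A" "stretching v B' B"
      show ?thesis
        by (rule disjI2, rule bexI[OF _ v], rule exI[of _ A'], rule exI[of _ B'], rule exI[of _ H]) (intro conjI c)
    qed (rule disjI1)
  next
    case False
    then have "- ltop (- u) ?B - ltop u ?B \<le> - ltop (- u) ?A - ltop u ?A" by simp
    from stretched_if_normalised[OF u par B nu(1) mu(1) refl refl bs.equality_structure[OF this]]
    show ?thesis
    proof (elim disjE bexE exE conjE)
      fix v A' B' H
      assume v: "v \<in> sphere 0 1" and c: "convex_body A'" "convex_body B'" "homothetic B' A'" "affine_parallel L H"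
        "proj_perp v ` A' = proj_perp v ` (A' \<inter> H)" "stretching v A' A" "stretching v B' B"
      show ?thesis
        by (rule disjI2, rule bexI[OF _ v], rule exI[of _ A'], rule exI[of _ B'], rule exI[of _ H]) (intro conjI c hsym[OF c(3)])
    qed (rule disjI1, rule hsym)
  qed
qed

text \<open>Both cases are instances of two stretched copies of one body: of \<open>A\<close> itself with stretching lengths
  zero, or of \<open>A'\<close>.\<close>
lemma stretched_imp_equality:
  fixes A B :: "'a::euclidean_space set"
  assumes dim: "DIM('a) \<ge> 2" and u: "norm u = 1" and par: "\<And>H. affine_parallel L H \<longleftrightarrow> (\<exists>t. H = {x. x \<bullet> u = t})"
    and A: "convex_body A" and B: "convex_body B" and ab: "\<alpha> > 0" "\<beta> > 0"
    and M: "M = max_section L A" and N: "N = max_section L B"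
    and st: "homothetic A B \<or> (\<exists>v\<in>sphere 0 1. \<exists>A' B' H.
      convex_body A' \<and> convex_body B' \<and> homothetic A' B' \<and> affine_parallel L H \<and>
      proj_perp v ` A' = proj_perp v ` (A' \<inter> H) \<and> stretching v A' A \<and> stretching v B' B)"
  shows "vol ((*\<^sub>R) \<alpha> ` A + (*\<^sub>R) \<beta> ` B) =
      (\<alpha> * M powr (1 / real (DIM('a) - 1)) + \<beta> * N powr (1 / real (DIM('a) - 1))) ^ (DIM('a) - 1) *
      (\<alpha> * (vol A / M) + \<beta> * (vol B / N))"
proof -
  have homD: "\<exists>x r. r > 0 \<and> Y = (\<lambda>y. x + r *\<^sub>R y) ` X" if hom: "homothetic X Y" for X Y :: "'a set"
  proof -
    obtain x r where r: "r > 0" and XY: "X = (\<lambda>y. x + r *\<^sub>R y) ` Y \<or> Y = (\<lambda>y. x + r *\<^sub>R y) ` X"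
      using hom unfolding homothetic_def by blast
    show ?thesis
    proof (cases "Y = (\<lambda>y. x + r *\<^sub>R y) ` X")
      case False
      then have "X = (\<lambda>y. x + r *\<^sub>R y) ` Y" using XY by blast
      then have "Y = (\<lambda>y. - (1 / r) *\<^sub>R x + (1 / r) *\<^sub>R y) ` X"
        using r by (simp add: image_image scaleR_add_right)
      then show ?thesis using r by (intro exI[of _ "- (1 / r) *\<^sub>R x"] exI[of _ "1 / r"]) simp
    qed (use r in blast)
  qed
  have p0: "prism z 0 S = S" for z and S :: "'a set" by (force simp: prism_eq)
  from st show ?thesis
  proof (elim disjE bexE exE conjE)
    assume "homothetic A B"
    then obtain x r where r: "r > 0" "B = (\<lambda>y. x + r *\<^sub>R y) ` A" using homD by blast
    show ?thesis
    proof (rule equality_for_stretched[OF dim u par A ab _ r(1) _ _ _ _ _ M N])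
      show "A = (+) 0 ` prism 0 0 ((*\<^sub>R) 1 ` A)" by (simp add: p0)
      show "B = (+) x ` prism 0 0 ((*\<^sub>R) r ` A)" by (simp add: p0 r(2) image_image)
    qed auto
  next
    fix v A' B' H
    assume v: "v \<in> sphere 0 1" and A': "convex_body A'" and hom: "homothetic A' B'"
      and H: "affine_parallel L H" and proj: "proj_perp v ` A' = proj_perp v ` (A' \<inter> H)"
      and st: "stretching v A' A" "stretching v B' B"
    have nv: "norm v = 1" using v by simp
    obtain x r where r: "r > 0" "B' = (\<lambda>y. x + r *\<^sub>R y) ` A'" using homD[OF hom] by blast
    obtain l1 w1 where A1: "0 \<le> l1" "A = (+) w1 ` prism v l1 A'" using st(1) unfolding stretching_iff by blast
    obtain l2 w2 where B1: "0 \<le> l2" "B = (+) w2 ` prism v l2 B'" using st(2) unfolding stretching_iff by blast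
    obtain h where h: "H = {x. x \<bullet> u = h}" using H par by blast
    have cyl: "\<forall>k\<in>A'. \<exists>s. k + s *\<^sub>R v \<in> slice u A' h"
      using proj unfolding proj_perp_image_section_iff[OF nv] h .
    \<comment> \<open>A body over a section in a direction parallel to \<open>L\<close> would lie in the hyperplane of that section.\<close>
    have vu: "v \<bullet> u \<noteq> 0"
    proof
      assume "v \<bullet> u = 0"
      have "u \<bullet> k = h" if k: "k \<in> A'" for k
      proof -
        obtain s where "k + s *\<^sub>R v \<in> slice u A' h" using cyl k by blast
        then have "(k + s *\<^sub>R v) \<bullet> u = h" by simp
        then show ?thesis using \<open>v \<bullet> u = 0\<close> by (simp add: inner_add_left inner_commute[of u k])
      qed
      then have "A' \<subseteq> {x. u \<bullet> x = h}" by blast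
      moreover have "u \<noteq> 0" using u by auto
      ultimately have "negligible A'" using negligible_hyperplane[of u h] negligible_subset by blast
      then show False using vol_convex_body_pos[OF A'] negligible_imp_measure0 by force
    qed
    \<comment> \<open>Orient the normal of \<open>L\<close> so that \<open>v\<close> points to its positive side.\<close>
    define \<sigma> where "\<sigma> = sgn (v \<bullet> u)"
    have sg: "\<sigma> = 1 \<or> \<sigma> = - 1" using vu by (auto simp: \<sigma>_def sgn_real_def)
    define u' where "u' = \<sigma> *\<^sub>R u"
    have u': "norm u' = 1" using sg u by (auto simp: u'_def)
    have par': "affine_parallel L H \<longleftrightarrow> (\<exists>t. H = {x. x \<bullet> u' = t})" for H
    proof -
      have eq: "{x. x \<bullet> u' = t} = {x. x \<bullet> u = \<sigma> * t}" "\<sigma> * (\<sigma> * t) = t" for t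
        using sg by (auto simp: u'_def)
      show ?thesis unfolding par eq(1) by (metis eq(2))
    qed
    have vu': "0 < v \<bullet> u'" using vu by (simp add: u'_def \<sigma>_def sgn_real_def)
    have sl: "slice u' A' (\<sigma> * h) = slice u A' h" using sg by (auto simp: u'_def)
    show ?thesis
    proof (rule equality_for_stretched[OF dim u' par' A' ab _ r(1) A1(1) B1(1) _ _ _ M N, where ?c1.0 = 1])
      show "A = (+) w1 ` prism v l1 ((*\<^sub>R) 1 ` A')" using A1(2) by simp
      have "prism v l2 ((\<lambda>y. x + r *\<^sub>R y) ` A') = (+) x ` prism v l2 ((*\<^sub>R) r ` A')"
        by (force simp: prism_eq image_iff)
      then show "B = (+) (w2 + x) ` prism v l2 ((*\<^sub>R) r ` A')"
        unfolding B1(2) r(2) by (simp add: image_image add.assoc)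
      show "l1 = 0 \<and> l2 = 0 \<or> 0 < v \<bullet> u' \<and> (\<forall>k\<in>A'. \<exists>s. k + s *\<^sub>R v \<in> slice u' A' (\<sigma> * h))"
        using vu' cyl unfolding sl by blast
    qed simp
  qed
qed

theorem theorem1p4:
  fixes A B L :: "'a::euclidean_space set" and \<alpha> \<beta> M N :: real
  assumes "DIM('a) \<ge> 2"
    and "convex_body A" and "convex_body B"
    and "\<alpha> > 0" and "\<beta> > 0"
    and "subspace L" and "dim L = DIM('a) - 1"
    and "M = max_section L A" and "N = max_section L B"
  shows "measure lebesgue ((*\<^sub>R) \<alpha> ` A + (*\<^sub>R) \<beta> ` B) =
           (\<alpha> * M powr (1 / real (DIM('a) - 1)) + \<beta> * N powr (1 / real (DIM('a) - 1)))
              ^ (DIM('a) - 1) *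
           (\<alpha> * (measure lebesgue A / M) + \<beta> * (measure lebesgue B / N))
         \<longleftrightarrow>
         homothetic A B \<or>
         (\<exists>v\<in>sphere 0 1. \<exists>A' B' H.
            convex_body A' \<and> convex_body B' \<and> homothetic A' B' \<and> affine_parallel L H \<and>
            proj_perp v ` A' = proj_perp v ` (A' \<inter> H) \<and>
            stretching v A' A \<and> stretching v B' B)"
proof -
  obtain u where u: "norm u = 1" "\<And>H. affine_parallel L H \<longleftrightarrow> (\<exists>t. H = {x. x \<bullet> u = t})"
    using hyperplane_unit_normal[OF assms(6,7)] by blast
  show ?thesis
    using equality_imp_stretched[OF assms(1) u assms(2-5,8,9)]
      stretched_imp_equality[OF assms(1) u assms(2-5,8,9)] by (rule iffI)
qed

end
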